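(* In the setting of the context, let $h$ be a $\Lambda$-rational rational function on $\Gamma$ with $h(V)\subset\Lambda$ such that $\tau(\mathbf{D})+\mathrm{div}(h)$ is $G$-admissible. Then $\mathbf{M}_h$ is a free $\mathbf{R}$-module of rank $r+1$, and the reduction map $\mathrm{red}_h\colon\mathbf{M}_h\to\mathbf{U}$ factors through an isomorphism of $\mathbf{k}$-vector spaces $\mathbf{M}_h/\mathbf{m}\mathbf{M}_h\simeq\mathrm{W}_h$. As a consequence, $\mathrm{W}_h$ is a $\mathbf{k}$-vector subspace of $\mathbf{U}$ of dimension $r+1$.
   Context: $\mathbf{K}$ is an algebraically closed field, complete with respect to a nontrivial non-Archimedean valuation $\mathfrak{v}$, with valuation ring $\mathbf{R}$, maximal ideal $\mathbf{m}$, residue field $\mathbf{k}$ and value group $\Lambda=\mathfrak{v}(\mathbf{K}^\times)$. $\mathbf{X}$ is a smooth proper connected curve over $\mathbf{K}$, with Berkovich analytification $\mathbf{X}^{\mathrm{an}}$; points $x\notin\mathbf{X}(\mathbf{K})$ are valuations $\mathfrak{v}_x$ on $\mathbf{K}(\mathbf{X})$ extending $\mathfrak{v}$. $V$ is a semistable vertex set: a finite set of type 2 points with $\mathbf{X}^{\mathrm{an}}\setminus V$ a disjoint union of finitely many open annuli and infinitely many open disks. $\Gamma$ is the union of $V$ and the skeletons of the annuli: a metric graph with model the connected graph $G=(V,E)$, one edge per annulus, of length the modulus (in $\Lambda$). $\tau\colon\mathbf{X}^{\mathrm{an}}\to\Gamma$ is the retraction, extended linearly to divisors. $\mathbf{D}$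 is a divisor on $\mathbf{X}$ and $\mathbf{H}\subseteq\{\mathbf{f}\in\mathbf{K}(\mathbf{X}):\mathrm{div}(\mathbf{f})+\mathbf{D}\ge0\}\cup\{0\}$ is a $\mathbf{K}$-subspace of dimension $r+1$. Divisors on $\Gamma$ are finite formal sums $D=\sum_{x\in\Gamma}D(x)(x)$, $D(x)\in\mathbb{Z}$. Rational functions on $\Gamma$ are continuous real functions, piecewise affine with integral slopes on edges; $\mathrm{div}(h)=\sum_x\mathrm{ord}_x(h)(x)$, with $\mathrm{ord}_x(h)$ the sum of incoming slopes at $x$. $D$ is $G$-admissible if on the interior of each edge it vanishes except possibly at one point, where it has value $1$. $D$ is $\Lambda$-rational if points of its support have distances along their edge to the extremities in $\Lambda$; a rational function $h$ is $\Lambda$-rational if $\mathrm{div}(h)$ is. Fix a group homomorphism $\lambda\mapsto a_\lambda$, $\Lambda\to\mathbf{K}^\times$, with $\mathfrak{v}(a_\lambda)=\lambda$. For $v\in V$ let $\mathbf{k}(v)$ be the residue field of $\mathfrak{v}_v$ and $\mathbf{U}_v\subset\mathbf{k}(v)$ the $\mathbf{k}$-span of the reductions of $a_{\mathfrak{v}_v(\mathbf{f})}^{-1}\mathbf{f}$, $0\ne\mathbf{f}\in\mathbf{H}$; $\mathbf{U}=\bigoplus_{v\in V}\mathbf{U}_v$. Put $\mathbf{M}_h:=\{\mathbf{f}\in\mathbf{H}:\mathfrak{v}_v(\mathbf{f})\ge h(v)\ \forall v\in V\}$, an $\mathbf{R}$-submodule of $\mathbf{H}$. Let $\mathrm{red}_h\colon\mathbf{M}_h\to\mathbf{U}$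 be the map whose $v$-component sends $\mathbf{f}$ to the reduction of $a_{h(v)}^{-1}\mathbf{f}$ in $\mathbf{k}(v)$ (zero if $\mathfrak{v}_v(\mathbf{f})>h(v)$), and $\mathrm{W}_h:=\mathrm{red}_h(\mathbf{M}_h)$. *)

theory Defs
  imports "HOL-Analysis.Analysis" "HOL-Algebra.Finite_Extensions" "HOL-Algebra.Generated_Fields"
begin

section \<open>Modules\<close>

text \<open>Some of the records below are used only as modules; their \<open>mult\<close> and \<open>one\<close> fields
  are then irrelevant.\<close>

definition free_of_rank :: "('a, 'r) ring_scheme \<Rightarrow> ('a, 'b, 'm) module_scheme \<Rightarrow> nat \<Rightarrow> bool" where
  "free_of_rank R M n \<longleftrightarrow> Module.module R M \<and>
     (\<exists>b. b \<in> {..<n} \<rightarrow> carrier M \<and>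
        (\<forall>x\<in>carrier M. \<exists>!c. c \<in> {..<n} \<rightarrow>\<^sub>E carrier R \<and>
            x = (\<Oplus>\<^bsub>M\<^esub>i\<in>{..<n}. c i \<odot>\<^bsub>M\<^esub> b i)))"

definition vector_space_of_dim ::
    "('a, 'r) ring_scheme \<Rightarrow> ('a, 'b, 'm) module_scheme \<Rightarrow> nat \<Rightarrow> bool" where
  "vector_space_of_dim k M n \<longleftrightarrow> Ring.field k \<and> free_of_rank k M n"

definition module_iso ::
    "('a, 'r) ring_scheme \<Rightarrow> ('a, 'b, 'm) module_scheme \<Rightarrow> ('a, 'c, 'n) module_scheme \<Rightarrow> ('b \<Rightarrow> 'c) set"
  where
  "module_iso R M N = {\<phi>. Module.module R M \<and> Module.module R N \<and>
     bij_betw \<phi> (carrier M) (carrier N) \<and>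
     (\<forall>x\<in>carrier M. \<forall>y\<in>carrier M. \<phi> (x \<oplus>\<^bsub>M\<^esub> y) = \<phi> x \<oplus>\<^bsub>N\<^esub> \<phi> y) \<and>
     (\<forall>c\<in>carrier R. \<forall>x\<in>carrier M. \<phi> (c \<odot>\<^bsub>M\<^esub> x) = c \<odot>\<^bsub>N\<^esub> \<phi> x)}"

definition submodule_span ::
    "('a, 'r) ring_scheme \<Rightarrow> ('a, 'b, 'm) module_scheme \<Rightarrow> 'b set \<Rightarrow> 'b set" where
  "submodule_span R M S = \<Inter>{N. submodule N R M \<and> S \<subseteq> N}"

definition ideal_times_module ::
    "('a, 'r) ring_scheme \<Rightarrow> 'a set \<Rightarrow> ('a, 'b, 'm) module_scheme \<Rightarrow> 'b set" where
  "ideal_times_module R I M = submodule_span R M {c \<odot>\<^bsub>M\<^esub> x | c x. c \<in> I \<and> x \<in> carrier M}"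

text \<open>The module \<open>M / I M\<close> over \<open>R Quot I\<close>; as for \<^const>\<open>rcoset_mult\<close>, the scalar product of two
  cosets is a union of identical cosets.\<close>
definition reduced_module ::
    "('a, 'r) ring_scheme \<Rightarrow> 'a set \<Rightarrow> ('a, 'b, 'm) module_scheme \<Rightarrow> ('a set, 'b set) module" where
  "reduced_module R I M = (let N = ideal_times_module R I M in
     \<lparr>carrier = a_rcosets\<^bsub>M\<^esub> N, monoid.mult = (\<lambda>_ _. N), monoid.one = N,
      ring.zero = N, ring.add = set_add M,
      module.smult = (\<lambda>C Y. \<Union>c\<in>C. \<Union>y\<in>Y. N +>\<^bsub>M\<^esub> (c \<odot>\<^bsub>M\<^esub> y))\<rparr>)"


section \<open>Valuations on fields\<close>

text \<open>A valuation lives on the nonzero elements of a field. The value at \<open>0\<close> is meaningless (it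
  should be infinite); fixing it makes a valuation unique as a function.\<close>
definition valuation :: "('a::field \<Rightarrow> 'g::linordered_ab_group_add) \<Rightarrow> bool" where
  "valuation w \<longleftrightarrow> w 0 = 0 \<and>
     (\<forall>x y. x \<noteq> 0 \<longrightarrow> y \<noteq> 0 \<longrightarrow> w (x * y) = w x + w y) \<and>
     (\<forall>x y. x \<noteq> 0 \<longrightarrow> y \<noteq> 0 \<longrightarrow> x + y \<noteq> 0 \<longrightarrow> min (w x) (w y) \<le> w (x + y))"

definition val_ge :: "('a::field \<Rightarrow> 'g::linordered_ab_group_add) \<Rightarrow> 'a \<Rightarrow> 'g \<Rightarrow> bool" where
  "val_ge w x s \<longleftrightarrow> x = 0 \<or> s \<le> w x"

definition val_gt :: "('a::field \<Rightarrow> 'g::linordered_ab_group_add) \<Rightarrow> 'a \<Rightarrow> 'g \<Rightarrow> bool" where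
  "val_gt w x s \<longleftrightarrow> x = 0 \<or> s < w x"

definition val_abs :: "('a::field \<Rightarrow> real) \<Rightarrow> 'a \<Rightarrow> real" where
  "val_abs w x = (if x = 0 then 0 else exp (- w x))"

definition value_group :: "('a::field \<Rightarrow> real) \<Rightarrow> real set" where
  "value_group w = w ` {x. x \<noteq> 0}"

definition complete_valuation :: "('a::field \<Rightarrow> real) \<Rightarrow> bool" where
  "complete_valuation w \<longleftrightarrow>
     (\<forall>s. (\<forall>\<epsilon>>0. \<exists>N. \<forall>m\<ge>N. \<forall>n\<ge>N. val_abs w (s m - s n) < \<epsilon>) \<longrightarrow>
          (\<exists>l. (\<lambda>n. val_abs w (s n - l)) \<longlonglongrightarrow> 0))"

definition val_ring :: "('a::field \<Rightarrow> real) \<Rightarrow> 'a ring" where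
  "val_ring w = \<lparr>carrier = {x. val_ge w x 0}, monoid.mult = (*), monoid.one = 1,
     ring.zero = 0, ring.add = (+)\<rparr>"

definition val_ideal :: "('a::field \<Rightarrow> real) \<Rightarrow> 'a set" where
  "val_ideal w = {x. val_gt w x 0}"

definition residue_field :: "('a::field \<Rightarrow> real) \<Rightarrow> 'a set ring" where
  "residue_field w = val_ring w Quot val_ideal w"

definition reduction :: "('a::field \<Rightarrow> real) \<Rightarrow> 'a \<Rightarrow> 'a set" where
  "reduction w x = val_ideal w +>\<^bsub>val_ring w\<^esub> x"


section \<open>Curves and their analytification\<close>

text \<open>A smooth proper connected curve over an algebraically closed field is given by its function
  field \<open>'f\<close>, with \<open>e\<close> the embedding of the constants; its closed points are the places of
  \<open>'f\<close> (the abstract nonsingular complete curve). Here \<open>P :: 'f \<Rightarrow> int\<close> is the order of vanishing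
  at the closed point.\<close>

definition field_embedding :: "('k::field \<Rightarrow> 'f::field) \<Rightarrow> bool" where
  "field_embedding e \<longleftrightarrow> e 1 = 1 \<and> (\<forall>x y. e (x + y) = e x + e y) \<and> (\<forall>x y. e (x * y) = e x * e y)"

definition peval :: "('k::field \<Rightarrow> 'f::field) \<Rightarrow> 'k poly \<Rightarrow> 'f \<Rightarrow> 'f" where
  "peval e p x = poly (map_poly e p) x"

definition simple_subfield :: "('k::field \<Rightarrow> 'f::field) \<Rightarrow> 'f \<Rightarrow> 'f set" where
  "simple_subfield e x = {peval e p x / peval e q x | p q. peval e q x \<noteq> 0}"

definition function_field :: "('k::field \<Rightarrow> 'f::field) \<Rightarrow> bool" where
  "function_field e \<longleftrightarrow> field_embedding e \<and>
     (\<exists>x. (\<forall>p. p \<noteq> 0 \<longrightarrow> peval e p x \<noteq> 0) \<and>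
        (\<exists>B. finite B \<and> (\<forall>f. \<exists>c. c ` B \<subseteq> simple_subfield e x \<and> f = (\<Sum>b\<in>B. c b * b))))"

definition analytic_curve :: "('k::alg_closed_field \<Rightarrow> real) \<Rightarrow> ('k \<Rightarrow> 'f::field) \<Rightarrow> bool" where
  "analytic_curve v e \<longleftrightarrow> valuation v \<and> (\<exists>c. c \<noteq> 0 \<and> v c \<noteq> 0) \<and> complete_valuation v \<and>
     function_field e"

datatype 'f an_point = Closed "'f \<Rightarrow> int" | Val "'f \<Rightarrow> real"

text \<open>The valuation of a point that is not closed.\<close>
primrec pt_val :: "'f an_point \<Rightarrow> 'f \<Rightarrow> real" where
  "pt_val (Val w) = w"
| "pt_val (Closed P) = undefined"

primrec regular_at :: "'f::field an_point \<Rightarrow> 'f \<Rightarrow> bool" where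
  "regular_at (Val w) f \<longleftrightarrow> True"
| "regular_at (Closed P) f \<longleftrightarrow> val_ge P f 0"

definition gauss_norm :: "('k::field \<Rightarrow> real) \<Rightarrow> real \<Rightarrow> 'k poly \<Rightarrow> real" where
  "gauss_norm v \<rho> p = (MAX i\<in>{..Polynomial.degree p}. val_abs v (Polynomial.coeff p i) * \<rho> ^ i)"

text \<open>Points of the Berkovich affine line: multiplicative seminorms on polynomials.\<close>
definition line_points :: "('k::field \<Rightarrow> real) \<Rightarrow> ('k poly \<Rightarrow> real) set" where
  "line_points v = {\<eta>. (\<forall>p. 0 \<le> \<eta> p) \<and> (\<forall>c. \<eta> [:c:] = val_abs v c) \<and>
     (\<forall>p q. \<eta> (p * q) = \<eta> p * \<eta> q) \<and> (\<forall>p q. \<eta> (p + q) \<le> max (\<eta> p) (\<eta> q))}"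

definition line_topology :: "('k::field \<Rightarrow> real) \<Rightarrow> ('k poly \<Rightarrow> real) topology" where
  "line_topology v = topology_generated_by
     {{\<eta> \<in> line_points v. \<alpha> < \<eta> p \<and> \<eta> p < \<beta>} | p \<alpha> \<beta>. True}"

definition standard_disk :: "('k::field \<Rightarrow> real) \<Rightarrow> ('k poly \<Rightarrow> real) set" where
  "standard_disk v = {\<eta> \<in> line_points v. \<eta> [:0, 1:] < 1}"

definition standard_annulus :: "('k::field \<Rightarrow> real) \<Rightarrow> 'k \<Rightarrow> ('k poly \<Rightarrow> real) set" where
  "standard_annulus v c = {\<eta> \<in> line_points v. val_abs v c < \<eta> [:0, 1:] \<and> \<eta> [:0, 1:] < 1}"

context
  fixes v :: "'k::field \<Rightarrow> real" and e :: "'k \<Rightarrow> 'f::field"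
begin

definition places :: "('f \<Rightarrow> int) set" where
  "places = {P. valuation P \<and> (\<forall>c. P (e c) = 0) \<and> P ` {f. f \<noteq> 0} = UNIV}"

definition an_points :: "'f an_point set" where
  "an_points = Closed ` places \<union> Val ` {w. valuation w \<and> (\<forall>c. w (e c) = v c)}"

text \<open>The absolute value of a function at a point; at a closed point it is that of the value
  in \<open>'k\<close>, and is only meaningful for functions regular there.\<close>
primrec pt_abs :: "'f an_point \<Rightarrow> 'f \<Rightarrow> real" where
  "pt_abs (Val w) f = val_abs w f"
| "pt_abs (Closed P) f = val_abs v (THE c. val_gt P (f - e c) 0)"

text \<open>The affine open subsets of the curve are the complements of nonempty finite sets \<open>S\<close> of
  closed points. On the analytification of each, the topology is the coarsest one making the
  absolute values of its regular functions continuous.\<close>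
definition an_topology :: "'f an_point topology" where
  "an_topology = topology_generated_by
     {{x \<in> an_points - Closed ` S. \<alpha> < pt_abs x f \<and> pt_abs x f < \<beta>} | S f \<alpha> \<beta>.
        finite S \<and> S \<noteq> {} \<and> S \<subseteq> places \<and> (\<forall>P\<in>places - S. val_ge P f 0)}"

text \<open>An element of the completed residue field at \<open>x\<close> is represented by a Cauchy
  sequence of functions regular at \<open>x\<close>; \<open>lim_abs\<close> is its absolute value.\<close>
definition cauchy_at :: "'f an_point \<Rightarrow> (nat \<Rightarrow> 'f) \<Rightarrow> bool" where
  "cauchy_at x s \<longleftrightarrow> (\<forall>n. regular_at x (s n)) \<and>
     (\<forall>\<epsilon>>0. \<exists>N. \<forall>m\<ge>N. \<forall>n\<ge>N. pt_abs x (s m - s n) < \<epsilon>)"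

definition lim_abs :: "'f an_point \<Rightarrow> (nat \<Rightarrow> 'f) \<Rightarrow> real" where
  "lim_abs x s = lim (\<lambda>n. pt_abs x (s n))"

text \<open>Analytic functions in the sense of Berkovich: they assign to each point an element of its
  completed residue field, and are locally uniform limits of rational functions without poles.\<close>
definition analytic_function :: "'f an_point set \<Rightarrow> ('f an_point \<Rightarrow> nat \<Rightarrow> 'f) \<Rightarrow> bool" where
  "analytic_function U t \<longleftrightarrow> (\<forall>x\<in>U. cauchy_at x (t x) \<and>
     (\<exists>W. openin an_topology W \<and> x \<in> W \<and> W \<subseteq> U \<and>
        (\<forall>\<epsilon>>0. \<exists>g. \<forall>y\<in>W. regular_at y g \<and> lim_abs y (\<lambda>n. t y n - g) < \<epsilon>)))"

text \<open>The image of a point under the morphism to the affine line with coordinate \<open>t\<close>.\<close>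
definition line_image :: "('f an_point \<Rightarrow> nat \<Rightarrow> 'f) \<Rightarrow> 'f an_point \<Rightarrow> 'k poly \<Rightarrow> real" where
  "line_image t x = (\<lambda>p. lim_abs x (\<lambda>n. peval e p (t x n)))"

text \<open>The analytic function \<open>t\<close> defines an isomorphism of the open subset \<open>U\<close> with the open
  subset \<open>B\<close> of the affine line: a homeomorphism whose inverse is analytic as well, that is, pulls
  back each regular function \<open>f\<close> to a locally uniform limit of rational functions \<open>p(t)/q(t)\<close>.
  The approximation is expressed on \<open>U\<close>, where both sides live.\<close>
definition analytic_iso ::
    "'f an_point set \<Rightarrow> ('f an_point \<Rightarrow> nat \<Rightarrow> 'f) \<Rightarrow> ('k poly \<Rightarrow> real) set \<Rightarrow> bool" where
  "analytic_iso U t B \<longleftrightarrow> openin an_topology U \<and> analytic_function U t \<and>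
     homeomorphic_map (subtopology an_topology U) (subtopology (line_topology v) B)
       (line_image t) \<and>
     (\<forall>x\<in>U. \<forall>f. regular_at x f \<longrightarrow> (\<exists>W.
        openin an_topology W \<and> x \<in> W \<and> W \<subseteq> U \<and>
        (\<forall>\<epsilon>>0. \<exists>p q. \<forall>y\<in>W. regular_at y f \<and> line_image t y q \<noteq> 0 \<and>
           lim_abs y (\<lambda>n. f - peval e p (t y n) / peval e q (t y n)) < \<epsilon>)))"

definition open_disk :: "'f an_point set \<Rightarrow> bool" where
  "open_disk U \<longleftrightarrow> (\<exists>t. analytic_iso U t (standard_disk v))"

definition annulus_chart :: "'f an_point set \<Rightarrow> ('f an_point \<Rightarrow> nat \<Rightarrow> 'f) \<Rightarrow> 'k \<Rightarrow> bool" where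
  "annulus_chart U t c \<longleftrightarrow> c \<noteq> 0 \<and> 0 < v c \<and> analytic_iso U t (standard_annulus v c)"

definition open_annulus :: "'f an_point set \<Rightarrow> bool" where
  "open_annulus U \<longleftrightarrow> (\<exists>t c. annulus_chart U t c)"

definition constant_residues :: "('f \<Rightarrow> real) \<Rightarrow> 'f set set" where
  "constant_residues w = (\<lambda>c. reduction w (e c)) ` carrier (val_ring v)"

text \<open>Type 2: the residue field has transcendence degree 1 over that of the ground field.\<close>
definition type2 :: "'f an_point \<Rightarrow> bool" where
  "type2 x \<longleftrightarrow> x \<in> an_points \<and> (\<exists>w. x = Val w \<and>
     (\<exists>u\<in>carrier (residue_field w).
        ring.transcendental (residue_field w) (constant_residues w) u \<and>
        (\<forall>y\<in>carrier (residue_field w). ring.algebraic (residue_field w)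
           (generate_field (residue_field w) (insert u (constant_residues w))) y)))"


section \<open>Semistable vertex sets and skeletons\<close>

definition vertex_complement_components :: "'f an_point set \<Rightarrow> 'f an_point set set" where
  "vertex_complement_components V =
     connected_components_of (subtopology an_topology (an_points - V))"

definition semistable_vertex_set :: "'f an_point set \<Rightarrow> bool" where
  "semistable_vertex_set V \<longleftrightarrow> finite V \<and> (\<forall>x\<in>V. type2 x) \<and>
     (\<forall>C\<in>vertex_complement_components V. open_disk C \<or> open_annulus C) \<and>
     finite {C \<in> vertex_complement_components V. open_annulus C} \<and>
     infinite {C \<in> vertex_complement_components V. open_disk C}"

definition edges :: "'f an_point set \<Rightarrow> 'f an_point set set" where
  "edges V = {C \<in> vertex_complement_components V. open_annulus C}"

text \<open>The skeleton of an annulus and its metric do not depend on the chart, except that the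
  orientation may be reversed.\<close>
definition edge_chart :: "'f an_point set \<Rightarrow> ('f an_point \<Rightarrow> nat \<Rightarrow> 'f) \<times> 'k" where
  "edge_chart A = (SOME (t, c). annulus_chart A t c)"

definition edge_length :: "'f an_point set \<Rightarrow> real" where
  "edge_length A = v (snd (edge_chart A))"

definition edge_interior_pt :: "'f an_point set \<Rightarrow> real \<Rightarrow> 'f an_point" where
  "edge_interior_pt A s = (THE x. x \<in> A \<and>
     line_image (fst (edge_chart A)) x = gauss_norm v (exp (- s)))"

text \<open>The parametrization by arc length, on \<open>{0..edge_length A}\<close>, of the closure of the skeleton of
  \<open>A\<close>. The extremities, which may coincide, are the limits in the analytification.\<close>
definition edge_pt :: "'f an_point set \<Rightarrow> real \<Rightarrow> 'f an_point" where
  "edge_pt A s = (if s \<in> {0<..<edge_length A} then edge_interior_pt A s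
     else THE y. limitin an_topology (edge_interior_pt A) y (at s within {0<..<edge_length A}))"

definition skeleton :: "'f an_point set \<Rightarrow> 'f an_point set" where
  "skeleton V = V \<union> (\<Union>A\<in>edges V. edge_pt A ` {0<..<edge_length A})"

text \<open>A point outside the skeleton lies in an open disk, the component of the complement,
  whose boundary is one point of the skeleton.\<close>
definition retraction :: "'f an_point set \<Rightarrow> 'f an_point \<Rightarrow> 'f an_point" where
  "retraction V x = (if x \<in> skeleton V then x else THE y. an_topology frontier_of
     (connected_component_of_set (subtopology an_topology (an_points - skeleton V)) x) = {y})"


section \<open>Divisors and rational functions on the curve and on the skeleton\<close>

definition is_divisor :: "(('f \<Rightarrow> int) \<Rightarrow> int) \<Rightarrow> bool" where
  "is_divisor D \<longleftrightarrow> finite {P. D P \<noteq> 0} \<and> {P. D P \<noteq> 0} \<subseteq> places"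

definition riemann_roch_space :: "(('f \<Rightarrow> int) \<Rightarrow> int) \<Rightarrow> 'f set" where
  "riemann_roch_space D = {f. f \<noteq> 0 \<longrightarrow> (\<forall>P\<in>places. 0 \<le> P f + D P)}"

definition retract_divisor ::
    "'f an_point set \<Rightarrow> (('f \<Rightarrow> int) \<Rightarrow> int) \<Rightarrow> 'f an_point \<Rightarrow> int" where
  "retract_divisor V D x = (\<Sum>P | D P \<noteq> 0 \<and> retraction V (Closed P) = x. D P)"

definition piecewise_affine :: "real \<Rightarrow> (real \<Rightarrow> real) \<Rightarrow> bool" where
  "piecewise_affine l g \<longleftrightarrow> (\<exists>B. finite B \<and>
     (\<forall>\<alpha> \<beta>. 0 \<le> \<alpha> \<and> \<alpha> < \<beta> \<and> \<beta> \<le> l \<and> {\<alpha><..<\<beta>} \<inter> B = {} \<longrightarrow>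
        (\<exists>(m::int) b. \<forall>s\<in>{\<alpha>..\<beta>}. g s = of_int m * s + b)))"

definition graph_rational_function :: "'f an_point set \<Rightarrow> ('f an_point \<Rightarrow> real) \<Rightarrow> bool" where
  "graph_rational_function V h \<longleftrightarrow>
     continuous_map (subtopology an_topology (skeleton V)) euclideanreal h \<and>
     (\<forall>A\<in>edges V. piecewise_affine (edge_length A) (\<lambda>s. h (edge_pt A s)))"

definition left_slope :: "(real \<Rightarrow> real) \<Rightarrow> real \<Rightarrow> int" where
  "left_slope g s = (THE m. (g has_real_derivative of_int m) (at_left s))"

definition right_slope :: "(real \<Rightarrow> real) \<Rightarrow> real \<Rightarrow> int" where
  "right_slope g s = (THE m. (g has_real_derivative of_int m) (at_right s))"

text \<open>Sum of the incoming slopes over all directions at \<open>x\<close>: each parameter of \<open>x\<close> on an edge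
  gives one direction for each side on which the edge continues (so a loop gives two
  directions at its vertex).\<close>
definition graph_div :: "'f an_point set \<Rightarrow> ('f an_point \<Rightarrow> real) \<Rightarrow> 'f an_point \<Rightarrow> int" where
  "graph_div V h x = (\<Sum>A\<in>edges V.
     (\<Sum>s | s \<in> {0<..edge_length A} \<and> edge_pt A s = x. left_slope (\<lambda>s. h (edge_pt A s)) s) -
     (\<Sum>s | s \<in> {0..<edge_length A} \<and> edge_pt A s = x. right_slope (\<lambda>s. h (edge_pt A s)) s))"

definition admissible :: "'f an_point set \<Rightarrow> ('f an_point \<Rightarrow> int) \<Rightarrow> bool" where
  "admissible V D \<longleftrightarrow> (\<forall>A\<in>edges V.
     (\<forall>s\<in>{0<..<edge_length A}. D (edge_pt A s) = 0) \<or>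
     (\<exists>s\<in>{0<..<edge_length A}. D (edge_pt A s) = 1 \<and>
        (\<forall>s'\<in>{0<..<edge_length A} - {s}. D (edge_pt A s') = 0)))"

definition rational_divisor :: "'f an_point set \<Rightarrow> ('f an_point \<Rightarrow> int) \<Rightarrow> bool" where
  "rational_divisor V D \<longleftrightarrow> (\<forall>A\<in>edges V. \<forall>s\<in>{0..edge_length A}. D (edge_pt A s) \<noteq> 0 \<longrightarrow>
     s \<in> value_group v \<and> edge_length A - s \<in> value_group v)"


section \<open>Reductions of spaces of functions\<close>

text \<open>The residue field of \<open>w\<close> as a vector space over that of \<open>v\<close>; \<open>C\<close> acts as the class of \<open>e c\<close>
  for any representative \<open>c\<close>.\<close>
definition residue_space :: "('f \<Rightarrow> real) \<Rightarrow> ('k set, 'f set) module" where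
  "residue_space w = (let \<kappa> = residue_field w in
     \<lparr>carrier = carrier \<kappa>, monoid.mult = monoid.mult \<kappa>, monoid.one = monoid.one \<kappa>,
      ring.zero = ring.zero \<kappa>, ring.add = ring.add \<kappa>,
      module.smult = (\<lambda>C u. (\<Union>c\<in>C. reduction w (e c)) \<otimes>\<^bsub>\<kappa>\<^esub> u)\<rparr>)"

definition reduced_span :: "(real \<Rightarrow> 'k) \<Rightarrow> 'f set \<Rightarrow> 'f an_point \<Rightarrow> 'f set set" where
  "reduced_span a H x = submodule_span (residue_field v) (residue_space (pt_val x))
     {reduction (pt_val x) (e (inverse (a (pt_val x f))) * f) | f. f \<in> H \<and> f \<noteq> 0}"

definition reduced_sum ::
    "'f an_point set \<Rightarrow> (real \<Rightarrow> 'k) \<Rightarrow> 'f set \<Rightarrow> ('k set, 'f an_point \<Rightarrow> 'f set) module" where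
  "reduced_sum V a H =
     \<lparr>carrier = (\<Pi>\<^sub>E x\<in>V. reduced_span a H x),
      monoid.mult = (\<lambda>u u'. \<lambda>x\<in>V. u x \<otimes>\<^bsub>residue_space (pt_val x)\<^esub> u' x),
      monoid.one = (\<lambda>x\<in>V. \<one>\<^bsub>residue_space (pt_val x)\<^esub>),
      ring.zero = (\<lambda>x\<in>V. \<zero>\<^bsub>residue_space (pt_val x)\<^esub>),
      ring.add = (\<lambda>u u'. \<lambda>x\<in>V. u x \<oplus>\<^bsub>residue_space (pt_val x)\<^esub> u' x),
      module.smult = (\<lambda>C u. \<lambda>x\<in>V. C \<odot>\<^bsub>residue_space (pt_val x)\<^esub> u x)\<rparr>"

definition M_mod :: "'f an_point set \<Rightarrow> 'f set \<Rightarrow> ('f an_point \<Rightarrow> real) \<Rightarrow> ('k, 'f) module" where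
  "M_mod V H h = \<lparr>carrier = {f \<in> H. \<forall>x\<in>V. val_ge (pt_val x) f (h x)}, monoid.mult = (*), monoid.one = 1,
     ring.zero = 0, ring.add = (+), module.smult = (\<lambda>c f. e c * f)\<rparr>"

definition red_map ::
    "'f an_point set \<Rightarrow> (real \<Rightarrow> 'k) \<Rightarrow> ('f an_point \<Rightarrow> real) \<Rightarrow> 'f \<Rightarrow> 'f an_point \<Rightarrow> 'f set" where
  "red_map V a h f = (\<lambda>x\<in>V. reduction (pt_val x) (e (inverse (a (h x))) * f))"

definition W_set ::
    "'f an_point set \<Rightarrow> (real \<Rightarrow> 'k) \<Rightarrow> 'f set \<Rightarrow> ('f an_point \<Rightarrow> real) \<Rightarrow> ('f an_point \<Rightarrow> 'f set) set"
  where
  "W_set V a H h = red_map V a h ` carrier (M_mod V H h)"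

end

end

theory Submission
  imports Defs "HOL-Computational_Algebra.Fraction_Field"
begin

text \<open>Let \<open>\<Lambda>\<close> be the value group of \<open>v\<close>. On \<open>H\<close> the function \<open>N(f) = Min {v\<^sub>x(f) - h(x) | x \<in> V}\<close> is a norm
  (written additively), and \<open>M_mod e V H h\<close> is its unit ball \<open>N \<ge> 0\<close>. Everything follows from an
  orthonormal basis: elements \<open>b i\<close> of \<open>H\<close> with \<open>N(b i) = 0\<close> whose coordinate functionals \<open>\<phi> i\<close>
  satisfy \<open>v(\<phi> i g) \<ge> N(g)\<close>. The \<open>b i\<close> are then a basis of the unit ball over the valuation ring.
  The kernel of the reduction map is the set where \<open>v\<^sub>x(f) > h(x)\<close> for all \<open>x\<close>, that is \<open>N(f) > 0\<close>, because
  \<open>V\<close> is finite and nonempty. As \<open>N(f)\<close> lies in \<open>\<Lambda>\<close>, such an \<open>f\<close> is \<open>c g\<close> with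
  \<open>v(c) = N(f) > 0\<close> and \<open>g\<close> in the unit ball, so the kernel is the maximal ideal times the unit ball
  (\<open>Mplus_factor\<close>, \<open>mM_eq\<close>). The remaining claims are formal (\<open>reduction_theorem\<close>).

  Orthonormal bases are built one vector at a time, as in the Gram-Schmidt process
  (\<open>orthonormal_extend\<close>), as soon as each nonzero \<open>f \<in> H\<close> has a linear functional \<open>\<phi> : H \<rightarrow> K\<close> with
  \<open>v(\<phi> g) \<ge> N(g)\<close> for all \<open>g\<close> and equality for \<open>g = f\<close>. Since the minimum \<open>N(f)\<close> is attained at some vertex,
  it suffices to find such a functional for a single valuation \<open>w = v\<^sub>x\<close> of type 2
  (\<open>dominated_functional\<close>). The functional is the evaluation at a closed point of the curve that
  specializes to a generic point of the residue curve at \<open>x\<close>. To construct it algebraically, choose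
  \<open>t\<close> whose reduction is transcendental. Then the function field is finite over \<open>K(t)\<close>, on which \<open>w\<close> is the
  Gauss valuation, and evaluation at a sufficiently general \<open>t = a\<close> with \<open>v(a) = 0\<close> does not lower the
  value of finitely many given rational functions (\<open>generic_point\<close>). There is a \<open>y\<close> with \<open>w(y) = 0\<close>
  such that every function of nonnegative value becomes integral over the valuation ring of \<open>K(t)\<close> after
  multiplication by a power of \<open>y\<close> (\<open>integral_localization\<close>), and at a closed point
  over \<open>t = a\<close> the integral functions have values in the valuation ring of \<open>K\<close>
  (\<open>bounded_integral_place\<close>). By a Newton polygon argument on its minimal equation, \<open>z = y\<^sup>n\<^sup>+\<^sup>1 f\<close>
  has a unit value at some closed point over \<open>t = a\<close>, if \<open>f\<close> is scaled to \<open>w(f) = 0\<close>. There \<open>y\<close> and \<open>f\<close>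
  have unit values too, and functions \<open>g\<close> with \<open>w(g) \<ge> 0\<close> have values in the valuation ring.

  That \<open>V\<close> is nonempty is a compactness statement (\<open>semistable_vertex_set_nonempty\<close>). Otherwise the
  analytification would be a disjoint union of infinitely many open sets. Points chosen in infinitely many
  of them have a cluster point in the space of all functions from the function field
  to \<open>[0, \<infinity>]\<close>; it is again a point of the analytification, and its component contains
  infinitely many of the chosen points, which is absurd.\<close>

section \<open>Valuations\<close>

lemma valuation_mult: "valuation w \<Longrightarrow> x \<noteq> 0 \<Longrightarrow> y \<noteq> 0 \<Longrightarrow> w (x * y) = w x + w y"
  by (auto simp: valuation_def)

lemma valuation_one: assumes "valuation w" shows "w 1 = 0"
  using valuation_mult[OF assms, of 1 1] by simp

lemma valuation_uminus: assumes "valuation w" shows "w (- x) = w x"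
proof -
  have "w (-1) + w (-1) = 0"
    using valuation_mult[OF assms, of "-1" "-1"] valuation_one[OF assms] by simp
  then have "w (-1) = 0" by simp
  then show ?thesis
    using valuation_mult[OF assms, of "-1" x] by (cases "x = 0") auto
qed

lemma valuation_inverse: assumes "valuation w" shows "w (inverse x) = - w x"
proof (cases "x = 0")
  case False
  then show ?thesis
    using valuation_mult[OF assms, of "inverse x" x] valuation_one[OF assms]
    by (simp add: eq_neg_iff_add_eq_0)
qed (use assms in \<open>auto simp: valuation_def\<close>)

lemma valuation_divide: "valuation w \<Longrightarrow> x \<noteq> 0 \<Longrightarrow> y \<noteq> 0 \<Longrightarrow> w (x / y) = w x - w y"
  by (simp add: divide_inverse valuation_mult valuation_inverse)

lemma valuation_power: "valuation w \<Longrightarrow> x \<noteq> 0 \<Longrightarrow> w (x ^ n) = of_nat n * (w x :: real)"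
  by (induction n) (auto simp: valuation_one valuation_mult algebra_simps)

lemma val_ge_0 [simp]: "val_ge w 0 s" by (simp add: val_ge_def)
lemma val_gt_0 [simp]: "val_gt w 0 s" by (simp add: val_gt_def)

lemma val_gt_imp_ge: "val_gt w x s \<Longrightarrow> val_ge w x s"
  by (auto simp: val_gt_def val_ge_def)

lemma val_ge_trans: "val_ge w x s \<Longrightarrow> s' \<le> s \<Longrightarrow> val_ge w x s'"
  by (auto simp: val_ge_def)

lemma val_ge_mult: "valuation w \<Longrightarrow> val_ge w x s \<Longrightarrow> val_ge w y s' \<Longrightarrow> val_ge w (x * y) (s + s')"
  by (cases "x = 0 \<or> y = 0") (auto simp: val_ge_def valuation_mult intro: add_mono)

lemma val_gt_mult_left:
  "valuation w \<Longrightarrow> val_gt w x s \<Longrightarrow> val_ge w y s' \<Longrightarrow> val_gt w (x * y) (s + s')"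
  by (cases "x = 0 \<or> y = 0") (auto simp: val_gt_def val_ge_def valuation_mult intro: add_less_le_mono)

lemma val_ge_mult0: "valuation w \<Longrightarrow> val_ge w x 0 \<Longrightarrow> val_ge w y 0 \<Longrightarrow> val_ge w (x * y) 0"
  using val_ge_mult[of w x 0 y 0] by simp

lemma val_ge_add:
  assumes "valuation w" "val_ge w x s" "val_ge w y s" shows "val_ge w (x + y) s"
proof (cases "x = 0 \<or> y = 0 \<or> x + y = 0")
  case False
  then have "min (w x) (w y) \<le> w (x + y)" using assms by (auto simp: valuation_def)
  then show ?thesis using assms False by (auto simp: val_ge_def min_def split: if_splits)
qed (use assms in \<open>auto simp: val_ge_def\<close>)

lemma val_gt_add:
  assumes "valuation w" "val_gt w x s" "val_gt w y s" shows "val_gt w (x + y) s"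
proof (cases "x = 0 \<or> y = 0 \<or> x + y = 0")
  case False
  then have "min (w x) (w y) \<le> w (x + y)" using assms by (auto simp: valuation_def)
  then show ?thesis using assms False by (auto simp: val_gt_def min_def split: if_splits)
qed (use assms in \<open>auto simp: val_gt_def\<close>)

lemma val_ge_uminus [simp]: "valuation w \<Longrightarrow> val_ge w (- x) s = val_ge w x s"
  by (simp add: val_ge_def valuation_uminus)

lemma val_gt_uminus [simp]: "valuation w \<Longrightarrow> val_gt w (- x) s = val_gt w x s"
  by (simp add: val_gt_def valuation_uminus)

lemma val_ge_diff: "valuation w \<Longrightarrow> val_ge w x s \<Longrightarrow> val_ge w y s \<Longrightarrow> val_ge w (x - y) s"
  using val_ge_add[of w x s "- y"] by simp

lemma val_gt_diff: "valuation w \<Longrightarrow> val_gt w x s \<Longrightarrow> val_gt w y s \<Longrightarrow> val_gt w (x - y) s"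
  using val_gt_add[of w x s "- y"] by simp

lemma val_ge_sum:
  "valuation w \<Longrightarrow> (\<And>i. i \<in> I \<Longrightarrow> val_ge w (f i) s) \<Longrightarrow> val_ge w (sum f I) s"
  by (induction I rule: infinite_finite_induct) (auto intro: val_ge_add)

lemma val_gt_sum:
  "valuation w \<Longrightarrow> (\<And>i. i \<in> I \<Longrightarrow> val_gt w (f i) s) \<Longrightarrow> val_gt w (sum f I) s"
  by (induction I rule: infinite_finite_induct) (auto intro: val_gt_add)

lemma val_ge_one: "valuation w \<Longrightarrow> val_ge w 1 0"
  by (simp add: val_ge_def valuation_one)

lemma val_ge_power: "valuation w \<Longrightarrow> val_ge w x 0 \<Longrightarrow> val_ge w (x ^ n) 0"
  by (induction n) (auto intro: val_ge_one val_ge_mult0)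

lemma valuation_add_dominant:
  assumes "valuation w" "x \<noteq> 0" "val_gt w y (w x)"
  shows "x + y \<noteq> 0" "w (x + y) = w x"
proof -
  have "\<not> val_gt w x (w x)" using assms by (simp add: val_gt_def)
  then show n: "x + y \<noteq> 0"
    using val_gt_uminus[OF assms(1), of y "w x"] assms(3) by (metis add.commute add_eq_0_iff)
  have "val_ge w (x + y) (w x)"
    using assms by (intro val_ge_add val_gt_imp_ge[OF assms(3)]) (auto simp: val_ge_def)
  moreover have "\<not> val_gt w (x + y) (w x)"
    using val_gt_diff[OF assms(1) _ assms(3), of "x + y"] \<open>\<not> val_gt w x (w x)\<close> by auto
  ultimately show "w (x + y) = w x" using n by (auto simp: val_ge_def val_gt_def)
qed

lemma valuation_sum_dominant:
  assumes "valuation w" "finite I" "j \<in> I" "f j \<noteq> 0" "\<And>i. i \<in> I \<Longrightarrow> i \<noteq> j \<Longrightarrow> val_gt w (f i) (w (f j))"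
  shows "sum f I \<noteq> 0" "w (sum f I) = w (f j)"
proof -
  have "sum f I = f j + sum f (I - {j})" using assms by (simp add: sum.remove)
  moreover have "val_gt w (sum f (I - {j})) (w (f j))"
    using assms by (intro val_gt_sum) auto
  ultimately show "sum f I \<noteq> 0" "w (sum f I) = w (f j)"
    using valuation_add_dominant[OF assms(1,4)] by auto
qed

lemma valuation_sum_eq_0:
  fixes w :: "'a::field \<Rightarrow> 'g::linordered_ab_group_add"
  assumes "valuation w" "finite I" "sum f I = 0" "k \<in> I" "f k \<noteq> 0"
  obtains i j where "i \<in> I" "j \<in> I" "i \<noteq> j" "f i \<noteq> 0" "f j \<noteq> 0" "w (f i) = w (f j)"
    "\<And>l. l \<in> I \<Longrightarrow> val_ge w (f l) (w (f i))"
proof -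
  define J where "J = {l \<in> I. f l \<noteq> 0}"
  have J: "finite J" "J \<noteq> {}" using assms by (auto simp: J_def)
  obtain i where i: "i \<in> J" "\<And>l. l \<in> J \<Longrightarrow> w (f i) \<le> w (f l)"
    using arg_min_if_finite[OF J, of "\<lambda>l. w (f l)"] by (meson not_le)
  have "\<exists>j\<in>I. j \<noteq> i \<and> \<not> val_gt w (f j) (w (f i))"
    using valuation_sum_dominant(1)[OF assms(1,2), of i f] i(1) assms(3) by (auto simp: J_def)
  then obtain j where j: "j \<in> I" "j \<noteq> i" "\<not> val_gt w (f j) (w (f i))" by blast
  then have "f j \<noteq> 0" "w (f j) \<le> w (f i)" by (auto simp: val_gt_def)
  moreover have "w (f i) \<le> w (f j)" using i(2) j(1) \<open>f j \<noteq> 0\<close> by (auto simp: J_def)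
  ultimately show ?thesis using that[of i j] i j by (auto simp: J_def val_ge_def)
qed

section \<open>Roots of polynomials and generic points\<close>

text \<open>A Newton polygon without a segment of slope 0 has its minimum at a single vertex. The vertex is
  followed through multiplication by the linear factors \<open>X - x\<close>: it moves by one step if \<open>v(x) > 0\<close> or \<open>x = 0\<close>, and
  stays in place if \<open>v(x) < 0\<close>.\<close>
lemma poly_unique_minimal_coeff:
  fixes v :: "'k::alg_closed_field \<Rightarrow> real"
  assumes v: "valuation v" and "p \<noteq> 0" and no: "\<And>x. poly p x = 0 \<Longrightarrow> x \<noteq> 0 \<Longrightarrow> v x \<noteq> 0"
  shows "\<exists>i. Polynomial.coeff p i \<noteq> 0 \<and>
           (\<forall>j. j \<noteq> i \<longrightarrow> val_gt v (Polynomial.coeff p j) (v (Polynomial.coeff p i)))"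
  using assms(2,3)
proof (induction "Polynomial.degree p" arbitrary: p)
  case 0
  then obtain c where p: "p = [:c:]" by (metis degree_eq_zeroE)
  show ?case using 0 by (intro exI[of _ 0]) (auto simp: p coeff_pCons split: nat.split)
next
  case (Suc n)
  then obtain x where x: "poly p x = 0" using alg_closed_imp_poly_has_root[of p] by auto
  then obtain q where p: "p = [:- x, 1:] * q" by (auto simp: poly_eq_0_iff_dvd)
  have q: "q \<noteq> 0" using Suc.prems p by auto
  have "Polynomial.degree p = Suc (Polynomial.degree q)"
    unfolding p by (subst degree_mult_eq) (use q in auto)
  with Suc obtain i where i: "Polynomial.coeff q i \<noteq> 0"
    "\<And>j. j \<noteq> i \<Longrightarrow> val_gt v (Polynomial.coeff q j) (v (Polynomial.coeff q i))"
    using Suc.hyps(1)[of q] q p by fastforce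
  have cp: "Polynomial.coeff p j = (case j of 0 \<Rightarrow> 0 | Suc k \<Rightarrow> Polynomial.coeff q k) - x * Polynomial.coeff q j" for j
    unfolding p by (auto simp: coeff_pCons algebra_simps split: nat.split)
  have gt: "val_gt v (Polynomial.coeff q j) s" if "s \<le> v (Polynomial.coeff q i)" "j \<noteq> i" for j s
    using i(2)[OF that(2)] that(1) by (auto simp: val_gt_def)
  have ge: "val_ge v (Polynomial.coeff q j) (v (Polynomial.coeff q i))" for j
    using i(2)[of j] by (cases "j = i") (auto simp: val_gt_def val_ge_def)
  show ?case
  proof (cases "x = 0 \<or> v x > 0")
    case True
    then have vx: "val_gt v x 0" by (auto simp: val_gt_def)
    have xg: "val_gt v (x * Polynomial.coeff q j) (v (Polynomial.coeff q i))" for j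
      using val_gt_mult_left[OF v vx ge[of j]] by simp
    have c: "Polynomial.coeff p (Suc i) = Polynomial.coeff q i + - (x * Polynomial.coeff q (Suc i))" by (simp add: cp)
    have d: "Polynomial.coeff p (Suc i) \<noteq> 0" "v (Polynomial.coeff p (Suc i)) = v (Polynomial.coeff q i)"
      unfolding c using valuation_add_dominant[OF v i(1), of "- (x * Polynomial.coeff q (Suc i))"] xg v by auto
    have "val_gt v (Polynomial.coeff p j) (v (Polynomial.coeff q i))" if "j \<noteq> Suc i" for j
      unfolding cp using that v by (intro val_gt_diff xg) (auto split: nat.split intro: i(2))
    then show ?thesis using d by (intro exI[of _ "Suc i"]) auto
  next
    case False
    then have x0: "x \<noteq> 0" "v x < 0" using Suc.prems(2)[OF x] by force+
    have vm: "v (x * Polynomial.coeff q i) = v x + v (Polynomial.coeff q i)" using v x0 i by (simp add: valuation_mult)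
    have sh: "val_gt v (case j of 0 \<Rightarrow> 0 | Suc k \<Rightarrow> Polynomial.coeff q k) (v (x * Polynomial.coeff q i))" for j
    proof (cases j)
      case (Suc k)
      then show ?thesis using ge[of k] x0 vm by (auto simp: val_gt_def val_ge_def)
    qed auto
    have xg: "val_gt v (x * Polynomial.coeff q j) (v (x * Polynomial.coeff q i))" if "j \<noteq> i" for j
      using i(2)[OF that] x0 vm v by (cases "Polynomial.coeff q j = 0") (auto simp: val_gt_def valuation_mult)
    have c: "Polynomial.coeff p i = - (x * Polynomial.coeff q i) + (case i of 0 \<Rightarrow> 0 | Suc k \<Rightarrow> Polynomial.coeff q k)" by (simp add: cp)
    have d: "Polynomial.coeff p i \<noteq> 0" "v (Polynomial.coeff p i) = v (x * Polynomial.coeff q i)"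
      unfolding c using valuation_add_dominant[OF v, of "- (x * Polynomial.coeff q i)" "case i of 0 \<Rightarrow> 0 | Suc k \<Rightarrow> Polynomial.coeff q k"] sh[of i] x0 i(1) v
      by (auto simp: valuation_uminus)
    have "val_gt v (Polynomial.coeff p j) (v (x * Polynomial.coeff q i))" if "j \<noteq> i" for j
      unfolding cp using that v by (intro val_gt_diff xg sh) auto
    then show ?thesis using d by (intro exI[of _ i]) auto
  qed
qed

lemma poly_root_of_value_0:
  fixes v :: "'k::alg_closed_field \<Rightarrow> real"
  assumes v: "valuation v" and "\<And>l. val_ge v (Polynomial.coeff p l) 0" and "i \<noteq> j"
    and "Polynomial.coeff p i \<noteq> 0" "v (Polynomial.coeff p i) = 0"
    and "Polynomial.coeff p j \<noteq> 0" "v (Polynomial.coeff p j) = 0"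
  obtains x where "x \<noteq> 0" "v x = 0" "poly p x = 0"
proof -
  have "\<exists>x. x \<noteq> 0 \<and> v x = 0 \<and> poly p x = 0"
  proof (rule ccontr)
    assume "\<not> ?thesis"
    moreover have "p \<noteq> 0" using assms by auto
    ultimately obtain l where l: "Polynomial.coeff p l \<noteq> 0"
      "\<And>j. j \<noteq> l \<Longrightarrow> val_gt v (Polynomial.coeff p j) (v (Polynomial.coeff p l))"
      using poly_unique_minimal_coeff[OF v, of p] by blast
    have "v (Polynomial.coeff p l) \<ge> 0" using assms(2)[of l] l(1) by (auto simp: val_ge_def)
    then show False using l(2)[of i] l(2)[of j] assms(3-) by (auto simp: val_gt_def)
  qed
  then show ?thesis using that by blast
qed

section \<open>Finite extensions of a valued field\<close>

lemma finite_min_exists: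
  fixes g :: "'a \<Rightarrow> 'b::linorder"
  assumes "finite J" "J \<noteq> {}"
  shows "\<exists>i\<in>J. \<forall>l\<in>J. g i \<le> g l"
  using arg_min_if_finite[OF assms, of g] by (meson not_le)

lemma field_embedding_0: assumes "field_embedding e" shows "e 0 = 0"
proof -
  have "e (0 + 0) = e 0 + e 0" using assms unfolding field_embedding_def by blast
  then show ?thesis by (simp only: add_0_right add_cancel_right_right)
qed

lemma field_embedding_add: "field_embedding e \<Longrightarrow> e (x + y) = e x + e y"
  and field_embedding_mult: "field_embedding e \<Longrightarrow> e (x * y) = e x * e y"
  and field_embedding_1: "field_embedding e \<Longrightarrow> e 1 = 1"
  by (auto simp: field_embedding_def)

lemma field_embedding_uminus: "field_embedding e \<Longrightarrow> e (- x) = - e x"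
  using field_embedding_add[of e x "- x"] by (simp add: field_embedding_0 eq_neg_iff_add_eq_0 add.commute)

lemma field_embedding_diff: "field_embedding e \<Longrightarrow> e (x - y) = e x - e y"
  using field_embedding_add[of e x "- y"] by (simp add: field_embedding_uminus)

lemma field_embedding_power: "field_embedding e \<Longrightarrow> e (x ^ n) = e x ^ n"
  by (induction n) (auto simp: field_embedding_1 field_embedding_mult)

lemma field_embedding_eq_0: "field_embedding e \<Longrightarrow> e x = 0 \<longleftrightarrow> x = 0"
  using field_embedding_mult[of e "inverse x" x]
  by (cases "x = 0") (auto simp: field_embedding_0 field_embedding_1)

lemma field_embedding_inverse: "field_embedding e \<Longrightarrow> e (inverse x) = inverse (e x)"
  using field_embedding_mult[of e "inverse x" x]
  by (cases "x = 0") (auto simp: field_embedding_0 field_embedding_1 field_embedding_eq_0 field_simps)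

lemma field_embedding_divide: "field_embedding e \<Longrightarrow> e (x / y) = e x / e y"
  by (simp add: divide_inverse field_embedding_mult field_embedding_inverse)

lemma field_embedding_vector_space:
  "field_embedding e \<Longrightarrow> vector_space (\<lambda>c f. e c * f)"
  by unfold_locales (auto simp: field_embedding_add field_embedding_mult field_embedding_1 algebra_simps)

text \<open>The family is indexed, so that repetitions among the \<open>f i\<close> also count as relations.\<close>
lemma (in vector_space) linear_relation:
  fixes f :: "nat \<Rightarrow> 'b"
  assumes "finite B" "\<And>i. f i \<in> span B"
  obtains c where "(\<Sum>i\<le>card B. c i *s f i) = 0" "\<exists>i\<le>card B. c i \<noteq> 0"
proof (cases "inj_on f {..card B}")
  case False
  then obtain i j where ij: "i \<le> card B" "j \<le> card B" "i \<noteq> j" "f i = f j" by (auto simp: inj_on_def)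
  have *: "(\<Sum>l\<le>card B. ((if l = i then 1 else 0) - (if l = j then 1 else 0)) *s f l)
     = (\<Sum>l\<le>card B. if l = i then f i else 0) - (\<Sum>l\<le>card B. if l = j then f j else 0)"
    unfolding sum_subtractf[symmetric] by (rule sum.cong) (auto simp: scale_left_diff_distrib)
  show ?thesis
    by (rule that[of "\<lambda>l. (if l = i then 1 else 0) - (if l = j then 1 else 0)"])
      (use ij in \<open>auto simp: * intro!: exI[of _ i]\<close>)
next
  case True
  have "f ` {..card B} \<subseteq> span B" using assms(2) by blast
  then have "dependent (f ` {..card B})"
    using card_image[OF True] independent_span_bound[OF assms(1), of "f ` {..card B}"] by auto
  then obtain u where u: "(\<Sum>x\<in>f ` {..card B}. u x *s x) = 0" "\<exists>x\<in>f ` {..card B}. u x \<noteq> 0"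
    by (auto simp: dependent_finite)
  show ?thesis
    by (rule that[of "u \<circ> f"]) (use u sum.reindex[OF True, of "\<lambda>x. u x *s x"] in auto)
qed

text \<open>A finite extension \<open>\<psi>\<close> of fields, generated as a vector space by \<open>B\<close>, with a real valuation above.\<close>
locale finite_valued_extension =
  fixes \<psi> :: "'l::field \<Rightarrow> 'f::field" and w :: "'f \<Rightarrow> real" and B :: "'f set"
  assumes emb: "field_embedding \<psi>" and val: "valuation w" and finB: "finite B"
    and spanB: "module.span (\<lambda>c f. \<psi> c * f) B = UNIV"
begin

sublocale vs: vector_space "\<lambda>c f. \<psi> c * f" by (rule field_embedding_vector_space[OF emb])

text \<open>The module generated by \<open>T\<close> over the valuation ring of the small field.\<close>
inductive_set int_span :: "'f set \<Rightarrow> 'f set" for T where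
  zero: "0 \<in> int_span T"
| step: "val_ge w (\<psi> c) 0 \<Longrightarrow> x \<in> T \<Longrightarrow> y \<in> int_span T \<Longrightarrow> \<psi> c * x + y \<in> int_span T"

text \<open>All powers of \<open>g\<close> lie in one finitely generated module. This form of integrality is stable under
  sums and products by elementary arguments, and it bounds all powers simultaneously, which is what bounds
  the values of integral elements at closed points (\<open>bounded_integral_place\<close>).\<close>
definition integral where
  "integral g \<longleftrightarrow> (\<exists>T. finite T \<and> (\<forall>k. g ^ k \<in> int_span T))"

lemma int_span_mono: "x \<in> int_span S \<Longrightarrow> S \<subseteq> T \<Longrightarrow> x \<in> int_span T"
  by (induction rule: int_span.induct) (auto intro: int_span.intros)

lemma int_span_base: "x \<in> T \<Longrightarrow> x \<in> int_span T"
  using int_span.step[of 1 x T 0] val_ge_one[OF val] by (simp add: field_embedding_1[OF emb] int_span.zero)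

lemma int_span_add: "x \<in> int_span T \<Longrightarrow> y \<in> int_span T \<Longrightarrow> x + y \<in> int_span T"
  by (induction rule: int_span.induct) (auto intro: int_span.intros simp: add.assoc)

lemma int_span_scale:
  assumes "val_ge w (\<psi> c) 0" "y \<in> int_span T" shows "\<psi> c * y \<in> int_span T"
  using assms(2)
proof (induction rule: int_span.induct)
  case (step d x y)
  then have "\<psi> (c * d) * x + \<psi> c * y \<in> int_span T"
    using val assms(1) by (intro int_span.step) (auto simp: field_embedding_mult[OF emb] intro: val_ge_mult0)
  then show ?case by (simp add: field_embedding_mult[OF emb] algebra_simps)
qed (auto intro: int_span.zero)

lemma int_span_sum: "(\<And>i. i \<in> I \<Longrightarrow> f i \<in> int_span T) \<Longrightarrow> sum f I \<in> int_span T"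
  by (induction I rule: infinite_finite_induct) (auto intro: int_span.zero int_span_add)

lemma int_span_mult_set: "y \<in> int_span T \<Longrightarrow> (\<And>x. x \<in> T \<Longrightarrow> g * x \<in> int_span S) \<Longrightarrow> g * y \<in> int_span S"
proof (induction rule: int_span.induct)
  case (step c x y)
  then have "\<psi> c * (g * x) + g * y \<in> int_span S" by (intro int_span_add int_span_scale) auto
  then show ?case by (simp add: algebra_simps)
qed (auto intro: int_span.zero)

lemma int_span_mult:
  assumes "x \<in> int_span S" "y \<in> int_span T" shows "x * y \<in> int_span ((\<lambda>(s, t). s * t) ` (S \<times> T))"
proof (rule int_span_mult_set[OF assms(2)])
  fix t assume t: "t \<in> T"
  show "x * t \<in> int_span ((\<lambda>(s, t). s * t) ` (S \<times> T))"
    unfolding mult.commute[of x] by (rule int_span_mult_set[OF assms(1)]) (use t in \<open>auto intro!: int_span_base image_eqI simp: mult.commute\<close>)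
qed

lemma integral_stable:
  assumes "finite T" "1 \<in> int_span T" "\<And>x. x \<in> T \<Longrightarrow> g * x \<in> int_span T" shows "integral g"
proof -
  have "g ^ k \<in> int_span T" for k
    by (induction k) (use assms in \<open>auto intro: int_span_mult_set\<close>)
  then show ?thesis using assms(1) by (auto simp: integral_def)
qed

lemma integral_scalar: "val_ge w (\<psi> c) 0 \<Longrightarrow> integral (\<psi> c)"
  using int_span_scale[of c 1 "{1}"] by (intro integral_stable[of "{1}"]) (auto intro: int_span_base)

lemma integral_1: "integral 1"
  by (rule integral_stable[of "{1}"]) (auto intro!: int_span_base)

lemma integral_mult: assumes "integral f" "integral g" shows "integral (f * g)"
proof -
  obtain S T where "finite S" "\<And>k. f ^ k \<in> int_span S" "finite T" "\<And>k. g ^ k \<in> int_span T"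
    using assms by (auto simp: integral_def)
  then show ?thesis unfolding integral_def
    by (intro exI[of _ "(\<lambda>(s, t). s * t) ` (S \<times> T)"]) (auto simp: power_mult_distrib intro!: int_span_mult)
qed

lemma val_ge_of_nat: "val_ge w (of_nat n) 0"
  by (induction n) (auto intro: val_ge_add val_ge_one val)

lemma emb_of_nat: "\<psi> (of_nat n) = of_nat n"
  by (induction n) (auto simp: field_embedding_0[OF emb] field_embedding_1[OF emb] field_embedding_add[OF emb])

lemma integral_add: assumes "integral f" "integral g" shows "integral (f + g)"
proof -
  obtain S T where "finite S" "\<And>k. f ^ k \<in> int_span S" "finite T" "\<And>k. g ^ k \<in> int_span T"
    using assms by (auto simp: integral_def)
  moreover have "(f + g) ^ k \<in> int_span ((\<lambda>(s, t). s * t) ` (S \<times> T))" for k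
    unfolding binomial_ring
  proof (rule int_span_sum)
    fix i
    have "\<psi> (of_nat (k choose i)) * (f ^ i * g ^ (k - i)) \<in> int_span ((\<lambda>(s, t). s * t) ` (S \<times> T))"
      using calculation by (intro int_span_scale int_span_mult) (auto simp: emb_of_nat val_ge_of_nat)
    then show "of_nat (k choose i) * f ^ i * g ^ (k - i) \<in> int_span ((\<lambda>(s, t). s * t) ` (S \<times> T))"
      by (simp add: emb_of_nat algebra_simps)
  qed
  ultimately show ?thesis unfolding integral_def
    by (intro exI[of _ "(\<lambda>(s, t). s * t) ` (S \<times> T)"]) auto
qed

lemma integral_sum: "(\<And>i. i \<in> I \<Longrightarrow> integral (f i)) \<Longrightarrow> integral (sum f I)"
proof (induction I rule: infinite_finite_induct)
  have "integral 0" using integral_scalar[of 0] by (simp add: field_embedding_0[OF emb])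
  then show "integral (sum f A)" if "infinite A" for A using that by simp
  show "integral (sum f {})" using \<open>integral 0\<close> by simp
qed (auto intro: integral_add)

lemma integral_power: "integral f \<Longrightarrow> integral (f ^ n)"
  by (induction n) (auto intro: integral_1 integral_mult)

text \<open>Clearing denominators: all scalars of large value bring \<open>y\<close> into the lattice spanned by \<open>B\<close>.\<close>
lemma absorbing_scalar:
  "\<exists>c. c \<noteq> 0 \<and> (\<forall>c'. val_ge w (\<psi> c') (w (\<psi> c)) \<longrightarrow> \<psi> c' * y \<in> int_span B)"
proof -
  have "y \<in> vs.span B" using spanB by simp
  then show ?thesis
  proof (induction rule: vs.span_induct_alt)
    case base
    then show ?case by (auto intro!: exI[of _ 1] int_span.zero)
  next
    case (step d x y)
    then obtain c where c: "c \<noteq> 0" "\<And>c'. val_ge w (\<psi> c') (w (\<psi> c)) \<Longrightarrow> \<psi> c' * y \<in> int_span B" by blast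
    obtain b where b: "b \<noteq> 0" "\<And>c'. val_ge w (\<psi> c') (w (\<psi> b)) \<Longrightarrow> val_ge w (\<psi> c' * \<psi> d) 0"
    proof (cases "d = 0")
      case True
      then show ?thesis using that[of 1] by (simp add: field_embedding_0[OF emb])
    next
      case False
      show ?thesis
      proof (rule that[of "inverse d"])
        fix c' assume "val_ge w (\<psi> c') (w (\<psi> (inverse d)))"
        from val_ge_mult[OF val this, of "\<psi> d" "w (\<psi> d)"]
        show "val_ge w (\<psi> c' * \<psi> d) 0"
          by (simp add: field_embedding_inverse[OF emb] valuation_inverse[OF val] val_ge_def)
      qed (use False in auto)
    qed
    define m where "m = (if w (\<psi> b) \<le> w (\<psi> c) then c else b)"
    have m: "w (\<psi> c) \<le> w (\<psi> m)" "w (\<psi> b) \<le> w (\<psi> m)" "m \<noteq> 0" using b c by (auto simp: m_def)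
    show ?case
    proof (intro exI[of _ m] conjI allI impI)
      fix c' assume c': "val_ge w (\<psi> c') (w (\<psi> m))"
      have "\<psi> (c' * d) * x + \<psi> c' * y \<in> int_span B"
        using b(2)[of c'] c(2)[of c'] val_ge_trans[OF c'] m step(1)
        by (intro int_span.step) (auto simp: field_embedding_mult[OF emb])
      then show "\<psi> c' * (\<psi> d * x + y) \<in> int_span B" by (simp add: field_embedding_mult[OF emb] algebra_simps)
    qed (use m in auto)
  qed
qed

lemma absorbing_scalar_finite:
  "finite S \<Longrightarrow> \<exists>c. c \<noteq> 0 \<and> (\<forall>y\<in>S. \<forall>c'. val_ge w (\<psi> c') (w (\<psi> c)) \<longrightarrow> \<psi> c' * y \<in> int_span B)"
proof (induction S rule: finite_induct)
  case (insert y S)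
  obtain c where c: "c \<noteq> 0" "\<And>y c'. y \<in> S \<Longrightarrow> val_ge w (\<psi> c') (w (\<psi> c)) \<Longrightarrow> \<psi> c' * y \<in> int_span B"
    using insert by blast
  obtain b where b: "b \<noteq> 0" "\<And>c'. val_ge w (\<psi> c') (w (\<psi> b)) \<Longrightarrow> \<psi> c' * y \<in> int_span B"
    using absorbing_scalar[of y] by blast
  define m where "m = (if w (\<psi> b) \<le> w (\<psi> c) then c else b)"
  have m: "w (\<psi> c) \<le> w (\<psi> m)" "w (\<psi> b) \<le> w (\<psi> m)" "m \<noteq> 0" using b c by (auto simp: m_def)
  show ?case
    using m b(2) c(2) by (intro exI[of _ m]) (blast intro: val_ge_trans)
qed (auto intro: exI[of _ 1])

lemma integral_multiple: "\<exists>c. c \<noteq> 0 \<and> integral (\<psi> c * g)"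
proof -
  have "finite ((*) g ` insert 1 B)" using finB by simp
  from absorbing_scalar_finite[OF this] obtain c where c: "c \<noteq> 0"
    "\<And>x c'. x \<in> insert 1 B \<Longrightarrow> val_ge w (\<psi> c') (w (\<psi> c)) \<Longrightarrow> \<psi> c' * (g * x) \<in> int_span B"
    by blast
  have "\<psi> c * g * x \<in> int_span (insert 1 B)" if "x \<in> insert 1 B" for x
    using c(2)[OF that, of c] int_span_mono[of _ B "insert 1 B"] by (auto simp: val_ge_def mult.assoc)
  then have "integral (\<psi> c * g)"
    using finB by (intro integral_stable[of "insert 1 B"]) (auto intro: int_span_base)
  with c show ?thesis by blast
qed

text \<open>In a relation \<open>\<Sum> a i * x ^ i = 0\<close> with integral coefficients, some of value 0, let \<open>k\<close> be the last index
  with \<open>w (a k) = 0\<close> and \<open>s = \<Sum>i\<ge>k. a i * x ^ (i - k)\<close>. Then \<open>s\<close> has value 0, being \<open>a k\<close>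
  up to terms of positive value. It is a polynomial in \<open>x\<close> and, by the relation, also a polynomial in
  \<open>1 / x\<close> without constant term. Therefore \<open>s\<close> and \<open>s * x\<close> map the module spanned by \<open>1, \<dots>, x ^ n\<close>
  to itself.\<close>
lemma integral_denominator:
  assumes x: "val_ge w x 0"
  shows "\<exists>s. s \<noteq> 0 \<and> w s = 0 \<and> integral s \<and> integral (s * x)"
proof (cases "x = 0")
  case True
  then show ?thesis using integral_1 integral_scalar[of 0] val_ge_one[OF val]
    by (auto intro!: exI[of _ 1] simp: field_embedding_0[OF emb] valuation_one[OF val])
next
  case x0: False
  obtain c where c: "(\<Sum>i\<le>card B. \<psi> (c i) * x ^ i) = 0" "\<exists>i\<le>card B. c i \<noteq> 0"
    using vs.linear_relation[OF finB, unfolded spanB, OF UNIV_I, of "\<lambda>i. x ^ i"] by blast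
  define n where "n = card B"
  define J where "J = {i. i \<le> n \<and> c i \<noteq> 0}"
  have "finite J" "J \<noteq> {}" using c by (auto simp: J_def n_def)
  then obtain m where m: "m \<in> J" "\<And>i. i \<in> J \<Longrightarrow> w (\<psi> (c m)) \<le> w (\<psi> (c i))"
    using arg_min_if_finite[of J "\<lambda>l. w (\<psi> (c l))"] by (meson not_le)
  define a where "a i = c i / c m" for i
  have cm: "c m \<noteq> 0" using m by (auto simp: J_def)
  have rel: "(\<Sum>i\<le>n. \<psi> (a i) * x ^ i) = 0"
  proof -
    have "(\<Sum>i\<le>n. \<psi> (a i) * x ^ i) = (\<Sum>i\<le>n. \<psi> (c i) * x ^ i) / \<psi> (c m)"
      unfolding sum_divide_distrib by (rule sum.cong) (auto simp: a_def field_embedding_divide[OF emb])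
    then show ?thesis using c by (simp add: n_def)
  qed
  have a: "val_ge w (\<psi> (a i)) 0" if "i \<le> n" for i
    using m(2)[of i] that cm
    by (cases "c i = 0") (auto simp: val_ge_def J_def a_def field_embedding_divide[OF emb] valuation_divide[OF val] field_embedding_eq_0[OF emb])
  have am: "\<psi> (a m) = 1" "m \<le> n" using m cm by (auto simp: a_def J_def field_embedding_1[OF emb])
  define k where "k = Max {i. i \<le> n \<and> \<not> val_gt w (\<psi> (a i)) 0}"
  have "m \<in> {i. i \<le> n \<and> \<not> val_gt w (\<psi> (a i)) 0}"
    using am valuation_one[OF val] by (auto simp: val_gt_def)
  then have "k \<in> {i. i \<le> n \<and> \<not> val_gt w (\<psi> (a i)) 0}" unfolding k_def by (intro Max_in) auto
  then have k: "k \<le> n" "\<psi> (a k) \<noteq> 0" "w (\<psi> (a k)) = 0" using a[of k] by (auto simp: val_gt_def val_ge_def)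
  have gt: "val_gt w (\<psi> (a i)) 0" if "k < i" "i \<le> n" for i
  proof (rule ccontr)
    assume "\<not> ?thesis"
    then have "i \<le> k" unfolding k_def using that by (intro Max_ge) auto
    then show False using that by simp
  qed
  define s where "s = (\<Sum>i=k..n. \<psi> (a i) * x ^ (i - k))"
  have "{..n} = {..<k} \<union> {k..n}" using k by auto
  then have split: "(\<Sum>i<k. \<psi> (a i) * x ^ i) + (\<Sum>i=k..n. \<psi> (a i) * x ^ i) = 0"
    using rel sum.union_disjoint[of "{..<k}" "{k..n}" "\<lambda>i. \<psi> (a i) * x ^ i"]
    by (simp add: ivl_disj_int_one)
  have "s = \<psi> (a k) + (\<Sum>i=Suc k..n. \<psi> (a i) * x ^ (i - k))"
    unfolding s_def using k by (subst sum.atLeast_Suc_atMost) auto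
  moreover have "val_gt w (\<Sum>i=Suc k..n. \<psi> (a i) * x ^ (i - k)) 0"
    using val_gt_mult_left[OF val gt val_ge_power[OF val x]] by (intro val_gt_sum[OF val]) auto
  ultimately have s: "s \<noteq> 0" "w s = 0"
    using valuation_add_dominant[OF val k(2)] k(3) by auto
  define T where "T = (\<lambda>i. x ^ i) ` {..n}"
  have T: "\<psi> (a i) * x ^ j \<in> int_span T" if "i \<le> n" "j \<le> n" for i j
    using a[OF that(1)] that by (intro int_span_scale int_span_base) (auto simp: T_def)
  have sx: "s * x ^ j \<in> int_span T" if "j \<le> Suc n" for j
  proof (cases "j \<le> k")
    case True
    have "s * x ^ j = (\<Sum>i=k..n. \<psi> (a i) * x ^ (i - k + j))"
      unfolding s_def sum_distrib_right by (simp only: power_add mult.assoc)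
    also have "\<dots> \<in> int_span T" using True by (intro int_span_sum T) auto
    finally show ?thesis .
  next
    case False
    have "s * x ^ k = (\<Sum>i=k..n. \<psi> (a i) * x ^ i)"
      unfolding s_def sum_distrib_right by (rule sum.cong) (auto simp: power_add[symmetric] mult.assoc)
    then have "s * x ^ k = \<psi> (- 1) * (\<Sum>i<k. \<psi> (a i) * x ^ i)"
      using split by (simp add: field_embedding_uminus[OF emb] field_embedding_1[OF emb] eq_neg_iff_add_eq_0 add.commute)
    then have "s * x ^ j = \<psi> (- 1) * (\<Sum>i<k. \<psi> (a i) * x ^ i) * x ^ (j - k)"
      using False by (metis mult.assoc power_add le_add_diff_inverse nat_le_linear)
    also have "\<dots> = \<psi> (- 1) * (\<Sum>i<k. \<psi> (a i) * x ^ (i + (j - k)))"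
      by (simp add: sum_distrib_right power_add mult.assoc)
    also have "\<dots> \<in> int_span T"
      using False that k val_ge_one[OF val] val
      by (intro int_span_scale int_span_sum T) (auto simp: field_embedding_uminus[OF emb] field_embedding_1[OF emb])
    finally show ?thesis .
  qed
  have "1 \<in> int_span T" by (rule int_span_base) (auto simp: T_def intro!: image_eqI[of _ _ 0])
  have "finite T" by (simp add: T_def)
  have "integral s"
    by (rule integral_stable[OF \<open>finite T\<close> \<open>1 \<in> int_span T\<close>]) (use sx in \<open>auto simp: T_def\<close>)
  moreover have "integral (s * x)"
  proof (rule integral_stable[OF \<open>finite T\<close> \<open>1 \<in> int_span T\<close>])
    fix z assume "z \<in> T"
    then obtain i where "i \<le> n" "z = x ^ i" by (auto simp: T_def)
    then show "s * x * z \<in> int_span T" using sx[of "Suc i"] by (simp add: mult.assoc)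
  qed
  ultimately show ?thesis using s by blast
qed

text \<open>If no \<open>y\<close> worked, one could multiply repeatedly by elements \<open>s\<close> violating the condition and get a
  sequence \<open>y 0, y 1, \<dots>\<close> in which each term divides the next. In a linear relation between its
  terms, normalized at the first coefficient of minimal value, the terms after it are multiples of \<open>y m * s\<close>
  and the terms before it have coefficients of positive value: exactly what was excluded.\<close>
lemma integral_localization_step:
  shows "\<exists>y. integral y \<and> y \<noteq> 0 \<and> w y = 0 \<and> (\<forall>s. integral s \<longrightarrow> s \<noteq> 0 \<longrightarrow> w s = 0 \<longrightarrow>
     (\<exists>b c u. integral b \<and> integral u \<and> val_gt w (\<psi> c) 0 \<and> y = y * s * b + \<psi> c * u))"
proof (rule ccontr)
  define good where "good y \<longleftrightarrow> integral y \<and> y \<noteq> 0 \<and> w y = 0" for y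
  assume contra: "\<not> ?thesis"
  have ex: "\<exists>s. good s \<and> (\<forall>b c u. integral b \<longrightarrow> integral u \<longrightarrow> val_gt w (\<psi> c) 0 \<longrightarrow> y \<noteq> y * s * b + \<psi> c * u)"
    if "good y" for y
  proof -
    have "\<not> (\<forall>s. integral s \<longrightarrow> s \<noteq> 0 \<longrightarrow> w s = 0 \<longrightarrow>
      (\<exists>b c u. integral b \<and> integral u \<and> val_gt w (\<psi> c) 0 \<and> y = y * s * b + \<psi> c * u))"
      using contra that unfolding good_def by blast
    then show ?thesis unfolding good_def by blast
  qed
  have gm: "good (y * s)" if "good y" "good s" for y s
    using that by (auto simp: good_def integral_mult valuation_mult[OF val])
  define nxt where "nxt y z \<longleftrightarrow> (\<exists>s. good s \<and> z = y * s \<and>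
      (\<forall>b c u. integral b \<longrightarrow> integral u \<longrightarrow> val_gt w (\<psi> c) 0 \<longrightarrow> y \<noteq> y * s * b + \<psi> c * u))" for y z
  have "\<exists>z. good z \<and> nxt y z" if "good y" for y
    using ex[OF that] gm[OF that] unfolding nxt_def by auto
  moreover have "good 1" using integral_1 valuation_one[OF val] by (auto simp: good_def)
  ultimately have "\<exists>y. \<forall>n. good (y n) \<and> nxt (y n) (y (Suc n))"
    by (intro dependent_nat_choice) auto
  then obtain y where y: "\<And>n. good (y n)" and ys: "\<And>n. nxt (y n) (y (Suc n))" by blast
  have chain: "\<exists>r. integral r \<and> y (n + k) = y n * r" for n k
  proof (induction k)
    case 0
    then show ?case using integral_1 by (auto intro!: exI[of _ 1])
  next
    case (Suc k)
    then obtain r where "integral r" "y (n + k) = y n * r" by blast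
    moreover obtain s where "good s" "y (Suc (n + k)) = y (n + k) * s" using ys[of "n + k"] unfolding nxt_def by blast
    ultimately show ?case by (intro exI[of _ "r * s"]) (auto simp: good_def integral_mult mult.assoc)
  qed
  define n where "n = card B"
  obtain c where c: "(\<Sum>i\<le>n. \<psi> (c i) * y i) = 0" "\<exists>i\<le>n. c i \<noteq> 0"
    using vs.linear_relation[OF finB, unfolded spanB, OF UNIV_I, of y] unfolding n_def by blast
  define J where "J = {i. i \<le> n \<and> c i \<noteq> 0}"
  have J: "finite J" "J \<noteq> {}" using c by (auto simp: J_def n_def)
  define \<mu> where "\<mu> = Min ((\<lambda>i. w (\<psi> (c i))) ` J)"
  define J' where "J' = {i \<in> J. w (\<psi> (c i)) = \<mu>}"
  have "\<mu> \<in> (\<lambda>i. w (\<psi> (c i))) ` J" unfolding \<mu>_def using J by (intro Min_in) auto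
  then have J': "finite J'" "J' \<noteq> {}" using J by (auto simp: J'_def)
  \<comment> \<open>The earliest index of minimal value: the coefficients before it have larger value.\<close>
  define m where "m = Min J'"
  have "m \<in> J'" unfolding m_def using J' by (intro Min_in) auto
  then have m: "m \<le> n" "c m \<noteq> 0" "w (\<psi> (c m)) = \<mu>" by (auto simp: J'_def J_def)
  have mu: "\<mu> \<le> w (\<psi> (c i))" if "i \<in> J" for i unfolding \<mu>_def using J that by (intro Min_le) auto
  define a where "a i = - (c i / c m)" for i
  have va: "w (\<psi> (a i)) = w (\<psi> (c i)) - \<mu>" if "c i \<noteq> 0" for i
    using that m by (simp add: a_def field_embedding_uminus[OF emb] valuation_uminus[OF val] field_embedding_divide[OF emb] valuation_divide[OF val] field_embedding_eq_0[OF emb])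
  have a0: "val_ge w (\<psi> (a i)) 0" if "i \<le> n" for i
    using va[of i] mu[of i] that by (cases "c i = 0") (auto simp: val_ge_def J_def a_def field_embedding_0[OF emb])
  have a1: "val_gt w (\<psi> (a i)) 0" if "i < m" for i
  proof (cases "c i = 0")
    case False
    then have "i \<in> J" using that m by (auto simp: J_def)
    moreover have "i \<notin> J'" unfolding m_def using Min_le[OF J'(1), of i] that m_def by auto
    ultimately show ?thesis using mu[of i] va[of i] False by (auto simp: J'_def val_gt_def)
  qed (auto simp: a_def field_embedding_0[OF emb])
  have "y m = (\<Sum>i\<in>{..n} - {m}. \<psi> (a i) * y i)"
  proof -
    have "(\<Sum>i\<in>{..n} - {m}. \<psi> (c i) * y i) = - \<psi> (c m) * y m"
      using c(1) m by (simp add: sum_diff1 )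
    then have "(\<Sum>i\<in>{..n} - {m}. \<psi> (c i) * y i) / - \<psi> (c m) = y m"
      using m by (simp add: field_embedding_eq_0[OF emb])
    then show ?thesis unfolding sum_divide_distrib
      by (simp add: a_def field_embedding_uminus[OF emb] field_embedding_divide[OF emb])
  qed
  also have "{..n} - {m} = {..<m} \<union> {m<..n}" using m by auto
  also have "(\<Sum>i\<in>{..<m} \<union> {m<..n}. \<psi> (a i) * y i) = (\<Sum>i\<in>{m<..n}. \<psi> (a i) * y i) + (\<Sum>i<m. \<psi> (a i) * y i)"
    by (subst sum.union_disjoint) auto
  finally have ym: "y m = (\<Sum>i\<in>{m<..n}. \<psi> (a i) * y i) + (\<Sum>i<m. \<psi> (a i) * y i)" .
  obtain s where s: "y (Suc m) = y m * s" "good s" "\<And>b c u. integral b \<Longrightarrow> integral u \<Longrightarrow> val_gt w (\<psi> c) 0 \<Longrightarrow> y m \<noteq> y m * s * b + \<psi> c * u"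
    using ys[of m] unfolding nxt_def by blast
  have "\<exists>b. integral b \<and> (\<Sum>i\<in>{m<..n}. \<psi> (a i) * y i) = y m * s * b"
  proof -
    have "\<exists>r. integral r \<and> y i = y m * s * r" if "i \<in> {m<..n}" for i
      using chain[of "Suc m" "i - Suc m"] that s by auto
    then obtain r where r: "\<And>i. i \<in> {m<..n} \<Longrightarrow> integral (r i) \<and> y i = y m * s * r i" by metis
    have "(\<Sum>i\<in>{m<..n}. \<psi> (a i) * y i) = y m * s * (\<Sum>i\<in>{m<..n}. \<psi> (a i) * r i)"
      unfolding sum_distrib_left using r by (intro sum.cong) auto
    moreover have "integral (\<Sum>i\<in>{m<..n}. \<psi> (a i) * r i)"
      using r a0 by (intro integral_sum integral_mult integral_scalar) auto
    ultimately show ?thesis by blast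
  qed
  then obtain b where b: "integral b" "(\<Sum>i\<in>{m<..n}. \<psi> (a i) * y i) = y m * s * b" by blast
  have "\<exists>d u. integral u \<and> val_gt w (\<psi> d) 0 \<and> (\<Sum>i<m. \<psi> (a i) * y i) = \<psi> d * u"
  proof (cases "\<exists>i<m. a i \<noteq> 0")
    case True
    have "finite {i. i < m \<and> a i \<noteq> 0}" "{i. i < m \<and> a i \<noteq> 0} \<noteq> {}" using True by auto
    from finite_min_exists[OF this, of "\<lambda>l. w (\<psi> (a l))"]
    obtain d where d': "d \<in> {i. i < m \<and> a i \<noteq> 0}"
      "\<forall>l\<in>{i. i < m \<and> a i \<noteq> 0}. w (\<psi> (a d)) \<le> w (\<psi> (a l))" by (rule bexE)
    then have d: "d < m" "a d \<noteq> 0" "\<And>l. l < m \<Longrightarrow> a l \<noteq> 0 \<Longrightarrow> w (\<psi> (a d)) \<le> w (\<psi> (a l))"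
      by auto
    have "(\<Sum>i<m. \<psi> (a i) * y i) = \<psi> (a d) * (\<Sum>i<m. \<psi> (a i / a d) * y i)"
      unfolding sum_distrib_left
    proof (rule sum.cong[OF refl])
      fix i
      have "\<psi> (a i) = \<psi> (a d * (a i / a d))" using d(2) by simp
      then show "\<psi> (a i) * y i = \<psi> (a d) * (\<psi> (a i / a d) * y i)"
        unfolding field_embedding_mult[OF emb] by (simp only: mult.assoc)
    qed
    moreover have "val_ge w (\<psi> (a i / a d)) 0" if "i < m" for i
      using d(3)[OF that] d(2) by (cases "a i = 0") (auto simp: val_ge_def
        field_embedding_divide[OF emb] valuation_divide[OF val] field_embedding_eq_0[OF emb] field_embedding_0[OF emb])
    then have "integral (\<Sum>i<m. \<psi> (a i / a d) * y i)"
      using y by (intro integral_sum integral_mult integral_scalar) (auto simp: good_def)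
    ultimately show ?thesis using a1[OF d(1)] by blast
  next
    case False
    then show ?thesis using integral_1 by (intro exI[of _ 0] exI[of _ 1]) (auto simp: field_embedding_0[OF emb])
  qed
  then obtain d u where du: "integral u" "val_gt w (\<psi> d) 0" "(\<Sum>i<m. \<psi> (a i) * y i) = \<psi> d * u" by blast
  show False
    using s(3)[OF b(1) du(1,2)] ym[unfolded b(2) du(3)] by (rule notE)
qed

text \<open>The integral closure of the valuation ring is the intersection of the finitely many valuation rings
  above it, and a \<open>y\<close> that is a unit for \<open>w\<close> and has positive value for the others inverts to the
  valuation ring of \<open>w\<close>. The element found by \<open>integral_localization_step\<close> behaves in this way: each
  integral \<open>s\<close> with \<open>w s = 0\<close>, in particular the denominator of \<open>g\<close>, divides one of its powers.\<close>
theorem integral_localization: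
  obtains y where "integral y" "y \<noteq> 0" "w y = 0" "\<And>g. val_ge w g 0 \<Longrightarrow> \<exists>n. integral (y ^ n * g)"
proof -
  obtain y where y: "integral y" "y \<noteq> 0" "w y = 0" and
    step: "\<And>s. integral s \<Longrightarrow> s \<noteq> 0 \<Longrightarrow> w s = 0 \<Longrightarrow>
      \<exists>b c u. integral b \<and> integral u \<and> val_gt w (\<psi> c) 0 \<and> y = y * s * b + \<psi> c * u"
    using integral_localization_step by metis
  have "\<exists>n. integral (y ^ n * g)" if g: "val_ge w g 0" for g
  proof -
    obtain s where s: "s \<noteq> 0" "w s = 0" "integral s" "integral (s * g)" using integral_denominator[OF g] by blast
    obtain b c u where bcu: "integral b" "integral u" "val_gt w (\<psi> c) 0" "y = y * s * b + \<psi> c * u"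
      using step[OF s(3,1,2)] by blast
    obtain d where d: "d \<noteq> 0" "integral (\<psi> d * inverse s)" using integral_multiple by blast
    \<comment> \<open>A high power of \<open>c\<close> cancels the denominator \<open>d\<close> of \<open>1 / s\<close>.\<close>
    obtain n where n: "val_ge w (\<psi> (c ^ n / d)) 0"
    proof (cases "c = 0")
      case True
      then show ?thesis using that[of 1] by (simp add: field_embedding_0[OF emb])
    next
      case False
      then have "w (\<psi> c) > 0" using bcu(3) by (auto simp: val_gt_def field_embedding_eq_0[OF emb])
      then obtain n where "w (\<psi> d) < real n * w (\<psi> c)" using reals_Archimedean3 by blast
      then show ?thesis using that[of n] False d
        by (simp add: val_ge_def field_embedding_divide[OF emb] field_embedding_power[OF emb] valuation_divide[OF val]
            valuation_power[OF val] field_embedding_eq_0[OF emb])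
    qed
    \<comment> \<open>The powers of \<open>y = y * s * b + c * u\<close>, modulo \<open>s\<close>.\<close>
    have "\<exists>r. integral r \<and> y ^ n = s * r + (\<psi> c * u) ^ n" for n
    proof (induction n)
      case 0
      then show ?case using integral_scalar[of 0] by (auto intro!: exI[of _ 0] simp: field_embedding_0[OF emb])
    next
      case (Suc n)
      then obtain r where r: "integral r" "y ^ n = s * r + (\<psi> c * u) ^ n" by blast
      have "y ^ Suc n = y * s * b * y ^ n + \<psi> c * u * y ^ n"
        using bcu(4) by (metis distrib_right power_Suc)
      also have "\<dots> = s * (y * b * y ^ n + \<psi> c * u * r) + (\<psi> c * u) ^ Suc n"
        unfolding r(2) by (simp add: algebra_simps)
      finally have "y ^ Suc n = s * (y * b * y ^ n + \<psi> c * u * r) + (\<psi> c * u) ^ Suc n" .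
      moreover have "integral (y * b * y ^ n + \<psi> c * u * r)"
        using r(1) y bcu val_gt_imp_ge[OF bcu(3)]
        by (intro integral_add integral_mult integral_power integral_scalar)
      ultimately show ?case by blast
    qed
    then obtain r where r: "integral r" "y ^ n = s * r + (\<psi> c * u) ^ n" by blast
    have "(\<psi> c * u) ^ n = s * (\<psi> (c ^ n / d) * (\<psi> d * inverse s) * u ^ n)"
      using s d by (simp add: power_mult_distrib field_embedding_divide[OF emb] field_embedding_power[OF emb] field_embedding_eq_0[OF emb])
    then have eq: "y ^ n * g = (r + \<psi> (c ^ n / d) * (\<psi> d * inverse s) * u ^ n) * (s * g)"
      unfolding r(2) by (simp add: algebra_simps)
    have "integral (y ^ n * g)" unfolding eq
      by (intro integral_mult[OF _ s(4)] integral_add r(1)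
        integral_mult[OF integral_mult[OF integral_scalar[OF n] d(2)] integral_power[OF bcu(2)]])
    then show ?thesis by blast
  qed
  then show ?thesis using that y by blast
qed

end

section \<open>Extension of places\<close>

text \<open>A ring homomorphism to \<open>'k\<close>, identity on constants, from a subring of \<open>'f\<close>, encoded by its graph. Graphs
  are ordered by inclusion, which suits Zorn's lemma; single-valuedness need only be required at \<open>0\<close>.\<close>
definition place_graph :: "('k::field \<Rightarrow> 'f::field) \<Rightarrow> ('f \<times> 'k) set \<Rightarrow> bool" where
  "place_graph e G \<longleftrightarrow> (\<forall>c. (e c, c) \<in> G) \<and>
     (\<forall>x c y d. (x, c) \<in> G \<longrightarrow> (y, d) \<in> G \<longrightarrow> (x + y, c + d) \<in> G \<and> (x * y, c * d) \<in> G) \<and>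
     (\<forall>c. (0, c) \<in> G \<longrightarrow> c = 0)"

locale embedded_place =
  fixes e :: "'k::field \<Rightarrow> 'f::field" and G :: "('f \<times> 'k) set"
  assumes emb: "field_embedding e" and graph: "place_graph e G"
begin

lemma const: "(e c, c) \<in> G"
  and add: "(x, c) \<in> G \<Longrightarrow> (y, d) \<in> G \<Longrightarrow> (x + y, c + d) \<in> G"
  and mult: "(x, c) \<in> G \<Longrightarrow> (y, d) \<in> G \<Longrightarrow> (x * y, c * d) \<in> G"
  and zeroD: "(0, c) \<in> G \<Longrightarrow> c = 0"
  using graph by (auto simp: place_graph_def)

lemma zero: "(0, 0) \<in> G" using const[of 0] by (simp add: field_embedding_0[OF emb])
lemma one: "(1, 1) \<in> G" using const[of 1] by (simp add: field_embedding_1[OF emb])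

lemma uminus: "(x, c) \<in> G \<Longrightarrow> (- x, - c) \<in> G"
  using mult[OF const[of "- 1"]] by (fastforce simp: field_embedding_uminus[OF emb] field_embedding_1[OF emb])

lemma diff: "(x, c) \<in> G \<Longrightarrow> (y, d) \<in> G \<Longrightarrow> (x - y, c - d) \<in> G"
  using add[OF _ uminus] by fastforce

lemma unique: "(x, c) \<in> G \<Longrightarrow> (x, d) \<in> G \<Longrightarrow> c = d"
  using diff[of x c x d] zeroD by fastforce

lemma power: "(x, c) \<in> G \<Longrightarrow> (x ^ n, c ^ n) \<in> G"
  by (induction n) (auto intro: one mult)

lemma sum: "(\<And>i. i \<in> I \<Longrightarrow> (f i, g i) \<in> G) \<Longrightarrow> (sum f I, sum g I) \<in> G"
  by (induction I rule: infinite_finite_induct) (auto intro: zero add)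

definition coeffs_in_graph :: "'f poly \<Rightarrow> 'k poly \<Rightarrow> bool" where
  "coeffs_in_graph P C \<longleftrightarrow> (\<forall>i. (Polynomial.coeff P i, Polynomial.coeff C i) \<in> G)"

lemma coeffs_in_graph_add:
  "coeffs_in_graph P C \<Longrightarrow> coeffs_in_graph P' C' \<Longrightarrow> coeffs_in_graph (P + P') (C + C')"
  by (auto simp: coeffs_in_graph_def intro: add)

lemma coeffs_in_graph_diff:
  "coeffs_in_graph P C \<Longrightarrow> coeffs_in_graph P' C' \<Longrightarrow> coeffs_in_graph (P - P') (C - C')"
  by (auto simp: coeffs_in_graph_def intro: diff)

lemma coeffs_in_graph_mult:
  "coeffs_in_graph P C \<Longrightarrow> coeffs_in_graph P' C' \<Longrightarrow> coeffs_in_graph (P * P') (C * C')"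
  by (auto simp: coeffs_in_graph_def coeff_mult intro: sum mult)

lemma coeffs_in_graph_pCons:
  "(x, c) \<in> G \<Longrightarrow> coeffs_in_graph P C \<Longrightarrow> coeffs_in_graph (pCons x P) (pCons c C)"
  by (auto simp: coeffs_in_graph_def coeff_pCons split: nat.split)

lemma coeffs_in_graph_0: "coeffs_in_graph 0 0"
  by (auto simp: coeffs_in_graph_def intro: zero)

lemma coeffs_in_graph_const: "coeffs_in_graph (map_poly e C) C"
  by (auto simp: coeffs_in_graph_def coeff_map_poly field_embedding_0[OF emb] intro: const)

text \<open>The homomorphism extends to the subring generated by \<open>\<theta>\<close>, with value \<open>\<beta>\<close>, if every polynomial relation of
  \<open>\<theta>\<close> specializes to a relation of \<open>\<beta>\<close>.\<close>
lemma adjoin: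
  assumes "\<forall>P C. coeffs_in_graph P C \<longrightarrow> poly P \<theta> = 0 \<longrightarrow> poly C \<beta> = 0"
  defines "G' \<equiv> {(poly P \<theta>, poly C \<beta>) | P C. coeffs_in_graph P C}"
  shows "place_graph e G'" "G \<subseteq> G'" "(\<theta>, \<beta>) \<in> G'"
proof -
  have base: "(x, c) \<in> G'" if "(x, c) \<in> G" for x c
  proof -
    have "coeffs_in_graph [:x:] [:c:]" using that by (intro coeffs_in_graph_pCons coeffs_in_graph_0)
    then show ?thesis unfolding G'_def by force
  qed
  then show "G \<subseteq> G'" by auto
  have "coeffs_in_graph [:0, 1:] [:0, 1:]"
    by (intro coeffs_in_graph_pCons coeffs_in_graph_0 zero one)
  then show "(\<theta>, \<beta>) \<in> G'" unfolding G'_def by force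
  have "(x + y, c + d) \<in> G'" "(x * y, c * d) \<in> G'" if xy: "(x, c) \<in> G'" "(y, d) \<in> G'" for x c y d
  proof -
    obtain P C Q D where *: "x = poly P \<theta>" "c = poly C \<beta>" "y = poly Q \<theta>" "d = poly D \<beta>"
      "coeffs_in_graph P C" "coeffs_in_graph Q D" using xy by (auto simp: G'_def)
    show "(x + y, c + d) \<in> G'" unfolding G'_def using coeffs_in_graph_add[OF *(5,6)] *(1-4) by force
    show "(x * y, c * d) \<in> G'" unfolding G'_def using coeffs_in_graph_mult[OF *(5,6)] *(1-4) by force
  qed
  moreover have "c = 0" if "(0, c) \<in> G'" for c using that assms(1) unfolding G'_def by force
  ultimately show "place_graph e G'" using base const by (auto simp: place_graph_def)
qed

text \<open>The kernel of the homomorphism generates the unit ideal after adjoining \<open>\<theta>\<close>.\<close>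
definition unit_relation :: "'f \<Rightarrow> nat \<Rightarrow> bool" where
  "unit_relation \<theta> n \<longleftrightarrow> (\<exists>f. (\<forall>i\<le>n. (f i, 0) \<in> G) \<and> (\<Sum>i\<le>n. f i * \<theta> ^ i) = 1)"

end

locale maximal_place = embedded_place e G for e :: "'k::alg_closed_field \<Rightarrow> 'f::field" and G +
  assumes maximal: "\<And>G'. place_graph e G' \<Longrightarrow> G \<subseteq> G' \<Longrightarrow> G' = G"
begin

lemma adjoin_in:
  assumes "\<forall>P C. coeffs_in_graph P C \<longrightarrow> poly P \<theta> = 0 \<longrightarrow> poly C \<beta> = 0"
  shows "(\<theta>, \<beta>) \<in> G"
proof -
  note A = adjoin[OF assms]
  show ?thesis using A(3) unfolding maximal[OF A(1,2)] .
qed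

lemma inverse_in:
  assumes x: "(x, c) \<in> G" and c: "c \<noteq> 0"
  shows "(inverse x, inverse c) \<in> G"
proof (rule adjoin_in, intro allI impI)
  fix P C assume PC: "coeffs_in_graph P C" and P0: "poly P (inverse x) = 0"
  have x0: "x \<noteq> 0" using x c zeroD by auto
  define n where "n = max (Polynomial.degree P) (Polynomial.degree C)"
  have gen: "y ^ n * poly Q (inverse y) = (\<Sum>i\<le>n. Polynomial.coeff Q i * y ^ (n - i))"
    if "y \<noteq> 0" "Polynomial.degree Q \<le> n" for y and Q :: "'z::field poly"
    unfolding poly_altdef sum_distrib_left
  proof -
    have "(\<Sum>i\<le>Polynomial.degree Q. y ^ n * (Polynomial.coeff Q i * inverse y ^ i))
        = (\<Sum>i\<le>n. y ^ n * (Polynomial.coeff Q i * inverse y ^ i))"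
      using that by (intro sum.mono_neutral_left) (auto simp: coeff_eq_0)
    also have "\<dots> = (\<Sum>i\<le>n. Polynomial.coeff Q i * y ^ (n - i))"
      using that by (intro sum.cong) (auto simp: power_diff power_inverse field_simps)
    finally show "(\<Sum>i\<le>Polynomial.degree Q. y ^ n * (Polynomial.coeff Q i * inverse y ^ i))
        = (\<Sum>i\<le>n. Polynomial.coeff Q i * y ^ (n - i))" .
  qed
  have "(x ^ n * poly P (inverse x), c ^ n * poly C (inverse c)) \<in> G"
    unfolding gen[OF x0 max.cobounded1[of "Polynomial.degree P" "Polynomial.degree C", folded n_def]]
      gen[OF c max.cobounded2[of "Polynomial.degree C" "Polynomial.degree P", folded n_def]]
    using PC x by (intro sum mult power) (auto simp: coeffs_in_graph_def)
  then have "c ^ n * poly C (inverse c) = 0"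
    unfolding P0 mult_zero_right by (rule zeroD)
  then show "poly C (inverse c) = 0" using c by simp
qed

text \<open>The specializations of the polynomial relations of \<open>\<theta>\<close> form an ideal \<open>J\<close> of \<open>K[X]\<close>. If no value \<open>\<beta>\<close>
  can be assigned to \<open>\<theta>\<close>, then \<open>J\<close> has no zero in the algebraically closed field \<open>K\<close>, so it contains \<open>1\<close>; a
  relation of \<open>\<theta>\<close> that specializes to \<open>1\<close> is a unit relation.\<close>
lemma unit_relation_if_not_in:
  assumes "\<And>\<beta>. (\<theta>, \<beta>) \<notin> G" shows "\<exists>n. unit_relation \<theta> n"
proof -
  define J where "J = {C. \<exists>P. coeffs_in_graph P C \<and> poly P \<theta> = 0}"
  have ex: "\<exists>C\<in>J. poly C \<beta> \<noteq> 0" for \<beta>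
    using adjoin_in[of \<theta> \<beta>] assms[of \<beta>] by (auto simp: J_def)
  have Jd: "C - D * C' \<in> J" if "C \<in> J" "C' \<in> J" for C C' D
  proof -
    obtain P P' where "coeffs_in_graph P C" "poly P \<theta> = 0" "coeffs_in_graph P' C'" "poly P' \<theta> = 0"
      using \<open>C \<in> J\<close> \<open>C' \<in> J\<close> by (auto simp: J_def)
    then show ?thesis
      using coeffs_in_graph_diff[OF _ coeffs_in_graph_mult[OF coeffs_in_graph_const[of D]], of P C P' C']
      unfolding J_def by force
  qed
  obtain C where C: "C \<in> J" "C \<noteq> 0" "\<And>D. D \<in> J \<Longrightarrow> D \<noteq> 0 \<Longrightarrow> Polynomial.degree C \<le> Polynomial.degree D"
    using ex[of 0] ex_has_least_nat[of "\<lambda>C. C \<in> J \<and> C \<noteq> 0" _ Polynomial.degree] by force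
  have "Polynomial.degree C = 0"
  proof (rule ccontr)
    assume "Polynomial.degree C \<noteq> 0"
    then obtain \<beta> where \<beta>: "poly C \<beta> = 0" using alg_closed_imp_poly_has_root[of C] by auto
    obtain D where D: "D \<in> J" "poly D \<beta> \<noteq> 0" using ex by blast
    have "D mod C \<in> J" using Jd[OF D(1) C(1), of "D div C"] by (simp add: minus_div_mult_eq_mod)
    then have "D mod C = 0" using C(3)[of "D mod C"] degree_mod_less[of C D] C(2) \<open>Polynomial.degree C \<noteq> 0\<close> by force
    then have "C dvd D" by auto
    then show False using \<beta> D(2) by auto
  qed
  then obtain c where c: "C = [:c:]" "c \<noteq> 0" using C(2) by (metis degree_eq_zeroE pCons_0_0)
  have "0 - [:- inverse c:] * C \<in> J" using Jd[of 0 C "[:- inverse c:]"] C(1) Jd[of C C 1] by simp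
  then have "1 \<in> J" using c by (simp add: one_pCons)
  then obtain P where P: "coeffs_in_graph P 1" "poly P \<theta> = 0" by (auto simp: J_def)
  define f where "f i = (if i = 0 then 1 else 0) - Polynomial.coeff P i" for i
  define n where "n = Polynomial.degree P"
  have "(f i, 0) \<in> G" for i
    using diff[OF one P(1)[unfolded coeffs_in_graph_def, rule_format, of 0]]
      uminus[OF P(1)[unfolded coeffs_in_graph_def, rule_format, of i]]
    by (auto simp: f_def)
  moreover have "(\<Sum>i\<le>n. f i * \<theta> ^ i) = 1"
  proof -
    have "(\<Sum>i\<le>n. f i * \<theta> ^ i) = (\<Sum>i\<le>n. (if i = 0 then 1 else 0) * \<theta> ^ i) - poly P \<theta>"
      unfolding f_def n_def poly_altdef by (simp add: left_diff_distrib sum_subtractf)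
    also have "(\<Sum>i\<le>n. (if i = 0 then 1 else 0) * \<theta> ^ i) = (\<Sum>i\<le>n. if i = 0 then 1 else 0)"
      by (rule sum.cong) auto
    finally show ?thesis using P(2) by simp
  qed
  ultimately show ?thesis by (auto simp: unit_relation_def)
qed

lemma unit_relation_pos: "unit_relation \<theta> n \<Longrightarrow> n > 0"
  using unique[OF one] by (cases n) (force simp: unit_relation_def)+

text \<open>Chevalley's argument: the relation of smaller degree \<open>m\<close> has the invertible element \<open>1 - g 0\<close>,
  so it expresses \<open>\<theta> ^ n\<close> by lower powers of \<open>\<theta>\<close>, and this shortens the relation of degree \<open>n\<close>.\<close>
lemma no_two_unit_relations:
  "unit_relation \<theta> n \<Longrightarrow> unit_relation \<theta>' m \<Longrightarrow> \<theta> * \<theta>' = 1 \<Longrightarrow> False"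
proof (induction "n + m" arbitrary: n m \<theta> \<theta>' rule: less_induct)
  case less
  have main: False if nm: "m \<le> n" and n: "unit_relation \<theta> n" and m: "unit_relation \<theta>' m" and \<theta>: "\<theta> * \<theta>' = 1"
    and IH: "unit_relation \<theta> (n - 1) \<Longrightarrow> False" for n m \<theta> \<theta>'
  proof -
    obtain f where f: "\<And>i. i \<le> n \<Longrightarrow> (f i, 0) \<in> G" "(\<Sum>i\<le>n. f i * \<theta> ^ i) = 1" using n by (auto simp: unit_relation_def)
    obtain g where g: "\<And>i. i \<le> m \<Longrightarrow> (g i, 0) \<in> G" "(\<Sum>i\<le>m. g i * \<theta>' ^ i) = 1" using m by (auto simp: unit_relation_def)
    have n0: "n > 0" "m > 0" using unit_relation_pos n m by auto
    have g0: "(1 - g 0, 1) \<in> G" using diff[OF one g(1)[of 0]] by simp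
    define u where "u = inverse (1 - g 0)"
    have u: "(u, 1) \<in> G" using inverse_in[OF g0] by (simp add: u_def)
    have "1 - g 0 \<noteq> 0" using g0 zeroD by fastforce
    moreover have "1 - g 0 = (\<Sum>i=1..m. g i * \<theta>' ^ i)"
      using g(2) by (simp add: sum.atLeast_Suc_atMost atMost_atLeast0 algebra_simps)
    ultimately have "1 = u * (\<Sum>i=1..m. g i * \<theta>' ^ i)" by (simp add: u_def)
    then have "\<theta> ^ n = u * (\<Sum>i=1..m. g i * \<theta>' ^ i) * \<theta> ^ n"
      by (simp only: mult_1)
    also have "\<dots> = (\<Sum>i=1..m. u * g i * (\<theta>' ^ i * \<theta> ^ n))"
      by (simp only: sum_distrib_left sum_distrib_right mult.assoc)
    also have "\<dots> = (\<Sum>i=1..m. u * g i * \<theta> ^ (n - i))"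
    proof (rule sum.cong)
      fix i assume "i \<in> {1..m}"
      then have "\<theta> ^ n = \<theta> ^ i * \<theta> ^ (n - i)" using nm by (simp flip: power_add)
      then have "\<theta>' ^ i * \<theta> ^ n = (\<theta> * \<theta>') ^ i * \<theta> ^ (n - i)" by (simp add: power_mult_distrib)
      then show "u * g i * (\<theta>' ^ i * \<theta> ^ n) = u * g i * \<theta> ^ (n - i)" using \<theta> by simp
    qed auto
    also have "\<dots> = (\<Sum>j\<in>{n - m..n - 1}. u * g (n - j) * \<theta> ^ j)"
      using nm n0 by (intro sum.reindex_bij_witness[of _ "\<lambda>j. n - j" "\<lambda>i. n - i"]) auto
    also have "\<dots> = (\<Sum>j\<le>n - 1. (if n - m \<le> j then u * g (n - j) else 0) * \<theta> ^ j)"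
      by (intro sum.mono_neutral_cong_left) auto
    finally have \<theta>n: "\<theta> ^ n = \<dots>" .
    define f' where "f' j = f j + f n * (if n - m \<le> j then u * g (n - j) else 0)" for j
    have "(\<Sum>i\<le>n. f i * \<theta> ^ i) = (\<Sum>i\<le>n - 1. f i * \<theta> ^ i) + f n * \<theta> ^ n"
      using n0 by (cases n) auto
    also have "\<dots> = (\<Sum>i\<le>n - 1. f' i * \<theta> ^ i)"
      unfolding \<theta>n sum_distrib_left sum.distrib[symmetric] by (rule sum.cong) (auto simp: f'_def algebra_simps)
    finally have "(\<Sum>i\<le>n - 1. f' i * \<theta> ^ i) = 1" using f(2) by simp
    moreover have "(f' i, 0) \<in> G" if "i \<le> n - 1" for i
    proof -
      have "((if n - m \<le> i then u * g (n - i) else 0), 0) \<in> G"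
        using mult[OF u g(1)[of "n - i"]] zero nm by auto
      from add[OF f(1)[of i] mult[OF f(1)[of n] this]] show ?thesis using that by (auto simp: f'_def)
    qed
    ultimately show False using IH by (auto simp: unit_relation_def)
  qed
  have "n > 0" "m > 0" using unit_relation_pos less.prems by auto
  then show False
    using main[of m n \<theta> \<theta>'] main[of n m \<theta>' \<theta>] less.prems less.hyps[of "n - 1" m \<theta> \<theta>'] less.hyps[of n "m - 1" \<theta> \<theta>']
    by (cases "m \<le> n") (auto simp: mult.commute)
qed

theorem valuation_ring: "x \<noteq> 0 \<Longrightarrow> (\<exists>c. (x, c) \<in> G) \<or> (\<exists>c. (inverse x, c) \<in> G)"
  using unit_relation_if_not_in[of x] unit_relation_if_not_in[of "inverse x"]
    no_two_unit_relations[of x _ "inverse x"] by (metis right_inverse)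

end

theorem place_graph_maximal_extension:
  fixes e :: "'k::alg_closed_field \<Rightarrow> 'f::field"
  assumes "field_embedding e" "place_graph e G0"
  obtains G where "G0 \<subseteq> G" "maximal_place e G"
proof -
  let ?A = "{G. place_graph e G \<and> G0 \<subseteq> G}"
  have "\<exists>M \<in> ?A. \<forall>Z \<in> ?A. M \<subseteq> Z \<longrightarrow> Z = M"
  proof (rule subset_Zorn_nonempty)
    fix \<C> assume C: "\<C> \<noteq> {}" "subset.chain ?A \<C>"
    have pg: "place_graph e Z" "G0 \<subseteq> Z" if "Z \<in> \<C>" for Z using C that by (auto simp: subset.chain_def)
    have tot: "Z \<subseteq> Y \<or> Y \<subseteq> Z" if "Z \<in> \<C>" "Y \<in> \<C>" for Z Y using C that by (auto simp: subset_chain_def)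
    have ep: "embedded_place e Z" if "Z \<in> \<C>" for Z
      using assms(1) pg(1)[OF that] by unfold_locales
    have two: "\<exists>Z\<in>\<C>. p \<in> Z \<and> q \<in> Z" if "p \<in> \<Union>\<C>" "q \<in> \<Union>\<C>" for p q using that tot by blast
    have "place_graph e (\<Union>\<C>)" unfolding place_graph_def
    proof (intro conjI allI impI, goal_cases)
      case (1 c)
      then show ?case using C(1) ep[THEN embedded_place.const] by blast
    next
      case (2 x c y d)
      then obtain Z where Z: "Z \<in> \<C>" "(x, c) \<in> Z" "(y, d) \<in> Z" using two by metis
      then show ?case using embedded_place.add[OF ep] by blast
    next
      case (3 x c y d)
      then obtain Z where Z: "Z \<in> \<C>" "(x, c) \<in> Z" "(y, d) \<in> Z" using two by metis
      then show ?case using embedded_place.mult[OF ep] by blast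
    next
      case (4 c)
      then show ?case using embedded_place.zeroD[OF ep] by blast
    qed
    then show "\<Union>\<C> \<in> ?A" using C(1) pg(2) by auto
  qed (use assms in auto)
  then obtain G where "G \<in> ?A" and max: "\<forall>Z\<in>?A. G \<subseteq> Z \<longrightarrow> Z = G" by (rule bexE)
  then have G: "place_graph e G" "G0 \<subseteq> G" by auto
  have eq: "Z = G" if Z: "place_graph e Z" "G \<subseteq> Z" for Z
  proof -
    have "Z \<in> ?A" using Z(1) order_trans[OF G(2) Z(2)] by simp
    then show ?thesis using max Z(2) by simp
  qed
  have "maximal_place e G" by unfold_locales (rule assms(1) G(1) eq; assumption?)+
  then show ?thesis by (rule that[OF G(2)])
qed

section \<open>Residually transcendental elements\<close>

definition is_ring_hom :: "('a::comm_ring_1 \<Rightarrow> 'b::comm_ring_1) \<Rightarrow> bool" where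
  "is_ring_hom h \<longleftrightarrow> h 1 = 1 \<and> (\<forall>x y. h (x + y) = h x + h y) \<and> (\<forall>x y. h (x * y) = h x * h y)"

lemma is_ring_hom_0: assumes "is_ring_hom h" shows "h 0 = 0"
proof -
  have "h (0 + 0) = h 0 + h 0" using assms unfolding is_ring_hom_def by blast
  then show ?thesis by (simp only: add_0_right add_cancel_right_right)
qed

lemma is_ring_hom_embedding: "field_embedding e \<Longrightarrow> is_ring_hom e"
  by (simp add: field_embedding_def is_ring_hom_def)

lemma is_ring_hom_poly: "is_ring_hom (\<lambda>p. poly p (a :: 'a::comm_ring_1))"
  by (simp add: is_ring_hom_def)

lemma degree_map_poly_le: "is_ring_hom h \<Longrightarrow> Polynomial.degree (map_poly h p) \<le> Polynomial.degree p"
  by (rule degree_le) (simp add: coeff_map_poly is_ring_hom_0 coeff_eq_0)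

lemma poly_map_poly_altdef:
  assumes "is_ring_hom h"
  shows "poly (map_poly h p) x = (\<Sum>i\<le>Polynomial.degree p. h (Polynomial.coeff p i) * x ^ i)"
proof -
  have "poly (map_poly h p) x = (\<Sum>i\<le>Polynomial.degree (map_poly h p). Polynomial.coeff (map_poly h p) i * x ^ i)"
    by (rule poly_altdef)
  also have "\<dots> = (\<Sum>i\<le>Polynomial.degree p. Polynomial.coeff (map_poly h p) i * x ^ i)"
    by (intro sum.mono_neutral_left) (auto intro!: order_trans[OF _ degree_map_poly_le[OF assms]] simp: coeff_eq_0 not_le)
  finally show ?thesis by (simp add: coeff_map_poly is_ring_hom_0[OF assms])
qed

lemma poly_map_poly_pCons:
  "is_ring_hom h \<Longrightarrow> poly (map_poly h (pCons c p)) x = h c + x * poly (map_poly h p) x"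
  by (simp add: map_poly_pCons is_ring_hom_0)

lemma poly_map_poly_add:
  assumes h: "is_ring_hom h"
  shows "poly (map_poly h (p + q)) x = poly (map_poly h p) x + poly (map_poly h q) x"
proof -
  have "map_poly h (p + q) = map_poly h p + map_poly h q"
    by (rule poly_eqI) (use h in \<open>simp add: coeff_map_poly is_ring_hom_0 is_ring_hom_def\<close>)
  then show ?thesis by simp
qed

lemma poly_map_poly_smult:
  assumes h: "is_ring_hom h"
  shows "poly (map_poly h (Polynomial.smult c p)) x = h c * poly (map_poly h p) x"
proof -
  have "map_poly h (Polynomial.smult c p) = Polynomial.smult (h c) (map_poly h p)"
    by (rule poly_eqI) (use h in \<open>simp add: coeff_map_poly is_ring_hom_0 is_ring_hom_def\<close>)
  then show ?thesis by simp
qed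

lemma poly_map_poly_mult:
  assumes h: "is_ring_hom h"
  shows "poly (map_poly h (p * q)) x = poly (map_poly h p) x * poly (map_poly h q) x"
proof (induction p)
  case (pCons c p)
  then show ?case
    by (simp add: mult_pCons_left poly_map_poly_add[OF h] poly_map_poly_smult[OF h] poly_map_poly_pCons[OF h]
        is_ring_hom_0[OF h] algebra_simps)
qed simp

lemma is_ring_hom_eval: "is_ring_hom h \<Longrightarrow> is_ring_hom (\<lambda>p. poly (map_poly h p) x)"
  unfolding is_ring_hom_def[of "\<lambda>p. poly (map_poly h p) x"]
  by (auto simp: poly_map_poly_add poly_map_poly_mult one_pCons poly_map_poly_pCons)
    (simp add: is_ring_hom_def)

lemma is_ring_hom_peval: "field_embedding e \<Longrightarrow> is_ring_hom (\<lambda>p. peval e p x)"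
  unfolding peval_def by (intro is_ring_hom_eval is_ring_hom_embedding)

lemma peval_pCons: "field_embedding e \<Longrightarrow> peval e (pCons c p) x = e c + x * peval e p x"
  unfolding peval_def by (intro poly_map_poly_pCons is_ring_hom_embedding)

lemma peval_0 [simp]: "peval e 0 x = 0" by (simp add: peval_def)

lemma peval_add: "field_embedding e \<Longrightarrow> peval e (p + q) x = peval e p x + peval e q x"
  and peval_mult: "field_embedding e \<Longrightarrow> peval e (p * q) x = peval e p x * peval e q x"
  and peval_1: "field_embedding e \<Longrightarrow> peval e 1 x = 1"
  using is_ring_hom_peval[of e x] by (auto simp: is_ring_hom_def)

lemma peval_smult: "field_embedding e \<Longrightarrow> peval e (Polynomial.smult c p) x = e c * peval e p x"
  unfolding peval_def by (intro poly_map_poly_smult is_ring_hom_embedding)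

lemma val_ge_poly:
  assumes "valuation v" "\<And>i. val_ge v (Polynomial.coeff p i) s" "val_ge v a 0"
  shows "val_ge v (poly p a) s"
  unfolding poly_altdef
  using val_ge_mult[OF assms(1) assms(2) val_ge_power[OF assms(1,3)]] by (intro val_ge_sum assms(1)) auto

definition transcendental_over :: "('k::field \<Rightarrow> 'f::field) \<Rightarrow> 'f \<Rightarrow> bool" where
  "transcendental_over e t \<longleftrightarrow> (\<forall>p. p \<noteq> 0 \<longrightarrow> peval e p t \<noteq> 0)"

text \<open>The evaluation \<open>K(T) \<rightarrow> F\<close> at a transcendental element \<open>t\<close>, an isomorphism onto the subfield \<open>K(t)\<close>.\<close>
definition fract_eval :: "('k::field \<Rightarrow> 'f::field) \<Rightarrow> 'f \<Rightarrow> 'k poly fract \<Rightarrow> 'f" where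
  "fract_eval e t x = (THE y. \<exists>p q. q \<noteq> 0 \<and> x = Fract p q \<and> y = peval e p t / peval e q t)"

lemma fract_eval_Fract:
  assumes "field_embedding e" "transcendental_over e t" "q \<noteq> 0"
  shows "fract_eval e t (Fract p q) = peval e p t / peval e q t"
  unfolding fract_eval_def
proof (rule the_equality)
  fix y assume "\<exists>p' q'. q' \<noteq> 0 \<and> Fract p q = Fract p' q' \<and> y = peval e p' t / peval e q' t"
  then obtain p' q' where *: "q' \<noteq> 0" "Fract p q = Fract p' q'" "y = peval e p' t / peval e q' t" by blast
  then have "p * q' = p' * q" using assms(3) by (simp add: eq_fract)
  then have "peval e p t * peval e q' t = peval e p' t * peval e q t"
    using peval_mult[OF assms(1)] by metis
  then show "y = peval e p t / peval e q t"
    using * assms(2,3) by (simp add: transcendental_over_def frac_eq_eq)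
qed (use assms(3) in blast)

lemma fract_eval_embedding:
  assumes e: "field_embedding e" and t: "transcendental_over e t"
  shows "field_embedding (fract_eval e t)"
proof -
  have nz: "peval e q t \<noteq> 0" if "q \<noteq> 0" for q using t that by (auto simp: transcendental_over_def)
  have "fract_eval e t 1 = 1"
    by (simp add: One_fract_def fract_eval_Fract[OF e t] nz)
  moreover have "fract_eval e t (x + y) = fract_eval e t x + fract_eval e t y" for x y
    by (cases x; cases y) (simp add: fract_eval_Fract[OF e t] peval_add[OF e] peval_mult[OF e] nz divide_simps)
  moreover have "fract_eval e t (x * y) = fract_eval e t x * fract_eval e t y" for x y
    by (cases x; cases y) (simp add: fract_eval_Fract[OF e t] peval_mult[OF e])
  ultimately show ?thesis by (auto simp: field_embedding_def)
qed

lemma fract_eval_const: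
  assumes "field_embedding e" "transcendental_over e t"
  shows "fract_eval e t (Fract p 1) = peval e p t"
  using fract_eval_Fract[OF assms, of 1 p] by (simp add: peval_1[OF assms(1)])

lemma fract_common_denominator:
  assumes "finite I"
  shows "\<exists>d p. d \<noteq> 0 \<and> (\<forall>i\<in>I. (c i :: 'a::idom fract) * Fract d 1 = Fract (p i) 1)"
  using assms
proof induction
  case (insert j I)
  then obtain d p where dp: "d \<noteq> 0" "\<forall>i\<in>I. c i * Fract d 1 = Fract (p i) 1" by blast
  obtain x y where xy: "c j = Fract x y" "y \<noteq> 0" by (cases "c j")
  have "c i * Fract (d * y) 1 = Fract (if i = j then d * x else p i * y) 1" if "i \<in> insert j I" for i
  proof (cases "i = j")
    case True
    then show ?thesis using xy by (simp add: eq_fract)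
  next
    case False
    have "c i * Fract (d * y) 1 = c i * Fract d 1 * Fract y 1" by (simp add: mult.assoc)
    moreover have "c i * Fract d 1 = Fract (p i) 1" using False that dp by auto
    ultimately have "c i * Fract (d * y) 1 = Fract (p i) 1 * Fract y 1" by (simp only:)
    then show ?thesis using False by simp
  qed
  then show ?case using dp xy by (intro exI[of _ "d * y"] exI[of _ "\<lambda>i. if i = j then d * x else p i * y"]) auto
qed (auto intro: exI[of _ 1])

text \<open>The field \<open>'f\<close> is a finite extension of \<open>K(t)\<close>, a rational function field.\<close>
definition finite_over :: "('k::field \<Rightarrow> 'f::field) \<Rightarrow> 'f \<Rightarrow> bool" where
  "finite_over e t \<longleftrightarrow> transcendental_over e t \<and>
     (\<exists>B. finite B \<and> module.span (\<lambda>c f. fract_eval e t c * f) B = UNIV)"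

text \<open>Powers of \<open>z\<close> are linearly dependent over \<open>K(t)\<close>; clearing denominators gives a polynomial relation over
  \<open>K[t]\<close> whose degree in \<open>z\<close> is bounded by the degree of the extension.\<close>
lemma finite_over_bounded_relation:
  assumes e: "field_embedding e" and "finite_over e t"
  shows "\<exists>N. \<forall>z. \<exists>P. P \<noteq> 0 \<and> Polynomial.degree P \<le> N \<and> poly (map_poly (\<lambda>p. peval e p t) P) z = 0"
proof -
  obtain B where B: "finite B" "module.span (\<lambda>c f. fract_eval e t c * f) B = UNIV" and t: "transcendental_over e t"
    using assms(2) by (auto simp: finite_over_def)
  interpret V: vector_space "\<lambda>c f. fract_eval e t c * f"
    by (rule field_embedding_vector_space[OF fract_eval_embedding[OF e t]])
  have "\<exists>P. P \<noteq> 0 \<and> Polynomial.degree P \<le> card B \<and> poly (map_poly (\<lambda>p. peval e p t) P) z = 0" for z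
  proof -
    obtain c where c: "(\<Sum>i\<le>card B. fract_eval e t (c i) * z ^ i) = 0" "\<exists>i\<le>card B. c i \<noteq> 0"
      using V.linear_relation[OF B(1), unfolded B(2), OF UNIV_I, of "\<lambda>i. z ^ i"] by blast
    obtain d p where d: "d \<noteq> 0" and p: "\<And>i. i \<le> card B \<Longrightarrow> c i * Fract d 1 = Fract (p i) 1"
      using fract_common_denominator[of "{..card B}" c] by auto
    define P where "P = (\<Sum>i\<le>card B. Polynomial.monom (p i) i)"
    note h = is_ring_hom_peval[OF e, of t]
    have cP: "Polynomial.coeff P i = (if i \<le> card B then p i else 0)" for i
      unfolding P_def by (simp add: coeff_sum)
    obtain i where i: "i \<le> card B" "c i \<noteq> 0" using c by blast
    have "Fract d 1 \<noteq> 0" using d by (simp add: Zero_fract_def eq_fract)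
    then have "Fract (p i) 1 \<noteq> 0"
      unfolding p[OF i(1), symmetric] using i by simp
    then have "p i \<noteq> 0" by (auto simp: fract_collapse)
    then have "P \<noteq> 0" using cP[of i] i by auto
    moreover have deg: "Polynomial.degree P \<le> card B" by (rule degree_le) (simp add: cP)
    moreover have "poly (map_poly (\<lambda>p. peval e p t) P) z = 0"
    proof -
      from deg have "poly (map_poly (\<lambda>p. peval e p t) P) z = (\<Sum>i\<le>card B. peval e (Polynomial.coeff P i) t * z ^ i)"
        unfolding poly_map_poly_altdef[OF h] by (intro sum.mono_neutral_left) (auto simp: coeff_eq_0)
      also have "\<dots> = (\<Sum>i\<le>card B. peval e d t * (fract_eval e t (c i) * z ^ i))"
      proof (rule sum.cong)
        fix i assume "i \<in> {..card B}"
        then have "fract_eval e t (c i * Fract d 1) = peval e (p i) t"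
          using p[of i] by (simp add: fract_eval_const[OF e t])
        then have "fract_eval e t (c i) * peval e d t = peval e (p i) t"
          by (simp add: field_embedding_mult[OF fract_eval_embedding[OF e t]] fract_eval_const[OF e t])
        then show "peval e (Polynomial.coeff P i) t * z ^ i = peval e d t * (fract_eval e t (c i) * z ^ i)"
          using \<open>i \<in> _\<close> by (simp add: cP mult.commute mult.left_commute)
      qed auto
      also have "\<dots> = 0" unfolding sum_distrib_left[symmetric] c(1) by simp
      finally show ?thesis .
    qed
    ultimately show ?thesis by blast
  qed
  then show ?thesis by blast
qed

lemma finite_over_relation:
  "field_embedding e \<Longrightarrow> finite_over e t \<Longrightarrow> \<exists>P. P \<noteq> 0 \<and> poly (map_poly (\<lambda>p. peval e p t) P) z = 0"
  using finite_over_bounded_relation by metis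

lemma value_group_divisible:
  fixes v :: "'k::alg_closed_field \<Rightarrow> real"
  assumes v: "valuation v" and "real n * s \<in> value_group v" "n > 0"
  shows "s \<in> value_group v"
proof -
  obtain x where x: "x \<noteq> 0" "v x = real n * s" using assms(2) by (auto simp: value_group_def)
  obtain y where y: "y ^ n = x" using nth_root_exists[of n x] assms(3) by blast
  then have "y \<noteq> 0" using x assms(3) by (auto simp: power_0_left)
  then show ?thesis using valuation_power[OF v, of y n] y x assms(3) by (auto simp: value_group_def image_iff intro!: exI[of _ y])
qed

lemma value_group_diff: "valuation v \<Longrightarrow> s \<in> value_group v \<Longrightarrow> s' \<in> value_group v \<Longrightarrow> s - s' \<in> value_group v"
  unfolding value_group_def by (auto simp flip: valuation_divide)

text \<open>The assumption \<open>residual\<close> says that the reduction of \<open>t\<close> is transcendental over the residue field of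
  \<open>v\<close>, without mentioning residue fields: a polynomial with integral coefficients, one of them a unit, takes
  a unit value at \<open>t\<close>.\<close>
locale gauss_extension =
  fixes v :: "'k::alg_closed_field \<Rightarrow> real" and e :: "'k \<Rightarrow> 'f::field" and w :: "'f \<Rightarrow> real" and t :: 'f
  assumes emb: "field_embedding e" and v: "valuation v" and w: "valuation w" and ext: "\<And>c. w (e c) = v c"
    and residual: "\<And>p i. (\<And>j. val_ge v (Polynomial.coeff p j) 0) \<Longrightarrow> Polynomial.coeff p i \<noteq> 0 \<Longrightarrow>
       v (Polynomial.coeff p i) = 0 \<Longrightarrow> peval e p t \<noteq> 0 \<and> w (peval e p t) = 0"
begin

text \<open>On \<open>K[t]\<close> the valuation is the Gauss valuation, as one sees after scaling a minimal coefficient to \<open>1\<close>.\<close>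
lemma gauss_value:
  assumes "p \<noteq> 0"
  obtains i where "Polynomial.coeff p i \<noteq> 0" "w (peval e p t) = v (Polynomial.coeff p i)" "peval e p t \<noteq> 0"
    "\<And>j. val_ge v (Polynomial.coeff p j) (w (peval e p t))"
proof -
  have "finite {i. Polynomial.coeff p i \<noteq> 0}" "{i. Polynomial.coeff p i \<noteq> 0} \<noteq> {}"
    using assms MOST_coeff_eq_0[of p] by (auto simp: MOST_iff_cofinite) (metis leading_coeff_0_iff)
  from finite_min_exists[OF this, of "\<lambda>i. v (Polynomial.coeff p i)"]
  obtain i where i: "Polynomial.coeff p i \<noteq> 0"
    "\<And>l. Polynomial.coeff p l \<noteq> 0 \<Longrightarrow> v (Polynomial.coeff p i) \<le> v (Polynomial.coeff p l)" by auto
  define q where "q = Polynomial.smult (inverse (Polynomial.coeff p i)) p"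
  have "peval e q t \<noteq> 0 \<and> w (peval e q t) = 0"
  proof (rule residual)
    show "Polynomial.coeff q i \<noteq> 0" "v (Polynomial.coeff q i) = 0"
      using i valuation_one[OF v] by (auto simp: q_def)
    show "val_ge v (Polynomial.coeff q j) 0" for j
      using i(2)[of j] i(1) v
      by (cases "Polynomial.coeff p j = 0") (auto simp: q_def val_ge_def valuation_mult valuation_inverse)
  qed
  moreover have "peval e p t = e (Polynomial.coeff p i) * peval e q t"
    using i by (simp add: q_def peval_smult[OF emb] field_embedding_inverse[OF emb] field_embedding_eq_0[OF emb])
  ultimately have "peval e p t \<noteq> 0" "w (peval e p t) = v (Polynomial.coeff p i)"
    using i by (auto simp: field_embedding_eq_0[OF emb] valuation_mult[OF w] ext)
  then show ?thesis using that[of i] i by (auto simp: val_ge_def)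
qed

lemma transcendental: "transcendental_over e t"
  unfolding transcendental_over_def using gauss_value by metis

definition primitive :: "'k poly \<Rightarrow> bool" where
  "primitive p \<longleftrightarrow> p \<noteq> 0 \<and> w (peval e p t) = 0"

lemma primitive_coeff: "primitive p \<Longrightarrow> val_ge v (Polynomial.coeff p i) 0"
  unfolding primitive_def using gauss_value by metis

lemma primitive_unit_coeff: assumes "primitive p" shows "\<exists>i. Polynomial.coeff p i \<noteq> 0 \<and> v (Polynomial.coeff p i) = 0"
proof -
  have "p \<noteq> 0" "w (peval e p t) = 0" using assms by (auto simp: primitive_def)
  then show ?thesis using gauss_value[of p] by metis
qed

lemma primitive_mult: "primitive p \<Longrightarrow> primitive q \<Longrightarrow> primitive (p * q)"
  using transcendental by (auto simp: primitive_def peval_mult[OF emb] valuation_mult[OF w] transcendental_over_def)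

lemma primitive_1: "primitive 1"
  by (simp add: primitive_def peval_1[OF emb] valuation_one[OF w])

lemma primitive_prod: "(\<And>q. q \<in> Q \<Longrightarrow> primitive q) \<Longrightarrow> primitive (\<Prod>Q)"
  by (induction Q rule: infinite_finite_induct) (auto intro: primitive_1 primitive_mult)

lemma primitive_part:
  assumes "p \<noteq> 0"
  obtains c q where "c \<noteq> 0" "primitive q" "p = Polynomial.smult c q" "v c = w (peval e p t)"
proof -
  obtain i where i: "Polynomial.coeff p i \<noteq> 0" "w (peval e p t) = v (Polynomial.coeff p i)" "peval e p t \<noteq> 0"
    using gauss_value[OF assms] by metis
  show ?thesis
  proof (rule that)
    show "primitive (Polynomial.smult (inverse (Polynomial.coeff p i)) p)"
      using i assms by (auto simp: primitive_def peval_smult[OF emb] valuation_mult[OF w] ext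
         valuation_inverse[OF v] field_embedding_eq_0[OF emb])
  qed (use i in auto)
qed

text \<open>If \<open>P\<close> is the product of all \<open>q\<close>, then \<open>X * P - 1\<close> has a constant coefficient and another coefficient of
  value 0, hence a root \<open>a\<close> of value 0. At this root all factors of \<open>a * P(a) = 1\<close> are integral, so they
  are units.\<close>
lemma generic_point:
  assumes "finite Q" "\<And>q. q \<in> Q \<Longrightarrow> primitive q"
  obtains a where "a \<noteq> 0" "v a = 0" "\<And>q. q \<in> Q \<Longrightarrow> poly q a \<noteq> 0 \<and> v (poly q a) = 0"
proof -
  define P where "P = \<Prod>Q"
  have P: "primitive P" unfolding P_def by (intro primitive_prod assms(2))
  obtain i where i: "Polynomial.coeff P i \<noteq> 0" "v (Polynomial.coeff P i) = 0" using primitive_unit_coeff[OF P] by blast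
  obtain a where a: "a \<noteq> 0" "v a = 0" "poly (pCons (- 1) P) a = 0"
  proof (rule poly_root_of_value_0[OF v, of "pCons (- 1) P" 0 "Suc i"])
    show "val_ge v (Polynomial.coeff (pCons (- 1) P) l) 0" for l
      using primitive_coeff[OF P] val_ge_one[OF v] v by (auto simp: coeff_pCons split: nat.split)
  qed (use i valuation_one[OF v] valuation_uminus[OF v] in auto)
  have va: "val_ge v a 0" using a by (simp add: val_ge_def)
  have unit: "poly q a \<noteq> 0 \<and> v (poly q a) = 0" if q: "q \<in> Q" for q
  proof -
    have "P = q * \<Prod>(Q - {q})" unfolding P_def using q assms(1) by (simp add: prod.remove)
    then have 1: "a * (poly q a * poly (\<Prod>(Q - {q})) a) = 1" using a(3) by simp
    have ge: "val_ge v (poly q a) 0" "val_ge v (poly (\<Prod>(Q - {q})) a) 0"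
      using assms(2) q by (auto intro!: val_ge_poly[OF v primitive_coeff va] primitive_prod)
    have nz: "poly q a \<noteq> 0" "poly (\<Prod>(Q - {q})) a \<noteq> 0" using 1 by auto
    then have "v a + (v (poly q a) + v (poly (\<Prod>(Q - {q})) a)) = 0"
      using arg_cong[OF 1, of v] a(1) by (simp add: valuation_mult[OF v] valuation_one[OF v])
    then show ?thesis using nz ge a(2) by (auto simp: val_ge_def)
  qed
  show ?thesis by (rule that[OF a(1,2) unit])
qed

text \<open>In a vanishing sum two terms have the same value. Applied to an algebraic relation of \<open>z\<close> over \<open>K[t]\<close>,
  this makes a positive multiple of \<open>w z\<close> a difference of Gauss values, and the value group of an
  algebraically closed field is divisible.\<close>
lemma value_in_value_group:
  assumes fin: "finite_over e t" and "z \<noteq> 0" shows "w z \<in> value_group v"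
proof -
  obtain P where P: "P \<noteq> 0" "poly (map_poly (\<lambda>p. peval e p t) P) z = 0"
    using finite_over_relation[OF emb fin] by blast
  define f where "f i = peval e (Polynomial.coeff P i) t * z ^ i" for i
  have f0: "f i \<noteq> 0 \<longleftrightarrow> Polynomial.coeff P i \<noteq> 0" for i
    using transcendental assms(2) by (auto simp: f_def transcendental_over_def)
  have "sum f {..Polynomial.degree P} = 0"
    using P(2) unfolding poly_map_poly_altdef[OF is_ring_hom_peval[OF emb]] f_def by simp
  moreover have "f (Polynomial.degree P) \<noteq> 0" using P(1) by (simp add: f0)
  ultimately obtain i j where ij: "i \<noteq> j" "f i \<noteq> 0" "f j \<noteq> 0" "w (f i) = w (f j)"
    using valuation_sum_eq_0[OF w, of "{..Polynomial.degree P}" f] by (metis atMost_iff finite_atMost order_refl)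
  have c: "w (peval e (Polynomial.coeff P l) t) \<in> value_group v" if "f l \<noteq> 0" for l
  proof -
    have "Polynomial.coeff P l \<noteq> 0" using that f0 by blast
    then obtain i where "Polynomial.coeff (Polynomial.coeff P l) i \<noteq> 0"
      "w (peval e (Polynomial.coeff P l) t) = v (Polynomial.coeff (Polynomial.coeff P l) i)" by (rule gauss_value)
    then show ?thesis by (simp add: value_group_def)
  qed
  have wf: "w (f l) = w (peval e (Polynomial.coeff P l) t) + real l * w z" if "f l \<noteq> 0" for l
    using that assms(2) by (auto simp: f_def valuation_mult[OF w] valuation_power[OF w])
  have "w z \<in> value_group v"
    if "f i \<noteq> 0" "f j \<noteq> 0" "w (f i) = w (f j)" "i < j" for i j
  proof (rule value_group_divisible[OF v, of "j - i"])
    have "real (j - i) * w z = w (peval e (Polynomial.coeff P i) t) - w (peval e (Polynomial.coeff P j) t)"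
      using that wf[of i] wf[of j] by (simp add: of_nat_diff algebra_simps)
    then show "real (j - i) * w z \<in> value_group v" using c that value_group_diff[OF v] by metis
  qed (use that in auto)
  then show ?thesis using ij by (metis nat_neq_iff)
qed

end

section \<open>Functionals bounded by a residually transcendental valuation\<close>

text \<open>Valuation rings are integrally closed: if \<open>x\<close> were outside, \<open>1 / x\<close> would have value 0, and dividing the
  relation by \<open>x ^ n\<close> would give \<open>c n = 0\<close>.\<close>
lemma (in maximal_place) root_in:
  assumes f: "\<And>i. i \<le> n \<Longrightarrow> (f i, c i) \<in> G" and cn: "c n \<noteq> 0" and rel: "(\<Sum>i\<le>n. f i * x ^ i) = 0"
  shows "\<exists>d. (x, d) \<in> G"
proof (cases "x = 0")
  case True
  then show ?thesis using zero by blast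
next
  case x0: False
  show ?thesis
  proof (cases "\<exists>d. (x, d) \<in> G")
    case False
    then obtain d where d: "(inverse x, d) \<in> G" using valuation_ring[OF x0] by blast
    have "d = 0" using inverse_in[OF d] False by auto
    have "(\<Sum>i\<le>n. f i * inverse x ^ (n - i)) = (\<Sum>i\<le>n. f i * x ^ i) * inverse x ^ n"
      unfolding sum_distrib_right
    proof (rule sum.cong[OF refl])
      fix i assume "i \<in> {..n}"
      then have "inverse x ^ n = inverse x ^ i * inverse x ^ (n - i)" by (simp flip: power_add)
      then show "f i * inverse x ^ (n - i) = f i * x ^ i * inverse x ^ n"
        using x0 by (simp add: power_inverse)
    qed
    then have "(\<Sum>i\<le>n. f i * inverse x ^ (n - i)) = 0" using rel by simp
    moreover have "(\<Sum>i\<le>n. f i * inverse x ^ (n - i), \<Sum>i\<le>n. c i * d ^ (n - i)) \<in> G"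
      by (intro sum mult power d) (simp add: f)
    ultimately have "(\<Sum>i\<le>n. c i * d ^ (n - i)) = 0" using zeroD by simp
    moreover have "(\<Sum>i\<le>n. c i * d ^ (n - i)) = (\<Sum>i\<le>n. if i = n then c n else 0)"
      using \<open>d = 0\<close> by (intro sum.cong) (auto simp: power_0_left)
    ultimately show ?thesis using cn by simp
  qed
qed

context gauss_extension
begin

lemma emb_fract: "field_embedding (fract_eval e t)"
  by (rule fract_eval_embedding[OF emb transcendental])

text \<open>After scaling, \<open>c\<close> has a reduction whose denominator does not vanish at the reduction of \<open>a\<close>.\<close>
definition regular_fract :: "'k \<Rightarrow> 'k poly fract \<Rightarrow> bool" where
  "regular_fract a c \<longleftrightarrow> (\<exists>p q. c = Fract p q \<and> primitive q \<and> poly q a \<noteq> 0 \<and> v (poly q a) = 0)"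

lemma primitive_nz: "primitive q \<Longrightarrow> q \<noteq> 0" by (simp add: primitive_def)

lemma regular_fract_add:
  assumes "regular_fract a c" "regular_fract a d" shows "regular_fract a (c + d)"
proof -
  obtain p q p' q' where *: "c = Fract p q" "primitive q" "poly q a \<noteq> 0" "v (poly q a) = 0"
    "d = Fract p' q'" "primitive q'" "poly q' a \<noteq> 0" "v (poly q' a) = 0"
    using assms by (auto simp: regular_fract_def)
  show ?thesis unfolding regular_fract_def
    by (intro exI[of _ "p * q' + p' * q"] exI[of _ "q * q'"])
      (use * in \<open>simp add: primitive_nz primitive_mult valuation_mult[OF v]\<close>)
qed

lemma regular_fract_mult:
  assumes "regular_fract a c" "regular_fract a d" shows "regular_fract a (c * d)"
proof -
  obtain p q p' q' where *: "c = Fract p q" "primitive q" "poly q a \<noteq> 0" "v (poly q a) = 0"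
    "d = Fract p' q'" "primitive q'" "poly q' a \<noteq> 0" "v (poly q' a) = 0"
    using assms by (auto simp: regular_fract_def)
  show ?thesis unfolding regular_fract_def
    by (intro exI[of _ "p * p'"] exI[of _ "q * q'"])
      (use * in \<open>simp add: primitive_nz primitive_mult valuation_mult[OF v]\<close>)
qed

lemma regular_fract_poly: "regular_fract a (Fract p 1)"
  unfolding regular_fract_def
  by (intro exI[of _ p] exI[of _ 1]) (simp add: primitive_1 valuation_one[OF v])

lemma regular_fract_0: "regular_fract a 0"
  unfolding Zero_fract_def by (rule regular_fract_poly)

lemma fract_primitive_denominator: "\<exists>p q. c = Fract p q \<and> primitive q"
proof -
  obtain p q where c: "c = Fract p q" "q \<noteq> 0" by (cases c)
  obtain k q' where q': "k \<noteq> 0" "primitive q'" "q = Polynomial.smult k q'"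
    using primitive_part[OF c(2)] by metis
  have "c = Fract (Polynomial.smult (inverse k) p) q'"
    unfolding c(1) using q' c(2) primitive_nz[OF q'(2)] by (simp add: eq_fract)
  with q'(2) show ?thesis by blast
qed

text \<open>At \<open>t = a\<close> such a function takes a value of size at most its Gauss norm, since the denominator takes a unit
  value there.\<close>
lemma regular_fract_place:
  assumes G: "maximal_place e G" and GP: "\<And>p. (peval e p t, poly p a) \<in> G"
    and a: "val_ge v a 0" and c: "regular_fract a c" and cs: "val_ge w (fract_eval e t c) s"
  shows "\<exists>d. (fract_eval e t c, d) \<in> G \<and> val_ge v d s"
proof -
  interpret maximal_place e G by fact
  obtain p q where *: "c = Fract p q" "primitive q" "poly q a \<noteq> 0" "v (poly q a) = 0"
    using c by (auto simp: regular_fract_def)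
  have fe: "fract_eval e t c = peval e p t * inverse (peval e q t)"
    unfolding *(1) fract_eval_Fract[OF emb transcendental primitive_nz[OF *(2)]] by (simp add: divide_inverse)
  have G: "(fract_eval e t c, poly p a * inverse (poly q a)) \<in> G"
    unfolding fe by (intro mult GP inverse_in) (rule *(3))
  have "val_ge v (poly p a) s"
  proof (cases "p = 0")
    case False
    have q: "peval e q t \<noteq> 0" "w (peval e q t) = 0"
      using transcendental *(2) by (auto simp: primitive_def transcendental_over_def)
    have i: "peval e p t \<noteq> 0 \<and> (\<forall>j. val_ge v (Polynomial.coeff p j) (w (peval e p t)))"
      by (rule gauss_value[OF False]) simp
    have "s \<le> w (peval e p t)"
      using cs i q unfolding fe by (simp add: val_ge_def valuation_mult[OF w] valuation_inverse[OF w])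
    then show ?thesis by (intro val_ge_poly[OF v _ a] val_ge_trans[OF i[THEN conjunct2, rule_format]])
  qed simp
  moreover have "val_ge v (inverse (poly q a)) 0"
    using *(3,4) by (simp add: val_ge_def valuation_inverse[OF v])
  ultimately have "val_ge v (poly p a * inverse (poly q a)) s"
    using val_ge_mult[OF v, of "poly p a" s "inverse (poly q a)" 0] by simp
  then show ?thesis using G by blast
qed

text \<open>Scaled so that the minimal Gauss value of its coefficients is 0, the relation has two primitive
  coefficients, because \<open>w z = 0\<close> and the smallest terms of a vanishing sum cannot be unique. After a
  generic specialization \<open>t = a\<close> they give the slope 0 in the Newton polygon.\<close>
lemma minimal_relation:
  assumes fin: "finite_over e t" and z: "z \<noteq> 0" "w z = 0"
  obtains P i j where "P \<noteq> 0" "poly (map_poly (\<lambda>p. peval e p t) P) z = 0"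
    "\<And>Q. Q \<noteq> 0 \<Longrightarrow> poly (map_poly (\<lambda>p. peval e p t) Q) z = 0 \<Longrightarrow> Polynomial.degree P \<le> Polynomial.degree Q"
    "\<And>l m. val_ge v (Polynomial.coeff (Polynomial.coeff P l) m) 0"
    "i \<noteq> j" "primitive (Polynomial.coeff P i)" "primitive (Polynomial.coeff P j)"
proof -
  note h = is_ring_hom_peval[OF emb, of t]
  let ?ev = "\<lambda>Q. poly (map_poly (\<lambda>p. peval e p t) Q) z"
  obtain P0 where "P0 \<noteq> 0 \<and> ?ev P0 = 0" using finite_over_relation[OF emb fin] by blast
  from ex_has_least_nat[of "\<lambda>P. P \<noteq> 0 \<and> ?ev P = 0", OF this, of Polynomial.degree]
  obtain P where P: "P \<noteq> 0" "?ev P = 0"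
    and min: "\<And>Q. Q \<noteq> 0 \<Longrightarrow> ?ev Q = 0 \<Longrightarrow> Polynomial.degree P \<le> Polynomial.degree Q" by auto
  define f where "f i = peval e (Polynomial.coeff P i) t * z ^ i" for i
  have f0: "f i \<noteq> 0 \<longleftrightarrow> Polynomial.coeff P i \<noteq> 0" for i
    using transcendental z by (auto simp: f_def transcendental_over_def)
  have wf: "w (f i) = w (peval e (Polynomial.coeff P i) t)" if "Polynomial.coeff P i \<noteq> 0" for i
    using that f0[of i] z by (simp add: f_def valuation_mult[OF w] valuation_power[OF w])
  have 1: "sum f {..Polynomial.degree P} = 0" using P(2) unfolding poly_map_poly_altdef[OF h] f_def .
  have 2: "Polynomial.degree P \<in> {..Polynomial.degree P}" by simp
  have 3: "f (Polynomial.degree P) \<noteq> 0" using P(1) by (simp add: f0)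
  obtain i j where ij: "i \<noteq> j" "f i \<noteq> 0" "f j \<noteq> 0" "w (f i) = w (f j)"
    "\<And>l. l \<in> {..Polynomial.degree P} \<Longrightarrow> val_ge w (f l) (w (f i))"
  proof (rule valuation_sum_eq_0[OF w finite_atMost 1 2 3], goal_cases)
    case (1 i j)
    show ?thesis by (rule 1(1)[OF 1(4-7) 1(8)])
  qed
  obtain k where k: "k \<noteq> 0" "v k = w (f i)"
    using primitive_part[of "Polynomial.coeff P i"] ij(2) wf unfolding f0 by metis
  define R where "R = Polynomial.smult [:inverse k:] P"
  have cR: "Polynomial.coeff R l = Polynomial.smult (inverse k) (Polynomial.coeff P l)" for l
    by (simp add: R_def)
  have pe: "peval e (Polynomial.coeff R l) t = e (inverse k) * peval e (Polynomial.coeff P l) t" for l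
    unfolding cR by (rule peval_smult[OF emb])
  have ei: "e (inverse k) \<noteq> 0" using k by (simp add: field_embedding_eq_0[OF emb])
  have wR: "w (peval e (Polynomial.coeff R l) t) = w (f l) - w (f i)" if "Polynomial.coeff P l \<noteq> 0" for l
  proof -
    have "peval e (Polynomial.coeff P l) t \<noteq> 0" using that transcendental by (simp add: transcendental_over_def)
    then show ?thesis unfolding pe wf[OF that]
      using ei k by (simp add: valuation_mult[OF w] ext valuation_inverse[OF v])
  qed
  show ?thesis
  proof (rule that[of R i j])
    show "R \<noteq> 0" using P(1) k by (simp add: R_def)
    show "?ev R = 0" unfolding R_def poly_map_poly_smult[OF h] P(2) by simp
    show "Polynomial.degree R \<le> Polynomial.degree Q" if "Q \<noteq> 0" "?ev Q = 0" for Q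
      using min[OF that] k by (simp add: R_def)
    show "primitive (Polynomial.coeff R i)" "primitive (Polynomial.coeff R j)"
      using ij(2-4) wR[of i] wR[of j] k unfolding f0 primitive_def by (auto simp: cR)
    show "val_ge v (Polynomial.coeff (Polynomial.coeff R l) m) 0" for l m
    proof (cases "Polynomial.coeff P l = 0")
      case False
      then have "Polynomial.coeff R l \<noteq> 0" using k by (simp add: cR)
      then have *: "val_ge v (Polynomial.coeff (Polynomial.coeff R l) m) (w (peval e (Polynomial.coeff R l) t))"
        by (rule gauss_value)
      have "l \<in> {..Polynomial.degree P}" using False by (simp add: le_degree)
      then have "w (f i) \<le> w (f l)" using ij(5)[of l] False f0[of l] by (auto simp: val_ge_def)
      then show ?thesis using wR[OF False] by (intro val_ge_trans[OF *]) simp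
    qed (simp add: cR)
  qed (rule ij(1))
qed

text \<open>The specialization \<open>t \<mapsto> a\<close>, \<open>z \<mapsto> \<zeta>\<close> of \<open>K[t, z]\<close> is well defined: by pseudo-division, a polynomial \<open>Q\<close>
  vanishing at \<open>(t, z)\<close> becomes a multiple of the minimal relation \<open>P\<close> after multiplication by a power of
  the leading coefficient of \<open>P\<close>, which does not vanish at \<open>a\<close>.\<close>
lemma specialization_graph:
  assumes P: "P \<noteq> 0" "poly (map_poly (\<lambda>p. peval e p t) P) z = 0"
    and min: "\<And>Q. Q \<noteq> 0 \<Longrightarrow> poly (map_poly (\<lambda>p. peval e p t) Q) z = 0 \<Longrightarrow> Polynomial.degree P \<le> Polynomial.degree Q"
    and lc: "poly (Polynomial.lead_coeff P) a \<noteq> 0"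
    and \<zeta>: "poly (map_poly (\<lambda>p. poly p a) P) \<zeta> = 0"
  defines "G0 \<equiv> {(poly (map_poly (\<lambda>p. peval e p t) Q) z, poly (map_poly (\<lambda>p. poly p a) Q) \<zeta>) | Q. True}"
  shows "place_graph e G0" "(z, \<zeta>) \<in> G0" "(peval e p t, poly p a) \<in> G0"
proof -
  let ?ev = "\<lambda>Q. poly (map_poly (\<lambda>p. peval e p t) Q) z" and ?sp = "\<lambda>Q. poly (map_poly (\<lambda>p. poly p a) Q) \<zeta>"
  note h = is_ring_hom_peval[OF emb, of t] and h' = is_ring_hom_poly[of a]
  have mem: "(?ev Q, ?sp Q) \<in> G0" for Q unfolding G0_def by blast
  have const: "(peval e p t, poly p a) \<in> G0" for p
    using mem[of "[:p:]"] by (simp add: poly_map_poly_pCons[OF h] poly_map_poly_pCons[OF h'])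
  show "(peval e p t, poly p a) \<in> G0" by (rule const)
  show "(z, \<zeta>) \<in> G0"
    using mem[of "[:0, 1:]"] by (simp add: poly_map_poly_pCons[OF h] poly_map_poly_pCons[OF h'] peval_1[OF emb])
  have functional: "?sp Q = 0" if Q: "?ev Q = 0" for Q
  proof -
    obtain q r where qr: "pseudo_divmod Q P = (q, r)" by (cases "pseudo_divmod Q P")
    define n where "n = Suc (Polynomial.degree Q) - Polynomial.degree P"
    have div: "Polynomial.smult (Polynomial.lead_coeff P ^ n) Q = P * q + r" "r = 0 \<or> Polynomial.degree r < Polynomial.degree P"
      using pseudo_divmod[OF P(1) qr] by (auto simp: n_def)
    have "?ev (Polynomial.smult (Polynomial.lead_coeff P ^ n) Q) = ?ev P * ?ev q + ?ev r"
      unfolding div(1) poly_map_poly_add[OF h] poly_map_poly_mult[OF h] ..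
    then have "?ev r = 0" unfolding poly_map_poly_smult[OF h] Q P(2) by simp
    then have "r = 0" using min[of r] div(2) by (cases "r = 0") auto
    have "?sp (Polynomial.smult (Polynomial.lead_coeff P ^ n) Q) = ?sp P * ?sp q"
      unfolding div(1) \<open>r = 0\<close> poly_map_poly_add[OF h'] poly_map_poly_mult[OF h'] by simp
    then have "poly (Polynomial.lead_coeff P) a ^ n * ?sp Q = 0"
      unfolding poly_map_poly_smult[OF h'] \<zeta> by simp
    then show ?thesis using lc by simp
  qed
  show "place_graph e G0" unfolding place_graph_def
  proof (intro conjI allI impI)
    fix c show "(e c, c) \<in> G0" using const[of "[:c:]"] by (simp add: peval_pCons[OF emb])
  next
    fix x c y d assume "(x, c) \<in> G0" "(y, d) \<in> G0"
    then obtain Q R where *: "x = ?ev Q" "c = ?sp Q" "y = ?ev R" "d = ?sp R" by (auto simp: G0_def)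
    show "(x + y, c + d) \<in> G0"
      using mem[of "Q + R"] unfolding * poly_map_poly_add[OF h] poly_map_poly_add[OF h'] .
    show "(x * y, c * d) \<in> G0"
      using mem[of "Q * R"] unfolding * poly_map_poly_mult[OF h] poly_map_poly_mult[OF h'] .
  next
    fix c assume "(0, c) \<in> G0"
    then obtain Q where "0 = ?ev Q" "c = ?sp Q" by (auto simp: G0_def)
    then show "c = 0" using functional[of Q] by simp
  qed
qed

text \<open>The powers of \<open>g\<close> lie in a finitely generated module, so their coordinates with respect to \<open>B\<close>
  are bounded independently of the exponent. Therefore all powers of the value \<open>c\<close> of \<open>g\<close> are
  bounded by the same constant, which forces \<open>v c \<ge> 0\<close>.\<close>
lemma bounded_integral_place:
  assumes ext: "finite_valued_extension (fract_eval e t) w B" and B: "module.independent (\<lambda>c f. fract_eval e t c * f) B"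
    and G: "maximal_place e G" and GP: "\<And>p. (peval e p t, poly p a) \<in> G" and a: "val_ge v a 0"
    and GB: "\<And>b. b \<in> B \<Longrightarrow> \<exists>c. (b, c) \<in> G"
    and int: "finite_valued_extension.integral (fract_eval e t) w g"
    and reg: "\<And>k b. b \<in> B \<Longrightarrow> regular_fract a (module.representation (\<lambda>c f. fract_eval e t c * f) B (g ^ k) b)"
    and gc: "(g, c) \<in> G"
  shows "val_ge v c 0"
proof -
  interpret E: finite_valued_extension "fract_eval e t" w B by fact
  interpret G: maximal_place e G by fact
  let ?\<psi> = "fract_eval e t" and ?rep = "E.vs.representation B"
  note emb' = emb_fract
  obtain T where T: "finite T" "\<And>k. g ^ k \<in> E.int_span T" using int by (auto simp: E.integral_def)
  have inspan: "x \<in> E.vs.span B" for x using E.spanB by simp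
  define s where "s = Min (insert 0 ((\<lambda>(x, b). w (?\<psi> (?rep x b))) ` (T \<times> B)))"
  have s: "s \<le> w (?\<psi> (?rep x b))" if "x \<in> T" "b \<in> B" for x b
    unfolding s_def using that T(1) E.finB by (intro Min_le) auto
  have rep: "val_ge w (?\<psi> (?rep x b)) s" if x: "x \<in> E.int_span T" and b: "b \<in> B" for x b
    using x
  proof (induction rule: E.int_span.induct)
    case zero
    then show ?case by (simp add: E.vs.representation_zero field_embedding_0[OF emb'])
  next
    case (step d x y)
    have eq: "?rep (?\<psi> d * x + y) b = d * ?rep x b + ?rep y b"
      using E.vs.representation_add[OF B inspan inspan, of "?\<psi> d * x" y]
        E.vs.representation_scale[OF B inspan, of d x] by simp
    have "val_ge w (?\<psi> d * ?\<psi> (?rep x b)) (0 + s)"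
      using step s[OF _ b] by (intro val_ge_mult[OF w]) (auto simp: val_ge_def)
    then show ?case using step.IH
      unfolding eq field_embedding_add[OF emb'] field_embedding_mult[OF emb'] by (intro val_ge_add[OF w]) auto
  qed
  obtain \<beta> where \<beta>: "\<And>b. b \<in> B \<Longrightarrow> (b, \<beta> b) \<in> G" using GB by metis
  define s' where "s' = Min (insert 0 ((\<lambda>b. v (\<beta> b)) ` B))"
  have s': "val_ge v (\<beta> b) s'" if "b \<in> B" for b
    unfolding s'_def val_ge_def using that E.finB by (intro disjI2 Min_le) auto
  have ck: "val_ge v (c ^ k) (s + s')" for k
  proof -
    have "\<exists>d. (?\<psi> (?rep (g ^ k) b), d) \<in> G \<and> val_ge v d s" if "b \<in> B" for b
      by (rule regular_fract_place[OF G GP a reg[OF that] rep[OF T(2) that]])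
    then obtain d where d: "\<And>b. b \<in> B \<Longrightarrow> (?\<psi> (?rep (g ^ k) b), d b) \<in> G \<and> val_ge v (d b) s" by metis
    have "(\<Sum>b\<in>B. ?\<psi> (?rep (g ^ k) b) * b, \<Sum>b\<in>B. d b * \<beta> b) \<in> G"
      using d \<beta> by (intro G.sum G.mult) auto
    moreover have "(\<Sum>b\<in>B. ?\<psi> (?rep (g ^ k) b) * b) = g ^ k"
      by (rule E.vs.sum_representation_eq[OF B inspan E.finB order_refl])
    ultimately have "c ^ k = (\<Sum>b\<in>B. d b * \<beta> b)" using G.unique G.power[OF gc] by metis
    moreover have "val_ge v (\<Sum>b\<in>B. d b * \<beta> b) (s + s')"
      using d s' by (intro val_ge_sum[OF v] val_ge_mult[OF v]) auto
    ultimately show ?thesis by simp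
  qed
  show ?thesis
  proof (rule ccontr)
    assume "\<not> ?thesis"
    then have c: "c \<noteq> 0" "- v c > 0" by (auto simp: val_ge_def)
    obtain k where "- (s + s') < real k * (- v c)" using reals_Archimedean3[OF c(2)] by blast
    moreover have "s + s' \<le> real k * v c" using ck[of k] c(1) by (simp add: val_ge_def valuation_power[OF v])
    ultimately show False by simp
  qed
qed

text \<open>The functions with coordinates regular at \<open>a\<close> form a ring if the products of basis elements have
  such coordinates. Finitely many conditions on \<open>a\<close> therefore control all powers of a function.\<close>
lemma regular_representation_closed:
  assumes ext: "finite_valued_extension (fract_eval e t) w B" and B: "module.independent (\<lambda>c f. fract_eval e t c * f) B"
    and BB: "\<And>b b' b''. b \<in> B \<Longrightarrow> b' \<in> B \<Longrightarrow> b'' \<in> B \<Longrightarrow>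
       regular_fract a (module.representation (\<lambda>c f. fract_eval e t c * f) B (b * b') b'')"
  defines "R \<equiv> {f. \<forall>b\<in>B. regular_fract a (module.representation (\<lambda>c f. fract_eval e t c * f) B f b)}"
  shows "0 \<in> R" "\<And>f g. f \<in> R \<Longrightarrow> g \<in> R \<Longrightarrow> f + g \<in> R" "\<And>c f. f \<in> R \<Longrightarrow> e c * f \<in> R"
    "\<And>f g. f \<in> R \<Longrightarrow> g \<in> R \<Longrightarrow> f * g \<in> R"
proof -
  interpret E: finite_valued_extension "fract_eval e t" w B by fact
  let ?\<psi> = "fract_eval e t" and ?rep = "E.vs.representation B"
  have inspan: "x \<in> E.vs.span B" for x using E.spanB by simp
  have R: "f \<in> R \<longleftrightarrow> (\<forall>b\<in>B. regular_fract a (?rep f b))" for f by (simp add: R_def)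
  show R0: "0 \<in> R" by (simp add: R E.vs.representation_zero regular_fract_0)
  show add: "f + g \<in> R" if "f \<in> R" "g \<in> R" for f g
    using that E.vs.representation_add[OF B inspan inspan, of f g] by (simp add: R regular_fract_add)
  have scale: "?\<psi> c * f \<in> R" if "regular_fract a c" "f \<in> R" for c f
    using that E.vs.representation_scale[OF B inspan, of c f] by (simp add: R regular_fract_mult)
  show "e c * f \<in> R" if "f \<in> R" for c f
    using scale[OF regular_fract_poly[of a "[:c:]"] that]
    by (simp add: fract_eval_const[OF emb transcendental] peval_pCons[OF emb])
  have sum: "sum h I \<in> R" if "\<And>i. i \<in> I \<Longrightarrow> h i \<in> R" for h and I :: "'f set"
    using that by (induction I rule: infinite_finite_induct) (auto intro: R0 add)
  show "f * g \<in> R" if "f \<in> R" "g \<in> R" for f g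
  proof -
    have ex: "(\<Sum>b\<in>B. ?\<psi> (?rep f b) * b) = f" for f
      by (rule E.vs.sum_representation_eq[OF B inspan E.finB order_refl])
    have "f * g = (\<Sum>b\<in>B. ?\<psi> (?rep f b) * b) * (\<Sum>b\<in>B. ?\<psi> (?rep g b) * b)"
      unfolding ex ..
    also have "\<dots> = (\<Sum>b\<in>B. \<Sum>b'\<in>B. ?\<psi> (?rep f b) * (?\<psi> (?rep g b') * (b * b')))"
      unfolding sum_product by (intro sum.cong refl) (simp add: mult.assoc mult.left_commute)
    also have "\<dots> \<in> R"
    proof (intro sum scale)
      fix b b' assume "b \<in> B" "b' \<in> B"
      then show "b * b' \<in> R" using BB by (simp add: R)
    qed (use that in \<open>auto simp: R\<close>)
    finally show ?thesis .
  qed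
qed

text \<open>The place is chosen over a generic \<open>t = a\<close> such that \<open>z = y * (y ^ n * f)\<close> has a unit value \<open>\<zeta>\<close>.
  Both factors are integral, so both have unit values, and with \<open>y\<close> also \<open>f\<close>. If \<open>w g \<ge> 0\<close>,
  then \<open>y ^ m * g\<close> is integral for some \<open>m\<close>, and dividing by the unit value of \<open>y ^ m\<close> bounds the value of \<open>g\<close>.\<close>
theorem dominated_functional_unit:
  assumes fin: "finite_over e t" and S: "finite S" and f: "f \<in> module.span (\<lambda>c f. e c * f) S" "f \<noteq> 0" "w f = 0"
  obtains G where "maximal_place e G" "\<And>g. g \<in> module.span (\<lambda>c f. e c * f) S \<Longrightarrow> \<exists>c. (g, c) \<in> G"
    "\<And>g c. g \<in> module.span (\<lambda>c f. e c * f) S \<Longrightarrow> val_ge w g 0 \<Longrightarrow> (g, c) \<in> G \<Longrightarrow> val_ge v c 0"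
    "\<And>c. (f, c) \<in> G \<Longrightarrow> c \<noteq> 0 \<and> v c = 0"
proof -
  let ?\<psi> = "fract_eval e t"
  interpret K: vector_space "\<lambda>c f. e c * f" by (rule field_embedding_vector_space[OF emb])
  interpret L: vector_space "\<lambda>c f. ?\<psi> c * f" by (rule field_embedding_vector_space[OF emb_fract])
  obtain B0 where B0: "finite B0" "L.span B0 = UNIV" using fin by (auto simp: finite_over_def)
  obtain B where B: "B \<subseteq> B0" "L.independent B" "B0 \<subseteq> L.span B"
    using L.maximal_independent_subset[of B0] by blast
  have spB: "L.span B = UNIV"
    using L.span_minimal[OF B(3) L.subspace_span] B0(2) by auto
  have finB: "finite B" using B(1) B0(1) by (rule finite_subset)
  interpret E: finite_valued_extension ?\<psi> w B
    by unfold_locales (rule emb_fract w finB spB)+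
  note ext = E.finite_valued_extension_axioms
  let ?rep = "L.representation B"
  obtain y where y: "E.integral y" "y \<noteq> 0" "w y = 0" and loc: "\<And>g. val_ge w g 0 \<Longrightarrow> \<exists>n. E.integral (y ^ n * g)"
    using E.integral_localization by metis
  obtain n where n: "E.integral (y ^ n * f)" using loc[of f] f by (auto simp: val_ge_def)
  define z where "z = y * (y ^ n * f)"
  have z: "z \<noteq> 0" "w z = 0"
    using y f by (auto simp: z_def valuation_mult[OF w] valuation_power[OF w])
  obtain P i j where P: "P \<noteq> 0" "poly (map_poly (\<lambda>p. peval e p t) P) z = 0"
    and min: "\<And>Q. Q \<noteq> 0 \<Longrightarrow> poly (map_poly (\<lambda>p. peval e p t) Q) z = 0 \<Longrightarrow> Polynomial.degree P \<le> Polynomial.degree Q"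
    and Pge: "\<And>l m. val_ge v (Polynomial.coeff (Polynomial.coeff P l) m) 0"
    and ij: "i \<noteq> j" "primitive (Polynomial.coeff P i)" "primitive (Polynomial.coeff P j)"
    using minimal_relation[OF fin z] by metis
  have "Polynomial.lead_coeff P \<noteq> 0" using P(1) by simp
  then obtain k q0 where q0: "k \<noteq> 0" "primitive q0" "Polynomial.lead_coeff P = Polynomial.smult k q0"
    using primitive_part by metis
  have "\<exists>P k q. P \<noteq> 0 \<and> poly (map_poly (\<lambda>p. peval e p t) P) b = 0 \<and> k \<noteq> 0 \<and> primitive q \<and>
     Polynomial.lead_coeff P = Polynomial.smult k q" for b
  proof -
    obtain P where P: "P \<noteq> 0" "poly (map_poly (\<lambda>p. peval e p t) P) b = 0"
      using finite_over_relation[OF emb fin] by blast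
    have "Polynomial.lead_coeff P \<noteq> 0" using P(1) by simp
    then obtain k q where "k \<noteq> 0" "primitive q" "Polynomial.lead_coeff P = Polynomial.smult k q"
      using primitive_part by metis
    with P show ?thesis by blast
  qed
  then obtain PB kB qB where PB: "\<And>b. PB b \<noteq> 0 \<and> poly (map_poly (\<lambda>p. peval e p t) (PB b)) b = 0 \<and> kB b \<noteq> 0 \<and> primitive (qB b) \<and>
     Polynomial.lead_coeff (PB b) = Polynomial.smult (kB b) (qB b)" by metis
  obtain num den where nd: "\<And>c. c = Fract (num c) (den c) \<and> primitive (den c)"
    using fract_primitive_denominator by metis
  \<comment> \<open>All functions whose coordinates have to be regular at \<open>a\<close>, and below all primitive polynomials
    that have to take unit values at \<open>a\<close>: the coefficients giving the slope 0, the leading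
    coefficients, and the denominators of these coordinates.\<close>
  define Z where "Z = insert 1 (insert y (S \<union> (\<lambda>(b, b'). b * b') ` (B \<times> B)))"
  define Q where "Q = {Polynomial.coeff P i, Polynomial.coeff P j, q0} \<union> qB ` B \<union> (\<lambda>(x, b). den (?rep x b)) ` (Z \<times> B)"
  have "finite Q" using S finB by (simp add: Q_def Z_def)
  moreover have "primitive q" if "q \<in> Q" for q
    using that ij q0 PB nd unfolding Q_def by auto
  ultimately obtain a where a: "a \<noteq> 0" "v a = 0" "\<And>q. q \<in> Q \<Longrightarrow> poly q a \<noteq> 0 \<and> v (poly q a) = 0"
    using generic_point by metis
  have va: "val_ge v a 0" using a by (simp add: val_ge_def)
  define Pa where "Pa = map_poly (\<lambda>p. poly p a) P"
  have cPa: "Polynomial.coeff Pa l = poly (Polynomial.coeff P l) a" for l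
    by (simp add: Pa_def coeff_map_poly)
  obtain \<zeta> where \<zeta>: "\<zeta> \<noteq> 0" "v \<zeta> = 0" "poly Pa \<zeta> = 0"
  proof (rule poly_root_of_value_0[OF v, of Pa i j])
    show "val_ge v (Polynomial.coeff Pa l) 0" for l
      unfolding cPa by (rule val_ge_poly[OF v Pge va])
  qed (use ij a(3)[of "Polynomial.coeff P i"] a(3)[of "Polynomial.coeff P j"] in \<open>auto simp: cPa Q_def\<close>)
  have "poly (Polynomial.lead_coeff P) a \<noteq> 0"
    unfolding q0(3) using q0(1) a(3)[of q0] by (simp add: Q_def)
  note G0 = specialization_graph[OF P min this \<zeta>(3)[unfolded Pa_def]]
  obtain G where sub: "{(poly (map_poly (\<lambda>p. peval e p t) Q) z, poly (map_poly (\<lambda>p. poly p a) Q) \<zeta>) | Q. True} \<subseteq> G"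
    and G: "maximal_place e G"
    by (rule place_graph_maximal_extension[OF emb G0(1)])
  have GP: "(peval e p t, poly p a) \<in> G" for p by (rule subsetD[OF sub G0(3)])
  have Gz: "(z, \<zeta>) \<in> G" by (rule subsetD[OF sub G0(2)])
  interpret G: maximal_place e G by fact
  have GB: "\<exists>c. (b, c) \<in> G" if "b \<in> B" for b
  proof (rule G.root_in)
    show "(peval e (Polynomial.coeff (PB b) l) t, poly (Polynomial.coeff (PB b) l) a) \<in> G" for l by (rule GP)
    show "poly (Polynomial.coeff (PB b) (Polynomial.degree (PB b))) a \<noteq> 0"
      using PB[of b] a(3)[of "qB b"] that by (simp add: Q_def)
    show "(\<Sum>l\<le>Polynomial.degree (PB b). peval e (Polynomial.coeff (PB b) l) t * b ^ l) = 0"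
      using PB[of b] unfolding poly_map_poly_altdef[OF is_ring_hom_peval[OF emb]] by blast
  qed
  have regZ: "regular_fract a (?rep x b)" if "x \<in> Z" "b \<in> B" for x b
  proof -
    have "den (?rep x b) \<in> Q" using that by (auto simp: Q_def)
    then show ?thesis using a(3) nd[of "?rep x b"] unfolding regular_fract_def by metis
  qed
  define R where "R = {f. \<forall>b\<in>B. regular_fract a (?rep f b)}"
  have "regular_fract a (?rep (b * b') b'')" if "b \<in> B" "b' \<in> B" "b'' \<in> B" for b b' b''
    using that by (intro regZ) (auto simp: Z_def)
  note Rc = regular_representation_closed[OF ext B(2) this, folded R_def]
  have ZR: "x \<in> R" if "x \<in> Z" for x using regZ[OF that] by (simp add: R_def)
  have Rpow: "g ^ k \<in> R" if "g \<in> R" for g k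
    using that by (induction k) (auto intro: Rc(4) ZR simp: Z_def)
  have SR: "g \<in> R" if "g \<in> K.span S" for g
    using that
  proof (induction rule: K.span_induct_alt)
    case (step c x g)
    have "x \<in> R" by (rule ZR) (simp add: Z_def step)
    then show ?case by (intro Rc(2) Rc(3) step)
  qed (rule Rc(1))
  have RG: "\<exists>c. (g, c) \<in> G" if g: "g \<in> R" for g
  proof -
    have "\<exists>d. (?\<psi> (?rep g b) * b, d) \<in> G" if b: "b \<in> B" for b
    proof -
      have "regular_fract a (?rep g b)" using g b by (simp add: R_def)
      then have "\<exists>d. (?\<psi> (?rep g b), d) \<in> G \<and> val_ge v d (w (?\<psi> (?rep g b)))"
        by (rule regular_fract_place[OF G GP va]) (simp add: val_ge_def)
      then show ?thesis using GB[OF b] G.mult by blast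
    qed
    then obtain d where "\<And>b. b \<in> B \<Longrightarrow> (?\<psi> (?rep g b) * b, d b) \<in> G" by metis
    then have "(\<Sum>b\<in>B. ?\<psi> (?rep g b) * b, \<Sum>b\<in>B. d b) \<in> G" by (rule G.sum)
    moreover have "(\<Sum>b\<in>B. ?\<psi> (?rep g b) * b) = g"
      by (rule L.sum_representation_eq[OF B(2) _ finB order_refl]) (simp add: spB)
    ultimately show ?thesis by auto
  qed
  have bound: "val_ge v c 0" if "E.integral g" "g \<in> R" "(g, c) \<in> G" for g c
  proof (rule bounded_integral_place[OF ext B(2) G GP va GB that(1) _ that(3)])
    show "regular_fract a (?rep (g ^ k) b)" if "b \<in> B" for k b
      using Rpow[OF \<open>g \<in> R\<close>, of k] that by (simp add: R_def)
  qed
  have yR: "y \<in> R" by (rule ZR) (simp add: Z_def)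
  obtain cy where cy: "(y, cy) \<in> G" using RG[OF yR] by blast
  have ynf: "y ^ n * f \<in> R" by (intro Rc(4) Rpow yR SR f)
  obtain c1 where c1: "(y ^ n * f, c1) \<in> G" using RG[OF ynf] by blast
  have "\<zeta> = cy * c1" using G.unique[OF Gz, of "cy * c1"] G.mult[OF cy c1] by (simp add: z_def)
  moreover have "val_ge v cy 0" "val_ge v c1 0"
    using bound[OF y(1) yR cy] bound[OF n ynf c1] by auto
  ultimately have u: "cy \<noteq> 0" "c1 \<noteq> 0" "v cy = 0" "v c1 = 0"
    using \<zeta> by (auto simp: val_ge_def valuation_mult[OF v])
  show ?thesis
  proof (rule that[OF G])
    show "\<exists>c. (g, c) \<in> G" if "g \<in> K.span S" for g by (rule RG[OF SR[OF that]])
    show "val_ge v c 0" if g: "g \<in> K.span S" "val_ge w g 0" "(g, c) \<in> G" for g c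
    proof -
      obtain m where m: "E.integral (y ^ m * g)" using loc[OF g(2)] by blast
      have "y ^ m * g \<in> R" by (intro Rc(4) Rpow yR SR g(1))
      moreover have "(y ^ m * g, cy ^ m * c) \<in> G" by (intro G.mult G.power cy g(3))
      ultimately have "val_ge v (cy ^ m * c) 0" by (rule bound[OF m])
      then show ?thesis using u by (cases "c = 0") (auto simp: val_ge_def valuation_mult[OF v] valuation_power[OF v])
    qed
    show "c \<noteq> 0 \<and> v c = 0" if "(f, c) \<in> G" for c
    proof -
      have "c1 = cy ^ n * c" by (rule G.unique[OF c1]) (intro G.mult G.power cy that)
      then show ?thesis using u by (cases "c = 0") (auto simp: valuation_mult[OF v] valuation_power[OF v])
    qed
  qed
qed

theorem dominated_functional:
  assumes fin: "finite_over e t" and S: "finite S" and f: "f \<in> module.span (\<lambda>c f. e c * f) S" "f \<noteq> 0"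
  obtains \<phi> where
    "\<And>g g'. g \<in> module.span (\<lambda>c f. e c * f) S \<Longrightarrow> g' \<in> module.span (\<lambda>c f. e c * f) S \<Longrightarrow> \<phi> (g + g') = \<phi> g + \<phi> g'"
    "\<And>c g. g \<in> module.span (\<lambda>c f. e c * f) S \<Longrightarrow> \<phi> (e c * g) = c * \<phi> g"
    "\<And>g. g \<in> module.span (\<lambda>c f. e c * f) S \<Longrightarrow> g \<noteq> 0 \<Longrightarrow> val_ge v (\<phi> g) (w g)"
    "\<phi> f \<noteq> 0" "v (\<phi> f) = w f"
proof -
  interpret K: vector_space "\<lambda>c f. e c * f" by (rule field_embedding_vector_space[OF emb])
  have scaled: "\<exists>k. k \<noteq> 0 \<and> v k = w g" if "g \<noteq> 0" for g
    using value_in_value_group[OF fin that] by (auto simp: value_group_def)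
  obtain k where k: "k \<noteq> 0" "v k = w f" using scaled[OF f(2)] by blast
  have unit: "e (inverse k) * g \<noteq> 0 \<and> w (e (inverse k) * g) = 0" if "g \<noteq> 0" "k \<noteq> 0" "v k = w g" for k g
    using that by (simp add: field_embedding_eq_0[OF emb] valuation_mult[OF w] ext valuation_inverse[OF v])
  have "e (inverse k) * f \<in> K.span S" using f(1) by (rule K.span_scale)
  then obtain G where G: "maximal_place e G" and dom: "\<And>g. g \<in> K.span S \<Longrightarrow> \<exists>c. (g, c) \<in> G"
    and bd: "\<And>g c. g \<in> K.span S \<Longrightarrow> val_ge w g 0 \<Longrightarrow> (g, c) \<in> G \<Longrightarrow> val_ge v c 0"
    and fu: "\<And>c. (e (inverse k) * f, c) \<in> G \<Longrightarrow> c \<noteq> 0 \<and> v c = 0"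
    using dominated_functional_unit[OF fin S, of "e (inverse k) * f"] unit[OF f(2) k] by metis
  interpret G: maximal_place e G by fact
  define \<phi> where "\<phi> g = (THE c. (g, c) \<in> G)" for g
  have eq: "\<phi> g = c" if "(g, c) \<in> G" for g c
    unfolding \<phi>_def using that by (rule the_equality) (rule G.unique[OF _ that])
  have mem: "(g, \<phi> g) \<in> G" if "g \<in> K.span S" for g using dom[OF that] eq by metis
  have scale: "\<phi> (e c * g) = c * \<phi> g" if "g \<in> K.span S" for c g
    by (rule eq[OF G.mult[OF G.const mem[OF that]]])
  show ?thesis
  proof (rule that[of \<phi>])
    show "\<phi> (g + g') = \<phi> g + \<phi> g'" if "g \<in> K.span S" "g' \<in> K.span S" for g g'
      by (rule eq[OF G.add[OF mem[OF that(1)] mem[OF that(2)]]])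
    show "\<phi> (e c * g) = c * \<phi> g" if "g \<in> K.span S" for c g by (rule scale[OF that])
    show "val_ge v (\<phi> g) (w g)" if g: "g \<in> K.span S" "g \<noteq> 0" for g
    proof -
      obtain k where k: "k \<noteq> 0" "v k = w g" using scaled[OF g(2)] by blast
      have sp: "e (inverse k) * g \<in> K.span S" using g(1) by (rule K.span_scale)
      have "val_ge v (inverse k * \<phi> g) 0"
        using bd[OF sp _ mem[OF sp]] unit[OF g(2) k] unfolding scale[OF g(1)] by (simp add: val_ge_def)
      then show ?thesis using k
        by (cases "\<phi> g = 0") (auto simp: val_ge_def valuation_mult[OF v] valuation_inverse[OF v])
    qed
    have "inverse k * \<phi> f \<noteq> 0 \<and> v (inverse k * \<phi> f) = 0"
      using fu[OF mem[OF K.span_scale[OF f(1)]]] unfolding scale[OF f(1)] .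
    then show "\<phi> f \<noteq> 0" "v (\<phi> f) = w f"
      using k by (auto simp: valuation_mult[OF v] valuation_inverse[OF v])
  qed
qed

end

section \<open>Function fields of one variable\<close>

lemma function_field_finite_over:
  assumes "function_field e"
  obtains x where "finite_over e x"
proof -
  have e: "field_embedding e" using assms by (simp add: function_field_def)
  have "\<exists>x. transcendental_over e x \<and> (\<exists>B. finite B \<and>
     (\<forall>f. \<exists>c. c ` B \<subseteq> simple_subfield e x \<and> f = (\<Sum>b\<in>B. c b * b)))"
    using assms unfolding function_field_def transcendental_over_def by (rule conjunct2)
  then obtain x B where x: "transcendental_over e x" and B: "finite B"
    "\<forall>f. \<exists>c. c ` B \<subseteq> simple_subfield e x \<and> f = (\<Sum>b\<in>B. c b * b)"
    by (elim exE conjE)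
  interpret V: vector_space "\<lambda>c f. fract_eval e x c * f"
    by (rule field_embedding_vector_space[OF fract_eval_embedding[OF e x]])
  have "f \<in> V.span B" for f
  proof -
    obtain c where c: "c ` B \<subseteq> simple_subfield e x" "f = (\<Sum>b\<in>B. c b * b)"
      using spec[OF B(2), of f] by (elim exE conjE)
    show ?thesis unfolding c(2)
    proof (rule V.span_sum)
      fix b assume b: "b \<in> B"
      then obtain p q where "peval e q x \<noteq> 0" "c b = peval e p x / peval e q x"
        using c(1) unfolding simple_subfield_def by blast
      moreover from this have "q \<noteq> 0" by auto
      ultimately have "c b * b = fract_eval e x (Fract p q) * b"
        by (simp add: fract_eval_Fract[OF e x])
      then show "c b * b \<in> V.span B" using V.span_scale[OF V.span_base[OF b], of "Fract p q"] by (simp only:)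
    qed
  qed
  then have "V.span B = UNIV" by blast
  then show ?thesis using that x B(1) unfolding finite_over_def by blast
qed

text \<open>A relation of \<open>t\<close> over \<open>K[x]\<close>, read as a polynomial in \<open>x\<close> over \<open>K[t]\<close>. Its degree in \<open>x\<close> is
  positive because \<open>t\<close> is transcendental.\<close>
lemma exchange_relation:
  assumes e: "field_embedding e" and fin: "finite_over e x" and t: "transcendental_over e t"
  obtains R where "Polynomial.degree R > 0" "poly (map_poly (\<lambda>p. peval e p t) R) x = 0"
proof -
  obtain P where P: "P \<noteq> 0" "poly (map_poly (\<lambda>p. peval e p x) P) t = 0"
    using finite_over_relation[OF e fin] by blast
  define n where "n = Polynomial.degree P"
  define m where "m = Max ((\<lambda>i. Polynomial.degree (Polynomial.coeff P i)) ` {..n})"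
  have dm: "Polynomial.degree (Polynomial.coeff P i) \<le> m" for i
    unfolding m_def by (cases "i \<le> n") (auto simp: n_def coeff_eq_0 intro: Max_ge)
  \<comment> \<open>The coefficient of \<open>x ^ j\<close> in \<open>P\<close>, as a polynomial in \<open>t\<close>.\<close>
  define row where "row j = (\<Sum>i\<le>n. Polynomial.monom (Polynomial.coeff (Polynomial.coeff P i) j) i)" for j
  define R where "R = (\<Sum>j\<le>m. Polynomial.monom (row j) j)"
  have crow: "Polynomial.coeff (row j) i = Polynomial.coeff (Polynomial.coeff P i) j" for i j
    unfolding row_def by (auto simp: coeff_sum n_def coeff_eq_0)
  have cR: "Polynomial.coeff R j = row j" for j
  proof -
    have "row j = 0" if "\<not> j \<le> m"
    proof (rule poly_eqI)
      fix i
      have "Polynomial.degree (Polynomial.coeff P i) < j" using dm[of i] that by simp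
      then show "Polynomial.coeff (row j) i = Polynomial.coeff 0 i" by (simp add: crow coeff_eq_0)
    qed
    then show ?thesis unfolding R_def by (auto simp: coeff_sum)
  qed
  have ev: "peval e p y = (\<Sum>j\<le>k. e (Polynomial.coeff p j) * y ^ j)" if "Polynomial.degree p \<le> k" for p y k
    unfolding peval_def poly_map_poly_altdef[OF is_ring_hom_embedding[OF e]]
    using that by (intro sum.mono_neutral_left) (auto simp: coeff_eq_0 field_embedding_0[OF e])
  have drow: "Polynomial.degree (row j) \<le> n" for j
    by (rule degree_le) (simp add: crow n_def coeff_eq_0)
  have dR: "Polynomial.degree R \<le> m"
    unfolding R_def by (rule degree_sum_le) (auto intro: order_trans[OF degree_monom_le])
  have "poly (map_poly (\<lambda>p. peval e p t) R) x = (\<Sum>j\<le>m. peval e (row j) t * x ^ j)"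
    unfolding poly_map_poly_altdef[OF is_ring_hom_peval[OF e]] cR[symmetric]
    using dR by (intro sum.mono_neutral_left) (auto simp: coeff_eq_0)
  also have "\<dots> = (\<Sum>j\<le>m. \<Sum>i\<le>n. e (Polynomial.coeff (Polynomial.coeff P i) j) * t ^ i * x ^ j)"
    unfolding ev[OF drow] crow sum_distrib_right ..
  also have "\<dots> = (\<Sum>i\<le>n. \<Sum>j\<le>m. e (Polynomial.coeff (Polynomial.coeff P i) j) * t ^ i * x ^ j)"
    by (rule sum.swap)
  also have "\<dots> = (\<Sum>i\<le>n. peval e (Polynomial.coeff P i) x * t ^ i)"
    unfolding ev[OF dm] sum_distrib_right by (intro sum.cong refl) (simp add: mult_ac)
  also have "\<dots> = 0"
    using P(2) unfolding poly_map_poly_altdef[OF is_ring_hom_peval[OF e]] n_def .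
  finally have R0: "poly (map_poly (\<lambda>p. peval e p t) R) x = 0" .
  have "R \<noteq> 0"
  proof
    assume "R = 0"
    then have "Polynomial.coeff (Polynomial.coeff P i) j = 0" for i j
      using cR[of j] crow[of j i] by simp
    then show False using P(1) by (metis leading_coeff_0_iff)
  qed
  have "Polynomial.degree R > 0"
  proof (rule ccontr)
    assume "\<not> ?thesis"
    then obtain c where c: "R = [:c:]" using degree_eq_zeroE by blast
    then have "c \<noteq> 0" using \<open>R \<noteq> 0\<close> by auto
    moreover have "peval e c t = 0"
      using R0 unfolding c poly_map_poly_pCons[OF is_ring_hom_peval[OF e]] by simp
    ultimately show False using t by (simp add: transcendental_over_def)
  qed
  then show ?thesis using that R0 by blast
qed

text \<open>The span \<open>A\<close> of \<open>1, x, \<dots>, x ^ (n - 1)\<close> over \<open>K(t)\<close> is a ring by \<open>exchange_relation\<close> and, having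
  finite dimension, a field. So it contains \<open>K(x)\<close>, and the products of the powers of \<open>x\<close> with a basis over \<open>K(x)\<close>
  span the whole field over \<open>K(t)\<close>.\<close>
lemma finite_over_exchange:
  assumes e: "field_embedding e" and fin: "finite_over e x" and t: "transcendental_over e t"
  shows "finite_over e t"
proof -
  let ?\<psi> = "fract_eval e t"
  have x: "transcendental_over e x" using fin by (simp add: finite_over_def)
  note emb = fract_eval_embedding[OF e t]
  interpret V: vector_space "\<lambda>c f. ?\<psi> c * f" by (rule field_embedding_vector_space[OF emb])
  interpret W: vector_space "\<lambda>c f. fract_eval e x c * f"
    by (rule field_embedding_vector_space[OF fract_eval_embedding[OF e x]])
  obtain R where R: "Polynomial.degree R > 0" "poly (map_poly (\<lambda>p. peval e p t) R) x = 0"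
    by (rule exchange_relation[OF e fin t])
  define n where "n = Polynomial.degree R"
  define A where "A = V.span ((\<lambda>i. x ^ i) ` {..<n})"
  have xi: "x ^ i \<in> A" if "i < n" for i unfolding A_def using that by (intro V.span_base) auto
  have A_add: "f + g \<in> A" if "f \<in> A" "g \<in> A" for f g using that unfolding A_def by (rule V.span_add)
  have A_scale: "?\<psi> c * f \<in> A" if "f \<in> A" for c f using that unfolding A_def by (rule V.span_scale)
  have A_sum: "sum f I \<in> A" if "\<And>i. i \<in> I \<Longrightarrow> f i \<in> A" for f and I :: "nat set"
    using that unfolding A_def by (rule V.span_sum)
  have "x ^ n \<in> A"
  proof -
    define l where "l = peval e (Polynomial.lead_coeff R) t"
    have "Polynomial.lead_coeff R \<noteq> 0" using R(1) by auto
    then have l: "l \<noteq> 0" using t by (simp add: transcendental_over_def l_def)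
    have "(\<Sum>i<n. peval e (Polynomial.coeff R i) t * x ^ i) + l * x ^ n = 0"
      using R(2) unfolding poly_map_poly_altdef[OF is_ring_hom_peval[OF e]] n_def[symmetric] l_def
        lessThan_Suc_atMost[symmetric] by simp
    then have "x ^ n = - (\<Sum>i<n. peval e (Polynomial.coeff R i) t * x ^ i) / l"
      using l by (simp add: field_simps eq_neg_iff_add_eq_0 add.commute)
    also have "\<dots> = (\<Sum>i<n. ?\<psi> (- (Fract (Polynomial.coeff R i) 1 / Fract (Polynomial.lead_coeff R) 1)) * x ^ i)"
      unfolding sum_negf[symmetric] sum_divide_distrib field_embedding_uminus[OF emb] field_embedding_divide[OF emb]
        fract_eval_const[OF e t] l_def[symmetric] by simp
    also have "\<dots> \<in> A" by (intro A_sum A_scale xi) simp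
    finally show ?thesis .
  qed
  have xA: "x * f \<in> A" if "f \<in> A" for f
    using that[unfolded A_def]
  proof (induction rule: V.span_induct_alt)
    case base
    then show ?case unfolding A_def by (simp add: V.span_zero)
  next
    case (step c y g)
    then obtain i where "i < n" "y = x ^ i" by auto
    then have "x * y \<in> A" using xi[of "Suc i"] \<open>x ^ n \<in> A\<close> by (cases "Suc i = n") auto
    then have "?\<psi> c * (x * y) + x * g \<in> A" using step by (intro A_add A_scale)
    then show ?case by (simp add: algebra_simps)
  qed
  have pA: "peval e p x * f \<in> A" if f: "f \<in> A" for p f
  proof (induction p)
    case 0
    then show ?case unfolding A_def by (simp add: V.span_zero)
  next
    case (pCons c p)
    have "?\<psi> (Fract [:c:] 1) * f + x * (peval e p x * f) \<in> A"
      by (intro A_add A_scale xA pCons f)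
    then show ?case by (simp add: fract_eval_const[OF e t] peval_pCons[OF e] algebra_simps)
  qed
  have A1: "1 \<in> A" using xi[of 0] R(1) by (simp add: n_def)
  have AA: "f * g \<in> A" if "f \<in> A" "g \<in> A" for f g
    using that(1)[unfolded A_def]
  proof (induction rule: V.span_induct_alt)
    case base
    then show ?case unfolding A_def by (simp add: V.span_zero)
  next
    case (step c y h)
    then obtain i where "y = x ^ i" by auto
    moreover have "x ^ i * g \<in> A" by (induction i) (auto simp: mult.assoc that(2) xA)
    ultimately have "?\<psi> c * (y * g) + h * g \<in> A" using step by (intro A_add A_scale) auto
    then show ?case by (simp add: algebra_simps)
  qed
  have inv: "inverse u \<in> A" if u: "u \<in> A" "u \<noteq> 0" for u
  proof -
    have up: "u ^ k \<in> A" for k by (induction k) (auto intro: A1 AA u)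
    \<comment> \<open>A relation between powers of \<open>u\<close>, divided by its lowest term, expresses \<open>1 / u\<close> by
      nonnegative powers.\<close>
    let ?N = "card ((\<lambda>i. x ^ i) ` {..<n})"
    obtain c where c: "(\<Sum>i\<le>?N. ?\<psi> (c i) * u ^ i) = 0" "\<exists>i\<le>?N. c i \<noteq> 0"
      using V.linear_relation[of "(\<lambda>i. x ^ i) ` {..<n}" "\<lambda>i. u ^ i"] up unfolding A_def by blast
    define m where "m = (LEAST i. c i \<noteq> 0)"
    have m: "c m \<noteq> 0" "m \<le> ?N" "\<And>i. i < m \<Longrightarrow> c i = 0"
      using c(2) LeastI_ex[of "\<lambda>i. c i \<noteq> 0"] Least_le[of "\<lambda>i. c i \<noteq> 0"] not_less_Least[of _ "\<lambda>i. c i \<noteq> 0"]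
      unfolding m_def by (blast intro: order_trans)+
    have "(\<Sum>i\<le>?N. ?\<psi> (c i) * u ^ i) = (\<Sum>i\<in>{m..?N}. ?\<psi> (c i) * u ^ i)"
      by (rule sum.mono_neutral_right) (auto simp: m(3) field_embedding_0[OF emb])
    also have "\<dots> = ?\<psi> (c m) * u ^ m + (\<Sum>i\<in>{Suc m..?N}. ?\<psi> (c i) * u ^ i)"
      using m(2) by (simp add: sum.atLeast_Suc_atMost)
    finally have eq: "?\<psi> (c m) * u ^ m = - (\<Sum>i\<in>{Suc m..?N}. ?\<psi> (c i) * u ^ i)"
      using c(1) by (simp add: eq_neg_iff_add_eq_0)
    have "inverse u = ?\<psi> (c m) * u ^ m / (?\<psi> (c m) * u ^ Suc m)"
      using u m(1) by (simp add: field_simps field_embedding_eq_0[OF emb])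
    also have "\<dots> = - (\<Sum>i\<in>{Suc m..?N}. ?\<psi> (c i) * u ^ i) / (?\<psi> (c m) * u ^ Suc m)"
      by (simp only: eq)
    also have "\<dots> = (\<Sum>i\<in>{Suc m..?N}. ?\<psi> (- (c i / c m)) * u ^ (i - Suc m))"
      unfolding sum_negf[symmetric] sum_divide_distrib
    proof (rule sum.cong[OF refl])
      fix i assume "i \<in> {Suc m..?N}"
      then have "u ^ i = u ^ (i - Suc m) * u ^ Suc m"
        by (simp del: power_Suc flip: power_add)
      then show "- (?\<psi> (c i) * u ^ i) / (?\<psi> (c m) * u ^ Suc m) = ?\<psi> (- (c i / c m)) * u ^ (i - Suc m)"
        using u by (simp add: field_embedding_uminus[OF emb] field_embedding_divide[OF emb])
    qed
    also have "\<dots> \<in> A" by (intro A_sum A_scale up)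
    finally show ?thesis .
  qed
  have fracA: "fract_eval e x c \<in> A" for c
  proof -
    obtain p q where c: "c = Fract p q" "q \<noteq> 0" by (cases c)
    have "peval e q x \<noteq> 0" using x c(2) by (simp add: transcendental_over_def)
    then have "peval e p x * inverse (peval e q x) \<in> A" using pA[OF A1] by (intro pA inv) auto
    then show ?thesis unfolding c(1) fract_eval_Fract[OF e x c(2)] by (simp add: divide_inverse)
  qed
  obtain B where B: "finite B" "W.span B = UNIV" using fin by (auto simp: finite_over_def)
  define C where "C = (\<lambda>(i, b). x ^ i * b) ` ({..<n} \<times> B)"
  have AC: "f * b \<in> V.span C" if "f \<in> A" "b \<in> B" for f b
    using that(1)[unfolded A_def]
  proof (induction rule: V.span_induct_alt)
    case (step c y g)
    then have "y * b \<in> C" using that(2) by (auto simp: C_def)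
    from V.span_add[OF V.span_scale[OF V.span_base[OF this], of c] step(2)]
    have "?\<psi> c * (y * b) + g * b \<in> V.span C" .
    then show ?case by (simp add: algebra_simps)
  qed (simp add: V.span_zero)
  have "f \<in> V.span C" for f
  proof -
    have "f \<in> W.span B" using B(2) by simp
    then show ?thesis
    proof (induction rule: W.span_induct_alt)
      case (step c b g)
      then show ?case by (intro V.span_add AC fracA)
    qed (rule V.span_zero)
  qed
  moreover have "finite C" using B(1) by (simp add: C_def)
  ultimately show ?thesis unfolding finite_over_def using t by blast
qed

section \<open>Residue fields\<close>

lemma val_ring_simps [simp]:
  "carrier (val_ring w) = {x. val_ge w x 0}" "x \<otimes>\<^bsub>val_ring w\<^esub> y = x * y" "\<one>\<^bsub>val_ring w\<^esub> = 1"
  "\<zero>\<^bsub>val_ring w\<^esub> = 0" "x \<oplus>\<^bsub>val_ring w\<^esub> y = x + y"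
  by (simp_all add: val_ring_def)

lemma val_ring_cring: assumes w: "valuation w" shows "cring (val_ring w)"
proof (rule cringI)
  show "abelian_group (val_ring w)"
    by (rule abelian_groupI)
      (use w in \<open>auto simp: val_ge_add add_ac intro: exI[of _ "- _"] bexI[of _ "- _"]\<close>)
  show "comm_monoid (val_ring w)"
    by (rule comm_monoidI) (use w in \<open>auto simp: val_ge_mult0 val_ge_one mult_ac\<close>)
qed (simp add: distrib_right)

lemma val_ring_a_inv: assumes w: "valuation w" and "val_ge w x 0" shows "\<ominus>\<^bsub>val_ring w\<^esub> x = - x"
proof -
  interpret cring "val_ring w" by (rule val_ring_cring[OF w])
  show ?thesis using assms minus_equality[of "- x" x] by simp
qed

lemma val_ideal_maximal: assumes w: "valuation w" shows "maximalideal (val_ideal w) (val_ring w)"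
proof -
  interpret R: cring "val_ring w" by (rule val_ring_cring[OF w])
  have I: "ideal (val_ideal w) (val_ring w)"
  proof (rule idealI)
    show "subgroup (val_ideal w) (add_monoid (val_ring w))"
    proof (rule R.add.subgroupI)
      show "\<ominus>\<^bsub>val_ring w\<^esub> x \<in> val_ideal w" if "x \<in> val_ideal w" for x
        using that w val_gt_imp_ge[of w x 0] by (simp add: val_ring_a_inv val_ideal_def)
      show "val_ideal w \<noteq> {}" unfolding val_ideal_def using val_gt_0 by blast
    qed (use w in \<open>auto simp: val_ideal_def val_gt_imp_ge val_gt_add\<close>)
  next
    fix a x assume *: "a \<in> val_ideal w" "x \<in> carrier (val_ring w)"
    then show "x \<otimes>\<^bsub>val_ring w\<^esub> a \<in> val_ideal w" "a \<otimes>\<^bsub>val_ring w\<^esub> x \<in> val_ideal w"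
      using val_gt_mult_left[OF w, of a 0 x 0] by (auto simp: val_ideal_def mult.commute)
  qed (rule R.ring_axioms)
  show ?thesis
  proof (rule maximalidealI[OF I])
    have "1 \<in> carrier (val_ring w)" "1 \<notin> val_ideal w"
      using valuation_one[OF w] by (auto simp: val_ideal_def val_gt_def val_ge_def)
    then show "carrier (val_ring w) \<noteq> val_ideal w" by blast
  next
    fix J assume J: "ideal J (val_ring w)" "val_ideal w \<subseteq> J" "J \<subseteq> carrier (val_ring w)"
    interpret J: ideal J "val_ring w" by fact
    show "J = val_ideal w \<or> J = carrier (val_ring w)"
    proof (cases "J \<subseteq> val_ideal w")
      case False
      then obtain x where x: "x \<in> J" "x \<notin> val_ideal w" by blast
      then have "x \<noteq> 0" "w x = 0" using J(3) by (auto simp: val_ideal_def val_gt_def val_ge_def)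
      then have "1 \<in> J" using J.I_l_closed[OF x(1), of "inverse x"]
        by (simp add: val_ge_def valuation_inverse[OF w])
      then show ?thesis using J.one_imp_carrier by simp
    qed (use J(2) in blast)
  qed
qed

lemma residue_field_field: "valuation w \<Longrightarrow> Ring.field (residue_field w)"
  unfolding residue_field_def
  by (intro maximalideal.quotient_is_field val_ideal_maximal val_ring_cring)

lemma reduction_conv: "reduction w x = {y. val_gt w (y - x) 0}"
proof -
  have "y \<in> (\<lambda>h. h + x) ` val_ideal w \<longleftrightarrow> val_gt w (y - x) 0" for y
    by (auto simp: val_ideal_def image_iff intro: exI[of _ "y - x"])
  then show ?thesis by (auto simp: reduction_def a_r_coset_def' )
qed

lemma reduction_eq_iff: assumes w: "valuation w" shows "reduction w x = reduction w y \<longleftrightarrow> val_gt w (x - y) 0"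
proof
  assume "reduction w x = reduction w y"
  moreover have "x \<in> reduction w x" by (simp add: reduction_conv)
  ultimately show "val_gt w (x - y) 0" by (simp add: reduction_conv)
next
  assume *: "val_gt w (x - y) 0"
  have "val_gt w (z - x) 0 \<longleftrightarrow> val_gt w (z - y) 0" for z
    using val_gt_add[OF w _ *, of "z - x"] val_gt_diff[OF w _ *, of "z - y"] by auto
  then show "reduction w x = reduction w y" by (simp add: reduction_conv)
qed

lemma residue_field_carrier: "carrier (residue_field w) = reduction w ` {x. val_ge w x 0}"
  by (auto simp: residue_field_def FactRing_def A_RCOSETS_def' reduction_def)

lemma residue_field_ops:
  assumes w: "valuation w"
  shows "val_ge w x 0 \<Longrightarrow> val_ge w y 0 \<Longrightarrow> reduction w x \<oplus>\<^bsub>residue_field w\<^esub> reduction w y = reduction w (x + y)"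
    and "val_ge w x 0 \<Longrightarrow> val_ge w y 0 \<Longrightarrow> reduction w x \<otimes>\<^bsub>residue_field w\<^esub> reduction w y = reduction w (x * y)"
    and "\<one>\<^bsub>residue_field w\<^esub> = reduction w 1"
    and "\<zero>\<^bsub>residue_field w\<^esub> = reduction w 0"
proof -
  interpret maximalideal "val_ideal w" "val_ring w" by (rule val_ideal_maximal[OF w])
  note hom = rcos_ring_hom
  show "reduction w x \<oplus>\<^bsub>residue_field w\<^esub> reduction w y = reduction w (x + y)" if "val_ge w x 0" "val_ge w y 0"
    using ring_hom_add[OF hom, of x y] that by (simp add: residue_field_def reduction_def)
  show "reduction w x \<otimes>\<^bsub>residue_field w\<^esub> reduction w y = reduction w (x * y)" if "val_ge w x 0" "val_ge w y 0"
    using ring_hom_mult[OF hom, of x y] that by (simp add: residue_field_def reduction_def)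
  show "\<one>\<^bsub>residue_field w\<^esub> = reduction w 1" by (simp add: residue_field_def reduction_def FactRing_def)
  show "\<zero>\<^bsub>residue_field w\<^esub> = reduction w 0"
    unfolding reduction_conv by (simp add: residue_field_def FactRing_def val_ideal_def)
qed

lemma peval_residue:
  fixes v :: "'k::field \<Rightarrow> real" and w :: "'f::field \<Rightarrow> real"
  assumes e: "field_embedding e" and w: "valuation w" and ext: "\<And>c. w (e c) = v c" and t: "val_ge w t 0"
    and p: "\<And>i. val_ge v (Polynomial.coeff p i) 0"
  shows "ring.eval (residue_field w) (rev (map (\<lambda>c. reduction w (e c)) (coeffs p))) (reduction w t) =
      reduction w (peval e p t) \<and> val_ge w (peval e p t) 0"
proof -
  interpret R: Ring.field "residue_field w" by (rule residue_field_field[OF w])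
  have ge: "val_ge w (e c) 0" if "val_ge v c 0" for c
    using that by (auto simp: val_ge_def ext field_embedding_0[OF e])
  show ?thesis using p
  proof (induction p rule: pCons_induct)
    case 0
    then show ?case using residue_field_ops(4)[OF w] by simp
  next
    case (pCons c p)
    have c: "val_ge v c 0" using pCons.prems[of 0] by simp
    have p: "val_ge v (Polynomial.coeff p i) 0" for i using pCons.prems[of "Suc i"] by simp
    have cs: "coeffs (pCons c p) = c # coeffs p" using pCons.hyps by (auto simp: cCons_def)
    have set: "set (rev (map (\<lambda>c. reduction w (e c)) (coeffs p))) \<subseteq> carrier (residue_field w)"
      using ge p by (auto simp: residue_field_carrier coeffs_def split: if_splits)
    have IH: "ring.eval (residue_field w) (rev (map (\<lambda>c. reduction w (e c)) (coeffs p))) (reduction w t) =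
      reduction w (peval e p t)" "val_ge w (peval e p t) 0" using pCons.IH[OF p] by auto
    have "reduction w (e c) \<in> carrier (residue_field w)" "reduction w t \<in> carrier (residue_field w)"
      using ge[OF c] t by (auto simp: residue_field_carrier)
    from R.eval_append_aux[OF set this]
    have "ring.eval (residue_field w) (rev (map (\<lambda>c. reduction w (e c)) (coeffs (pCons c p)))) (reduction w t) =
        reduction w (peval e p t) \<otimes>\<^bsub>residue_field w\<^esub> reduction w t \<oplus>\<^bsub>residue_field w\<^esub> reduction w (e c)"
      by (simp add: cs IH(1) del: coeffs_pCons_eq_cCons)
    also have "\<dots> = reduction w (peval e p t * t + e c)"
      using IH(2) t ge[OF c] by (simp add: residue_field_ops[OF w] val_ge_mult0[OF w])
    finally show ?case
      using IH(2) t ge[OF c]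
      by (auto simp: peval_pCons[OF e] mult.commute add.commute intro!: val_ge_add[OF w] val_ge_mult0[OF w])
  qed
qed

text \<open>A polynomial with a unit coefficient whose value at \<open>t\<close> is not a unit reduces to an algebraic relation of
  the residue class \<open>u\<close> of \<open>t\<close>.\<close>
theorem residually_transcendental_gauss:
  fixes v :: "'k::alg_closed_field \<Rightarrow> real" and w :: "'f::field \<Rightarrow> real"
  assumes e: "field_embedding e" and v: "valuation v" and w: "valuation w" and ext: "\<And>c. w (e c) = v c"
    and u: "u \<in> carrier (residue_field w)" "ring.transcendental (residue_field w) (constant_residues v e w) u"
  obtains t where "gauss_extension v e w t"
proof -
  interpret R: Ring.field "residue_field w" by (rule residue_field_field[OF w])
  obtain t where t: "u = reduction w t" "val_ge w t 0" using u(1) by (auto simp: residue_field_carrier)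
  have ge: "val_ge w (e c) 0" if "val_ge v c 0" for c
    using that by (auto simp: val_ge_def ext field_embedding_0[OF e])
  have "peval e p t \<noteq> 0 \<and> w (peval e p t) = 0"
    if p: "\<And>j. val_ge v (Polynomial.coeff p j) 0" and i: "Polynomial.coeff p i \<noteq> 0" "v (Polynomial.coeff p i) = 0" for p i
  proof (rule ccontr)
    let ?l = "rev (map (\<lambda>c. reduction w (e c)) (coeffs p))"
    note ev = peval_residue[where v = v, OF e w ext t(2) p]
    assume "\<not> ?thesis"
    then have "val_gt w (peval e p t) 0" using ev by (auto simp: val_gt_def val_ge_def)
    then have "reduction w (peval e p t) = reduction w 0" unfolding reduction_eq_iff[OF w] by simp
    then have ev0: "R.eval ?l u = \<zero>\<^bsub>residue_field w\<^esub>"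
      using ev residue_field_ops(4)[OF w] by (simp add: t(1))
    have setK: "set ?l \<subseteq> constant_residues v e w"
      using p by (auto simp: constant_residues_def coeffs_def)
    also have "\<dots> \<subseteq> carrier (residue_field w)"
      using ge by (auto simp: constant_residues_def residue_field_carrier)
    finally have set: "set ?l \<subseteq> carrier (residue_field w)" .
    define l' where "l' = R.normalize ?l"
    have "polynomial\<^bsub>residue_field w\<^esub> (constant_residues v e w) l'"
      unfolding l'_def by (rule R.normalize_gives_polynomial[OF setK])
    then have l': "l' \<in> carrier (univ_poly (residue_field w) (constant_residues v e w))"
      by (simp add: univ_poly_carrier)
    have "[] \<in> carrier (univ_poly (residue_field w) (constant_residues v e w))"
      by (simp add: univ_poly_def polynomial_def)
    moreover have "R.eval l' u = R.eval [] u"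
      using R.eval_normalize[OF set u(1)] ev0 by (simp add: l'_def)
    ultimately have "l' = []"
      using inj_onD[OF u(2)[unfolded R.transcendental_def], of l' "[]"] l' by simp
    then have "?l = replicate (length ?l) \<zero>\<^bsub>residue_field w\<^esub>"
      using R.normalize_trick[of ?l] unfolding l'_def by simp
    then have all0: "\<forall>z\<in>set ?l. z = \<zero>\<^bsub>residue_field w\<^esub>" by (metis in_set_replicate)
    have "Polynomial.coeff p i \<in> set (coeffs p)" using i(1) by (intro coeff_in_coeffs) (auto intro: le_degree)
    then have "reduction w (e (Polynomial.coeff p i)) = reduction w 0"
      using all0 residue_field_ops(4)[OF w] by auto
    then have "val_gt w (e (Polynomial.coeff p i)) 0" unfolding reduction_eq_iff[OF w] by simp
    then show False using i by (simp add: val_gt_def ext field_embedding_eq_0[OF e])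
  qed
  then have "gauss_extension v e w t" by unfold_locales (use e v w ext in auto)
  then show ?thesis by (rule that)
qed

section \<open>Orthonormal bases\<close>

definition linear_on :: "('k::field \<Rightarrow> 'f::field) \<Rightarrow> 'f set \<Rightarrow> ('f \<Rightarrow> 'k) \<Rightarrow> bool" where
  "linear_on e H \<phi> \<longleftrightarrow> (\<forall>g\<in>H. \<forall>g'\<in>H. \<phi> (g + g') = \<phi> g + \<phi> g') \<and> (\<forall>c. \<forall>g\<in>H. \<phi> (e c * g) = c * \<phi> g)"

text \<open>The function \<open>N\<close> is the logarithm of a norm with reversed sign; it is only meaningful on
  nonzero elements. The assumption \<open>dual\<close> is a Hahn-Banach property without loss of
  norm; it is what makes orthonormal bases exist.\<close>
locale normed_subspace =
  fixes v :: "'k::field \<Rightarrow> real" and e :: "'k \<Rightarrow> 'f::field" and H :: "'f set" and N :: "'f \<Rightarrow> real"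
  assumes emb: "field_embedding e" and v: "valuation v" and sub: "module.subspace (\<lambda>c f. e c * f) H"
    and N_scale: "\<And>c f. c \<noteq> 0 \<Longrightarrow> f \<in> H \<Longrightarrow> f \<noteq> 0 \<Longrightarrow> N (e c * f) = v c + N f"
    and N_values: "\<And>f. f \<in> H \<Longrightarrow> f \<noteq> 0 \<Longrightarrow> N f \<in> value_group v"
    and dual: "\<And>f. f \<in> H \<Longrightarrow> f \<noteq> 0 \<Longrightarrow> \<exists>\<phi>. linear_on e H \<phi> \<and>
       (\<forall>g\<in>H. g \<noteq> 0 \<longrightarrow> val_ge v (\<phi> g) (N g)) \<and> \<phi> f \<noteq> 0 \<and> v (\<phi> f) = N f"
begin

sublocale vs: vector_space "\<lambda>c f. e c * f" by (rule field_embedding_vector_space[OF emb])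

text \<open>A biorthogonal system of vectors and functionals of norm 1. The functionals are
  defined on all of \<open>H\<close>, not only on the span of the \<open>b i\<close>, so that they give a projection of
  norm 1 to this span.\<close>
definition orthonormal :: "nat \<Rightarrow> (nat \<Rightarrow> 'f) \<Rightarrow> (nat \<Rightarrow> 'f \<Rightarrow> 'k) \<Rightarrow> bool" where
  "orthonormal m b \<phi> \<longleftrightarrow> (\<forall>i<m. b i \<in> H \<and> b i \<noteq> 0 \<and> N (b i) = 0 \<and> linear_on e H (\<phi> i) \<and>
     (\<forall>g\<in>H. g \<noteq> 0 \<longrightarrow> val_ge v (\<phi> i g) (N g)) \<and> (\<forall>j<m. \<phi> i (b j) = (if i = j then 1 else 0)))"

lemma H_add: "f \<in> H \<Longrightarrow> g \<in> H \<Longrightarrow> f + g \<in> H" and H_scale: "f \<in> H \<Longrightarrow> e c * f \<in> H" and H_0: "0 \<in> H"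
  using sub by (auto intro: vs.subspace_add vs.subspace_0 vs.subspace_scale[of H f c])

lemma H_sum: "(\<And>i. i \<in> I \<Longrightarrow> f i \<in> H) \<Longrightarrow> sum f I \<in> H"
  by (rule vs.subspace_sum[OF sub])

lemma linear_on_0: "linear_on e H \<phi> \<Longrightarrow> \<phi> 0 = 0"
  using H_0 unfolding linear_on_def by (metis field_embedding_0[OF emb] mult_zero_left)

lemma linear_on_sum: "linear_on e H \<phi> \<Longrightarrow> (\<And>i. i \<in> I \<Longrightarrow> f i \<in> H) \<Longrightarrow> \<phi> (sum f I) = (\<Sum>i\<in>I. \<phi> (f i))"
  by (induction I rule: infinite_finite_induct) (auto simp: linear_on_0 linear_on_def H_sum)

lemma coordinates_combination:
  assumes o: "orthonormal m b \<phi>" and i: "i < m"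
  shows "\<phi> i (\<Sum>j<m. e (c j) * b j) = c i"
proof -
  have l: "linear_on e H (\<phi> i)" using o i by (simp add: orthonormal_def)
  have "\<phi> i (\<Sum>j<m. e (c j) * b j) = (\<Sum>j<m. \<phi> i (e (c j) * b j))"
    by (rule linear_on_sum[OF l]) (use o in \<open>simp add: orthonormal_def H_scale\<close>)
  also have "\<dots> = (\<Sum>j<m. if j = i then c i else 0)"
    by (rule sum.cong) (use l o i in \<open>auto simp: linear_on_def orthonormal_def\<close>)
  finally show ?thesis using i by simp
qed

lemma orthonormal_bound:
  assumes o: "orthonormal m b \<phi>" and S: "finite S" "H \<subseteq> vs.span S"
  shows "m \<le> card S"
proof -
  have inj: "inj_on b {..<m}"
  proof (rule inj_onI)
    fix i j assume *: "i \<in> {..<m}" "j \<in> {..<m}" "b i = b j"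
    then have "\<phi> i (b j) = 1" "\<phi> i (b j) = (if i = j then 1 else 0)"
      using o unfolding orthonormal_def by (metis lessThan_iff)+
    then show "i = j" by (metis zero_neq_one)
  qed
  have "vs.independent (b ` {..<m})"
    unfolding vs.dependent_finite[OF finite_imageI[OF finite_lessThan]]
  proof (rule notI)
    assume "\<exists>u. (\<exists>x\<in>b ` {..<m}. u x \<noteq> 0) \<and> (\<Sum>x\<in>b ` {..<m}. e (u x) * x) = 0"
    then obtain u i where u: "(\<Sum>x\<in>b ` {..<m}. e (u x) * x) = 0" and i: "i \<in> {..<m}" "u (b i) \<noteq> 0"
      by auto
    have "(\<Sum>j<m. e (u (b j)) * b j) = 0"
      using u unfolding sum.reindex[OF inj] by simp
    then have "\<phi> i 0 = u (b i)"
      using coordinates_combination[OF o, of i "\<lambda>j. u (b j)"] i(1) by simp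
    moreover have "linear_on e H (\<phi> i)" using o i by (simp add: orthonormal_def)
    ultimately show False using i(2) linear_on_0 by metis
  qed
  moreover have "b ` {..<m} \<subseteq> vs.span S" using o S(2) by (auto simp: orthonormal_def)
  ultimately have "card (b ` {..<m}) \<le> card S"
    using vs.independent_span_bound[OF S(1)] by blast
  then show ?thesis by (simp add: card_image[OF inj])
qed

text \<open>A step of the Gram-Schmidt process. The component of \<open>g\<close> killed by the functionals at hand is scaled
  to a new vector \<open>y\<close> of norm 1, which is possible because \<open>N\<close> takes values in the value group; a dual functional
  of \<open>y\<close> is corrected so as to vanish on the previous vectors.\<close>
lemma orthonormal_extend:
  assumes o: "orthonormal m b \<phi>" and g: "g \<in> H" "g \<noteq> (\<Sum>i<m. e (\<phi> i g) * b i)"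
  shows "\<exists>b \<phi>. orthonormal (Suc m) b \<phi>"
proof -
  have b: "b i \<in> H" if "i < m" for i using o that by (simp add: orthonormal_def)
  have lin: "linear_on e H (\<phi> i)" if "i < m" for i using o that by (simp add: orthonormal_def)
  define g' where "g' = g + (\<Sum>i<m. e (- \<phi> i g) * b i)"
  have "g' \<in> H" unfolding g'_def by (intro H_add H_sum H_scale b g(1)) simp
  moreover have "g' \<noteq> 0" using g(2) unfolding g'_def by (simp add: field_embedding_uminus[OF emb] sum_negf)
  ultimately have g': "g' \<in> H" "g' \<noteq> 0" by auto
  have orth: "\<phi> i g' = 0" if i: "i < m" for i
  proof -
    have "(\<Sum>i<m. e (- \<phi> i g) * b i) \<in> H" by (intro H_sum H_scale b) simp
    then have "\<phi> i g' = \<phi> i g + \<phi> i (\<Sum>i<m. e (- \<phi> i g) * b i)"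
      using lin[OF i] g(1) unfolding linear_on_def g'_def by blast
    then show ?thesis unfolding coordinates_combination[OF o i] by simp
  qed
  obtain k where k: "k \<noteq> 0" "v k = N g'" using N_values[OF g'] by (auto simp: value_group_def)
  define y where "y = e (inverse k) * g'"
  have y: "y \<in> H" "y \<noteq> 0" "N y = 0"
    using g' k by (auto simp: y_def H_scale N_scale valuation_inverse[OF v] field_embedding_eq_0[OF emb])
  have \<phi>y: "\<phi> i y = 0" if "i < m" for i
    using lin[OF that] orth[OF that] g' by (simp add: y_def linear_on_def)
  obtain \<psi> where \<psi>: "linear_on e H \<psi>" "\<And>g. g \<in> H \<Longrightarrow> g \<noteq> 0 \<Longrightarrow> val_ge v (\<psi> g) (N g)" "\<psi> y \<noteq> 0" "v (\<psi> y) = 0"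
    using dual[OF y(1,2)] y(3) by auto
  define \<rho> where "\<rho> g = inverse (\<psi> y) * (\<psi> g - (\<Sum>i<m. \<psi> (b i) * \<phi> i g))" for g
  have "linear_on e H \<rho>"
    unfolding linear_on_def
  proof (intro conjI ballI allI)
    fix g h assume "g \<in> H" "h \<in> H"
    then have *: "\<psi> (g + h) = \<psi> g + \<psi> h" "\<And>i. i < m \<Longrightarrow> \<phi> i (g + h) = \<phi> i g + \<phi> i h"
      using \<psi>(1) lin by (auto simp: linear_on_def)
    have s: "(\<Sum>i<m. \<psi> (b i) * \<phi> i (g + h)) = (\<Sum>i<m. \<psi> (b i) * \<phi> i g) + (\<Sum>i<m. \<psi> (b i) * \<phi> i h)"
      unfolding sum.distrib[symmetric] by (rule sum.cong) (auto simp: *(2) distrib_left)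
    show "\<rho> (g + h) = \<rho> g + \<rho> h" unfolding \<rho>_def *(1) s by (simp add: algebra_simps)
  next
    fix c g assume "g \<in> H"
    then have *: "\<psi> (e c * g) = c * \<psi> g" "\<And>i. i < m \<Longrightarrow> \<phi> i (e c * g) = c * \<phi> i g"
      using \<psi>(1) lin by (auto simp: linear_on_def)
    have s: "(\<Sum>i<m. \<psi> (b i) * \<phi> i (e c * g)) = c * (\<Sum>i<m. \<psi> (b i) * \<phi> i g)"
      unfolding sum_distrib_left by (rule sum.cong) (auto simp: *(2))
    show "\<rho> (e c * g) = c * \<rho> g" unfolding \<rho>_def *(1) s by (simp add: algebra_simps)
  qed
  moreover have "val_ge v (\<rho> h) (N h)" if h: "h \<in> H" "h \<noteq> 0" for h
  proof -
    have "val_ge v (\<psi> (b i) * \<phi> i h) (N h)" if "i < m" for i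
    proof -
      have "val_ge v (\<psi> (b i)) 0" using \<psi>(2)[of "b i"] o that by (simp add: orthonormal_def)
      moreover have "val_ge v (\<phi> i h) (N h)" using o that h by (simp add: orthonormal_def)
      ultimately show ?thesis using val_ge_mult[OF v, of "\<psi> (b i)" 0] by simp
    qed
    then have "val_ge v (\<psi> h - (\<Sum>i<m. \<psi> (b i) * \<phi> i h)) (N h)"
      by (intro val_ge_diff[OF v] val_ge_sum[OF v] \<psi>(2) h) simp
    moreover have "val_ge v (inverse (\<psi> y)) 0" using \<psi>(3,4) by (simp add: val_ge_def valuation_inverse[OF v])
    ultimately show ?thesis
      using val_ge_mult[OF v, of "inverse (\<psi> y)" 0] by (simp add: \<rho>_def)
  qed
  moreover have "\<rho> y = 1" using \<psi>(3) \<phi>y by (simp add: \<rho>_def)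
  moreover have "\<rho> (b j) = 0" if j: "j < m" for j
  proof -
    have "(\<Sum>i<m. \<psi> (b i) * \<phi> i (b j)) = (\<Sum>i<m. if i = j then \<psi> (b j) else 0)"
      by (rule sum.cong) (use o j in \<open>auto simp: orthonormal_def\<close>)
    then show ?thesis using j by (simp add: \<rho>_def)
  qed
  ultimately have "orthonormal (Suc m) (b(m := y)) (\<phi>(m := \<rho>))"
    using o y \<phi>y unfolding orthonormal_def by (auto simp: less_Suc_eq)
  then show ?thesis by blast
qed

theorem orthonormal_basis:
  assumes "vs.dim H = n" "n > 0"
  obtains b \<phi> where "orthonormal n b \<phi>" "\<And>g. g \<in> H \<Longrightarrow> g = (\<Sum>i<n. e (\<phi> i g) * b i)"
proof -
  obtain S where S: "S \<subseteq> H" "vs.independent S" "H \<subseteq> vs.span S" "card S = n"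
    using vs.basis_exists[of H] assms(1) by metis
  have fS: "finite S" using S(4) assms(2) card_gt_0_iff by blast
  have "\<exists>b \<phi>. orthonormal m b \<phi>" if "m \<le> n" for m
    using that
  proof (induction m)
    case 0
    show ?case by (simp add: orthonormal_def)
  next
    case (Suc m)
    then obtain b \<phi> where o: "orthonormal m b \<phi>" by auto
    have "\<exists>g\<in>H. g \<noteq> (\<Sum>i<m. e (\<phi> i g) * b i)"
    proof (rule ccontr)
      assume contra: "\<not> ?thesis"
      have "H \<subseteq> vs.span (b ` {..<m})"
      proof
        fix g assume "g \<in> H"
        then have "g = (\<Sum>i<m. e (\<phi> i g) * b i)" using contra by blast
        moreover have "(\<Sum>i<m. e (\<phi> i g) * b i) \<in> vs.span (b ` {..<m})"
          by (intro vs.span_sum vs.span_scale vs.span_base) simp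
        ultimately show "g \<in> vs.span (b ` {..<m})" by simp
      qed
      then have "S \<subseteq> vs.span (b ` {..<m})" using S(1) by blast
      then have "card S \<le> card (b ` {..<m})" using vs.independent_span_bound[OF _ S(2)] by blast
      also have "\<dots> \<le> m" using card_image_le[of "{..<m}" b] by simp
      finally show False using S(4) Suc.prems by simp
    qed
    then show ?case using orthonormal_extend[OF o] by blast
  qed
  then obtain b \<phi> where o: "orthonormal n b \<phi>" by blast
  have "g = (\<Sum>i<n. e (\<phi> i g) * b i)" if g: "g \<in> H" for g
  proof (rule ccontr)
    assume "\<not> ?thesis"
    then obtain b' \<phi>' where "orthonormal (Suc n) b' \<phi>'" using orthonormal_extend[OF o g] by blast
    then show False using orthonormal_bound[OF _ fS S(3)] S(4) by fastforce
  qed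
  then show ?thesis using that o by blast
qed

end

section \<open>Modules\<close>

lemma module_transport:
  assumes B: "Module.module R B" and bij: "bij_betw \<phi> (carrier A) (carrier B)"
    and add: "\<And>x y. x \<in> carrier A \<Longrightarrow> y \<in> carrier A \<Longrightarrow>
      x \<oplus>\<^bsub>A\<^esub> y \<in> carrier A \<and> \<phi> (x \<oplus>\<^bsub>A\<^esub> y) = \<phi> x \<oplus>\<^bsub>B\<^esub> \<phi> y"
    and smult: "\<And>c x. c \<in> carrier R \<Longrightarrow> x \<in> carrier A \<Longrightarrow>
      c \<odot>\<^bsub>A\<^esub> x \<in> carrier A \<and> \<phi> (c \<odot>\<^bsub>A\<^esub> x) = c \<odot>\<^bsub>B\<^esub> \<phi> x"
    and zero: "\<zero>\<^bsub>A\<^esub> \<in> carrier A" "\<phi> \<zero>\<^bsub>A\<^esub> = \<zero>\<^bsub>B\<^esub>"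
  shows "Module.module R A"
proof -
  interpret B: Module.module R B by fact
  have im: "\<phi> x \<in> carrier B" if "x \<in> carrier A" for x using bij that by (auto simp: bij_betw_def)
  have inj: "x = y" if "\<phi> x = \<phi> y" "x \<in> carrier A" "y \<in> carrier A" for x y
    using bij that by (auto simp: bij_betw_def dest: inj_onD)
  have surj: "\<exists>x\<in>carrier A. \<phi> x = y" if "y \<in> carrier B" for y
  proof -
    have "y \<in> \<phi> ` carrier A" using bij that by (simp add: bij_betw_def)
    then show ?thesis by auto
  qed
  have ag: "abelian_group A"
  proof (rule abelian_groupI)
    fix x assume x: "x \<in> carrier A"
    obtain y where y: "y \<in> carrier A" "\<phi> y = \<ominus>\<^bsub>B\<^esub> \<phi> x" using surj[of "\<ominus>\<^bsub>B\<^esub> \<phi> x"] im[OF x] by auto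
    have "y \<oplus>\<^bsub>A\<^esub> x = \<zero>\<^bsub>A\<^esub>" by (rule inj) (use x y add zero im in \<open>simp_all add: B.M.l_neg\<close>)
    then show "\<exists>y\<in>carrier A. y \<oplus>\<^bsub>A\<^esub> x = \<zero>\<^bsub>A\<^esub>" using y(1) by blast
  next
    fix x y z assume *: "x \<in> carrier A" "y \<in> carrier A" "z \<in> carrier A"
    show "x \<oplus>\<^bsub>A\<^esub> y \<oplus>\<^bsub>A\<^esub> z = x \<oplus>\<^bsub>A\<^esub> (y \<oplus>\<^bsub>A\<^esub> z)"
      by (rule inj) (use * add im in \<open>simp_all add: B.M.a_assoc\<close>)
  next
    fix x y assume *: "x \<in> carrier A" "y \<in> carrier A"
    show "x \<oplus>\<^bsub>A\<^esub> y = y \<oplus>\<^bsub>A\<^esub> x"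
      by (rule inj) (use * add im in \<open>simp_all add: B.M.a_comm\<close>)
  next
    fix x assume *: "x \<in> carrier A"
    show "\<zero>\<^bsub>A\<^esub> \<oplus>\<^bsub>A\<^esub> x = x"
      by (rule inj) (use * add zero im in simp_all)
  qed (use add zero in auto)
  show ?thesis
  proof (rule moduleI[OF B.R.cring_axioms ag])
    fix c d x assume *: "c \<in> carrier R" "d \<in> carrier R" "x \<in> carrier A"
    show "(c \<oplus>\<^bsub>R\<^esub> d) \<odot>\<^bsub>A\<^esub> x = c \<odot>\<^bsub>A\<^esub> x \<oplus>\<^bsub>A\<^esub> d \<odot>\<^bsub>A\<^esub> x"
      by (rule inj) (use * add smult im in \<open>simp_all add: B.smult_l_distr\<close>)
    show "(c \<otimes>\<^bsub>R\<^esub> d) \<odot>\<^bsub>A\<^esub> x = c \<odot>\<^bsub>A\<^esub> (d \<odot>\<^bsub>A\<^esub> x)"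
      by (rule inj) (use * add smult im in \<open>simp_all add: B.smult_assoc1\<close>)
  next
    fix c x y assume *: "c \<in> carrier R" "x \<in> carrier A" "y \<in> carrier A"
    show "c \<odot>\<^bsub>A\<^esub> (x \<oplus>\<^bsub>A\<^esub> y) = c \<odot>\<^bsub>A\<^esub> x \<oplus>\<^bsub>A\<^esub> c \<odot>\<^bsub>A\<^esub> y"
      by (rule inj) (use * add smult im in \<open>simp_all add: B.smult_r_distr\<close>)
  next
    fix x assume *: "x \<in> carrier A"
    show "\<one>\<^bsub>R\<^esub> \<odot>\<^bsub>A\<^esub> x = x"
      by (rule inj) (use * smult im in simp_all)
  qed (use smult in auto)
qed

lemma submodule_span_submodule:
  assumes M: "Module.module R M" and S: "S \<subseteq> carrier M"
  shows "submodule (submodule_span R M S) R M" "S \<subseteq> submodule_span R M S"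
proof -
  interpret Module.module R M by fact
  show "S \<subseteq> submodule_span R M S" by (auto simp: submodule_span_def)
  have mem: "x \<in> submodule_span R M S \<longleftrightarrow> (\<forall>N. submodule N R M \<longrightarrow> S \<subseteq> N \<longrightarrow> x \<in> N)" for x
    by (auto simp: submodule_span_def)
  show "submodule (submodule_span R M S) R M"
  proof (rule submoduleI)
    show "submodule_span R M S \<subseteq> carrier M" using carrier_is_submodule S unfolding mem subset_iff by blast
    show "\<zero>\<^bsub>M\<^esub> \<in> submodule_span R M S"
      unfolding mem using submodule.axioms(1) subgroup.one_closed[of _ "add_monoid M"] by fastforce
    show "\<ominus>\<^bsub>M\<^esub> x \<in> submodule_span R M S" if "x \<in> submodule_span R M S" for x
      using that unfolding mem by (blast dest: submoduleE(3))
    show "x \<oplus>\<^bsub>M\<^esub> y \<in> submodule_span R M S" if "x \<in> submodule_span R M S" "y \<in> submodule_span R M S" for x y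
      using that unfolding mem by (blast dest: submoduleE(5))
    show "c \<odot>\<^bsub>M\<^esub> x \<in> submodule_span R M S" if "c \<in> carrier R" "x \<in> submodule_span R M S" for c x
      using that unfolding mem by (blast dest: submoduleE(4))
  qed
qed

lemma finsum_additive_map:
  fixes T :: "'a::comm_monoid_add \<Rightarrow> 'b"
  assumes "abelian_monoid A" and "finite I" and D: "0 \<in> D" "\<And>x y. x \<in> D \<Longrightarrow> y \<in> D \<Longrightarrow> x + y \<in> D"
    and T: "T 0 = \<zero>\<^bsub>A\<^esub>" "\<And>x. x \<in> D \<Longrightarrow> T x \<in> carrier A"
      "\<And>x y. x \<in> D \<Longrightarrow> y \<in> D \<Longrightarrow> T (x + y) = T x \<oplus>\<^bsub>A\<^esub> T y"
    and g: "\<And>i. i \<in> I \<Longrightarrow> g i \<in> D"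
  shows "finsum A (\<lambda>i. T (g i)) I = T (sum g I)"
proof -
  interpret A: abelian_monoid A by fact
  have "finsum A (\<lambda>i. T (g i)) I = T (sum g I) \<and> sum g I \<in> D"
    using assms(2) g
  proof (induction I rule: finite_induct)
    case (insert i I)
    then have "finsum A (\<lambda>i. T (g i)) (insert i I) = T (g i) \<oplus>\<^bsub>A\<^esub> finsum A (\<lambda>i. T (g i)) I"
      using T(2) by (intro A.finsum_insert) auto
    with insert show ?case using T(3) D(2) by simp
  qed (simp add: T(1) D(1))
  then show ?thesis by blast
qed

lemma residue_space_simps [simp]:
  "carrier (residue_space e w) = carrier (residue_field w)"
  "\<zero>\<^bsub>residue_space e w\<^esub> = \<zero>\<^bsub>residue_field w\<^esub>"
  "x \<oplus>\<^bsub>residue_space e w\<^esub> y = x \<oplus>\<^bsub>residue_field w\<^esub> y"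
  by (simp_all add: residue_space_def Let_def)

locale valued_extension =
  fixes v :: "'k::field \<Rightarrow> real" and e :: "'k \<Rightarrow> 'f::field" and w :: "'f \<Rightarrow> real"
  assumes emb: "field_embedding e" and v: "valuation v" and w: "valuation w" and ext: "\<And>c. w (e c) = v c"
begin

lemma val_ge_const: "val_ge w (e c) s \<longleftrightarrow> val_ge v c s" and val_gt_const: "val_gt w (e c) s \<longleftrightarrow> val_gt v c s"
  by (auto simp: val_ge_def val_gt_def ext field_embedding_eq_0[OF emb])

text \<open>The scalar product is a union over all representatives of the scalar; they all give the same class.\<close>
lemma residue_smult:
  assumes "val_ge v c 0" "val_ge w y 0"
  shows "reduction v c \<odot>\<^bsub>residue_space e w\<^esub> reduction w y = reduction w (e c * y)"
proof -
  have "reduction w (e d) = reduction w (e c)" if "d \<in> reduction v c" for d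
    using that unfolding reduction_eq_iff[OF w] field_embedding_diff[OF emb, symmetric] val_gt_const
    by (simp add: reduction_conv)
  moreover have "c \<in> reduction v c" by (simp add: reduction_conv)
  ultimately have "(\<Union>d\<in>reduction v c. reduction w (e d)) = reduction w (e c)" by blast
  then show ?thesis
    using assms by (simp add: residue_space_def Let_def residue_field_ops(2)[OF w] val_ge_const)
qed

lemma residue_space_module: "Module.module (residue_field v) (residue_space e w)"
proof (rule moduleI)
  interpret V: Ring.field "residue_field v" by (rule residue_field_field[OF v])
  interpret W: Ring.field "residue_field w" by (rule residue_field_field[OF w])
  show "cring (residue_field v)" by (rule V.cring_axioms)
  show "abelian_group (residue_space e w)"
    by (rule abelian_groupI) (auto simp: W.a_ac intro: W.l_neg W.a_inv_closed intro!: bexI[of _ "\<ominus>\<^bsub>residue_field w\<^esub> _"])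
qed (auto simp: residue_field_carrier residue_smult residue_field_ops[OF w] residue_field_ops[OF v] val_ge_const
       val_ge_add[OF v] val_ge_add[OF w] val_ge_mult0[OF v] val_ge_mult0[OF w] val_ge_one[OF v]
       field_embedding_add[OF emb] field_embedding_mult[OF emb] field_embedding_1[OF emb] algebra_simps
     intro!: imageI)

end

lemma product_module:
  assumes k: "cring k" and B: "\<And>x. x \<in> V \<Longrightarrow> Module.module k (B x)" and C: "\<And>x. x \<in> V \<Longrightarrow> submodule (C x) k (B x)"
    and A: "carrier A = (\<Pi>\<^sub>E x\<in>V. C x)" "\<zero>\<^bsub>A\<^esub> = (\<lambda>x\<in>V. \<zero>\<^bsub>B x\<^esub>)"
      "\<And>u u'. u \<oplus>\<^bsub>A\<^esub> u' = (\<lambda>x\<in>V. u x \<oplus>\<^bsub>B x\<^esub> u' x)" "\<And>c u. c \<odot>\<^bsub>A\<^esub> u = (\<lambda>x\<in>V. c \<odot>\<^bsub>B x\<^esub> u x)"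
  shows "Module.module k A"
proof -
  have carr: "u x \<in> carrier (B x)" "u x \<in> C x" if "u \<in> carrier A" "x \<in> V" for u x
    using that Module.module.submoduleE(1)[OF B C, of x] by (auto simp: A(1))
  have cl: "\<zero>\<^bsub>B x\<^esub> \<in> C x" "\<And>y z. y \<in> C x \<Longrightarrow> z \<in> C x \<Longrightarrow> y \<oplus>\<^bsub>B x\<^esub> z \<in> C x"
    "\<And>y. y \<in> C x \<Longrightarrow> \<ominus>\<^bsub>B x\<^esub> y \<in> C x" "\<And>c y. c \<in> carrier k \<Longrightarrow> y \<in> C x \<Longrightarrow> c \<odot>\<^bsub>B x\<^esub> y \<in> C x"
    if x: "x \<in> V" for x
  proof -
    note E = Module.module.submoduleE[OF B[OF x] C[OF x]]
    show "\<zero>\<^bsub>B x\<^esub> \<in> C x" using subgroup.one_closed[OF submodule.axioms(1)[OF C[OF x]]] by simp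
    show "\<And>y z. y \<in> C x \<Longrightarrow> z \<in> C x \<Longrightarrow> y \<oplus>\<^bsub>B x\<^esub> z \<in> C x" by (rule E(5))
    show "\<And>y. y \<in> C x \<Longrightarrow> \<ominus>\<^bsub>B x\<^esub> y \<in> C x" by (rule E(3))
    show "\<And>c y. c \<in> carrier k \<Longrightarrow> y \<in> C x \<Longrightarrow> c \<odot>\<^bsub>B x\<^esub> y \<in> C x" by (rule E(4))
  qed
  have eqI: "u = u'" if "u \<in> carrier A" "u' \<in> carrier A" "\<And>x. x \<in> V \<Longrightarrow> u x = u' x" for u u'
    using that unfolding A(1) by (rule PiE_ext)
  have add: "u \<oplus>\<^bsub>A\<^esub> u' \<in> carrier A" if "u \<in> carrier A" "u' \<in> carrier A" for u u'
    unfolding A(1,3) by (rule PiE_I) (use that carr(2) cl(2) in auto)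
  have zero: "\<zero>\<^bsub>A\<^esub> \<in> carrier A" using cl(1) by (auto simp: A)
  have sm: "c \<odot>\<^bsub>A\<^esub> u \<in> carrier A" if "c \<in> carrier k" "u \<in> carrier A" for c u
    unfolding A(1,4) by (rule PiE_I) (use that carr(2) cl(4) in auto)
  have ag: "abelian_group (B x)" if "x \<in> V" for x
    using B[OF that] by (simp add: Module.module_def)
  have am: "abelian_monoid (B x)" if "x \<in> V" for x
    using ag[OF that] by (simp add: abelian_group_def)
  have at: "(u \<oplus>\<^bsub>A\<^esub> u') x = u x \<oplus>\<^bsub>B x\<^esub> u' x" "\<zero>\<^bsub>A\<^esub> x = \<zero>\<^bsub>B x\<^esub>" "(c \<odot>\<^bsub>A\<^esub> u) x = c \<odot>\<^bsub>B x\<^esub> u x"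
    if "x \<in> V" for u u' c x
    using that by (simp_all add: A)
  show ?thesis
  proof (rule moduleI[OF k])
    show "abelian_group A"
    proof (rule abelian_groupI)
      fix u u' u'' assume *: "u \<in> carrier A" "u' \<in> carrier A" "u'' \<in> carrier A"
      show "u \<oplus>\<^bsub>A\<^esub> u' \<oplus>\<^bsub>A\<^esub> u'' = u \<oplus>\<^bsub>A\<^esub> (u' \<oplus>\<^bsub>A\<^esub> u'')"
        by (rule eqI) (use * add in \<open>simp_all add: at abelian_monoid.a_assoc[OF am] carr\<close>)
    next
      fix u u' assume *: "u \<in> carrier A" "u' \<in> carrier A"
      show "u \<oplus>\<^bsub>A\<^esub> u' = u' \<oplus>\<^bsub>A\<^esub> u"
        by (rule eqI) (use * add in \<open>simp_all add: at abelian_monoid.a_comm[OF am] carr\<close>)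
    next
      fix u assume *: "u \<in> carrier A"
      show "\<zero>\<^bsub>A\<^esub> \<oplus>\<^bsub>A\<^esub> u = u"
        by (rule eqI) (use * add zero in \<open>simp_all add: at abelian_monoid.l_zero[OF am] carr\<close>)
      define y where "y = (\<lambda>x\<in>V. \<ominus>\<^bsub>B x\<^esub> u x)"
      have y: "y \<in> carrier A" unfolding A(1) y_def by (rule PiE_I) (use * carr(2) cl(3) in auto)
      have "y \<oplus>\<^bsub>A\<^esub> u = \<zero>\<^bsub>A\<^esub>"
        by (rule eqI) (use * y add zero in \<open>simp_all add: at abelian_group.l_neg[OF ag] carr y_def\<close>)
      then show "\<exists>y\<in>carrier A. y \<oplus>\<^bsub>A\<^esub> u = \<zero>\<^bsub>A\<^esub>" using y by blast
    qed (use add zero in auto)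
  next
    fix c d u assume *: "c \<in> carrier k" "d \<in> carrier k" "u \<in> carrier A"
    have "c \<oplus>\<^bsub>k\<^esub> d \<in> carrier k" "c \<otimes>\<^bsub>k\<^esub> d \<in> carrier k"
      using * k by (auto simp: cring.cring_simprules)
    note * = * this
    show "(c \<oplus>\<^bsub>k\<^esub> d) \<odot>\<^bsub>A\<^esub> u = c \<odot>\<^bsub>A\<^esub> u \<oplus>\<^bsub>A\<^esub> d \<odot>\<^bsub>A\<^esub> u"
      by (rule eqI) (use * add sm in \<open>simp_all add: at Module.module.smult_l_distr[OF B] carr\<close>)
    show "(c \<otimes>\<^bsub>k\<^esub> d) \<odot>\<^bsub>A\<^esub> u = c \<odot>\<^bsub>A\<^esub> (d \<odot>\<^bsub>A\<^esub> u)"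
      by (rule eqI) (use * sm in \<open>simp_all add: at Module.module.smult_assoc1[OF B] carr\<close>)
  next
    fix c u u' assume *: "c \<in> carrier k" "u \<in> carrier A" "u' \<in> carrier A"
    show "c \<odot>\<^bsub>A\<^esub> (u \<oplus>\<^bsub>A\<^esub> u') = c \<odot>\<^bsub>A\<^esub> u \<oplus>\<^bsub>A\<^esub> c \<odot>\<^bsub>A\<^esub> u'"
      by (rule eqI) (use * add sm in \<open>simp_all add: at Module.module.smult_r_distr[OF B] carr\<close>)
  next
    fix u assume *: "u \<in> carrier A"
    have "\<one>\<^bsub>k\<^esub> \<in> carrier k" using k by (simp add: cring.cring_simprules)
    then show "\<one>\<^bsub>k\<^esub> \<odot>\<^bsub>A\<^esub> u = u"
      by (intro eqI) (use * sm in \<open>simp_all add: at Module.module.smult_one[OF B] carr\<close>)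
  qed (rule sm)
qed

text \<open>The lattice of functions with \<open>v\<^sub>x(f) \<ge> h(x)\<close> for all \<open>x \<in> V\<close>, together with an orthonormal basis \<open>b\<close> of
  \<open>H\<close> for the norm \<open>Min {v\<^sub>x(f) - h(x) | x \<in> V}\<close> and its coordinate functionals \<open>\<phi>\<close>.\<close>
locale lattice_reduction =
  fixes v :: "'k::field \<Rightarrow> real" and e :: "'k \<Rightarrow> 'f::field" and V :: "'f an_point set" and H :: "'f set"
    and a :: "real \<Rightarrow> 'k" and h :: "'f an_point \<Rightarrow> real" and n :: nat and b :: "nat \<Rightarrow> 'f" and \<phi> :: "nat \<Rightarrow> 'f \<Rightarrow> 'k"
  assumes emb: "field_embedding e" and v: "valuation v" and V: "finite V" "V \<noteq> {}"
    and pt: "\<And>x. x \<in> V \<Longrightarrow> valuation (pt_val x)" and ext: "\<And>x c. x \<in> V \<Longrightarrow> pt_val x (e c) = v c"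
    and vals: "\<And>x f. x \<in> V \<Longrightarrow> f \<in> H \<Longrightarrow> f \<noteq> 0 \<Longrightarrow> pt_val x f \<in> value_group v"
    and sub: "module.subspace (\<lambda>c f. e c * f) H"
    and a: "\<And>s. s \<in> value_group v \<Longrightarrow> a s \<noteq> 0 \<and> v (a s) = s" and h: "\<And>x. x \<in> V \<Longrightarrow> h x \<in> value_group v"
    and b: "\<And>i. i < n \<Longrightarrow> b i \<in> H \<and> (\<forall>x\<in>V. val_ge (pt_val x) (b i) (h x))"
    and lin: "\<And>i. i < n \<Longrightarrow> linear_on e H (\<phi> i)"
    and dual: "\<And>i j. i < n \<Longrightarrow> j < n \<Longrightarrow> \<phi> i (b j) = (if i = j then 1 else 0)"
    and expand: "\<And>g. g \<in> H \<Longrightarrow> g = (\<Sum>i<n. e (\<phi> i g) * b i)"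
    and bound: "\<And>i g. i < n \<Longrightarrow> g \<in> H \<Longrightarrow> (\<forall>x\<in>V. val_ge (pt_val x) g (h x)) \<Longrightarrow> val_ge v (\<phi> i g) 0"
begin

abbreviation "M \<equiv> M_mod e V H h"
abbreviation "S \<equiv> reduced_sum v e V a H"
abbreviation "W \<equiv> W_set e V a H h"
abbreviation "T \<equiv> red_map e V a h"
abbreviation "mM \<equiv> ideal_times_module (val_ring v) (val_ideal v) M"

sublocale vs: vector_space "\<lambda>c f. e c * f" by (rule field_embedding_vector_space[OF emb])

lemma pt_ext: "x \<in> V \<Longrightarrow> valued_extension v e (pt_val x)"
  by unfold_locales (auto simp: emb v pt ext)

lemma M_simps [simp]:
  "carrier M = {f \<in> H. \<forall>x\<in>V. val_ge (pt_val x) f (h x)}" "\<zero>\<^bsub>M\<^esub> = 0" "f \<oplus>\<^bsub>M\<^esub> g = f + g" "c \<odot>\<^bsub>M\<^esub> f = e c * f"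
  by (simp_all add: M_mod_def)

lemma H_add: "f \<in> H \<Longrightarrow> g \<in> H \<Longrightarrow> f + g \<in> H" and H_scale: "f \<in> H \<Longrightarrow> e c * f \<in> H" and H_0: "0 \<in> H"
  and H_uminus: "f \<in> H \<Longrightarrow> - f \<in> H" and H_diff: "f \<in> H \<Longrightarrow> g \<in> H \<Longrightarrow> f - g \<in> H"
  using sub by (auto intro: vs.subspace_add vs.subspace_0 vs.subspace_scale[of H f c] vs.subspace_neg vs.subspace_diff)

lemma scale_ge: "x \<in> V \<Longrightarrow> val_ge v c s \<Longrightarrow> val_ge (pt_val x) f t \<Longrightarrow> val_ge (pt_val x) (e c * f) (s + t)"
  using valued_extension.val_ge_const[OF pt_ext] by (intro val_ge_mult[OF pt]) auto

lemma scale_gt: "x \<in> V \<Longrightarrow> val_gt v c s \<Longrightarrow> val_ge (pt_val x) f t \<Longrightarrow> val_gt (pt_val x) (e c * f) (s + t)"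
  using valued_extension.val_gt_const[OF pt_ext] by (intro val_gt_mult_left[OF pt]) auto

lemma M_add: "f \<in> carrier M \<Longrightarrow> g \<in> carrier M \<Longrightarrow> f + g \<in> carrier M"
  and M_uminus: "f \<in> carrier M \<Longrightarrow> - f \<in> carrier M"
  and M_scale: "val_ge v c 0 \<Longrightarrow> f \<in> carrier M \<Longrightarrow> e c * f \<in> carrier M"
  and M_0: "0 \<in> carrier M"
  using scale_ge[of _ c 0] by (auto simp: H_add H_scale H_0 H_uminus pt intro: val_ge_add[OF pt])

lemma M_sum: "(\<And>i. i \<in> I \<Longrightarrow> f i \<in> carrier M) \<Longrightarrow> sum f I \<in> carrier M"
  by (induction I rule: infinite_finite_induct) (auto simp del: M_simps intro: M_add M_0)

lemma M_module: "Module.module (val_ring v) M"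
proof (rule moduleI[OF val_ring_cring[OF v]])
  show "abelian_group M"
  proof (rule abelian_groupI)
    show "\<exists>y\<in>carrier M. y \<oplus>\<^bsub>M\<^esub> f = \<zero>\<^bsub>M\<^esub>" if "f \<in> carrier M" for f
      using M_uminus[OF that] by (intro bexI[of _ "- f"]) auto
  qed (use M_add M_0 in \<open>auto simp: add_ac\<close>)
qed (use M_scale in \<open>auto simp: field_embedding_add[OF emb] field_embedding_mult[OF emb] field_embedding_1[OF emb] algebra_simps\<close>)

text \<open>The elements of norm smaller than 1, which is also the kernel of the reduction map (\<open>T_eq_iff\<close>).\<close>
definition Mplus :: "'f set" where
  "Mplus = {f \<in> H. \<forall>x\<in>V. val_gt (pt_val x) f (h x)}"

text \<open>The minimum of the finitely many positive numbers \<open>v\<^sub>x(f) - h(x)\<close> is the value of a scalar \<open>c\<close>, and dividing by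
  \<open>c\<close> stays inside the lattice.\<close>
lemma Mplus_factor:
  assumes "f \<in> Mplus" shows "\<exists>c g. val_gt v c 0 \<and> g \<in> carrier M \<and> f = e c * g"
proof (cases "f = 0")
  case True
  then show ?thesis using M_0 by (intro exI[of _ 0]) auto
next
  case f0: False
  have f: "f \<in> H" "\<And>x. x \<in> V \<Longrightarrow> h x < pt_val x f" using assms f0 by (auto simp: Mplus_def val_gt_def)
  from finite_min_exists[OF V, of "\<lambda>x. pt_val x f - h x"]
  obtain y where y: "y \<in> V" "\<And>x. x \<in> V \<Longrightarrow> pt_val y f - h y \<le> pt_val x f - h x" by auto
  have "pt_val y f - h y \<in> value_group v" by (intro value_group_diff v vals h y f f0)
  then obtain c where c: "c \<noteq> 0" "v c = pt_val y f - h y" by (auto simp: value_group_def)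
  have "val_gt v c 0" using c f(2)[OF y(1)] by (simp add: val_gt_def)
  moreover have "e (inverse c) * f \<in> carrier M"
  proof -
    have "val_ge (pt_val x) (e (inverse c) * f) (h x)" if "x \<in> V" for x
      using scale_ge[OF that, of "inverse c" "- v c" f "pt_val x f"] y(2)[OF that] c(2)
      by (auto simp: val_ge_def valuation_inverse[OF v])
    then show ?thesis using f(1) H_scale by auto
  qed
  moreover have "f = e c * (e (inverse c) * f)"
    using c(1) by (simp add: field_embedding_inverse[OF emb] field_embedding_eq_0[OF emb])
  ultimately show ?thesis by blast
qed

lemma Mplus_submodule: "submodule Mplus (val_ring v) M"
proof -
  interpret M: Module.module "val_ring v" M by (rule M_module)
  have um: "\<ominus>\<^bsub>M\<^esub> f = - f" if "f \<in> carrier M" for f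
    using M.M.minus_equality[of "- f" f] M_uminus[OF that] that by simp
  have sub: "Mplus \<subseteq> carrier M" by (auto simp: Mplus_def val_gt_imp_ge)
  show ?thesis
  proof (rule M.submoduleI[OF sub])
    show "\<ominus>\<^bsub>M\<^esub> f \<in> Mplus" if "f \<in> Mplus" for f
      using um[OF subsetD[OF sub that]] that by (auto simp: Mplus_def H_uminus pt)
    show "f \<oplus>\<^bsub>M\<^esub> g \<in> Mplus" if "f \<in> Mplus" "g \<in> Mplus" for f g
      using that by (auto simp: Mplus_def H_add intro: val_gt_add[OF pt])
    show "c \<odot>\<^bsub>M\<^esub> f \<in> Mplus" if "c \<in> carrier (val_ring v)" "f \<in> Mplus" for c f
      using that H_scale[of f c] val_gt_mult_left[OF pt, of _ f _ "e c" 0] valued_extension.val_ge_const[OF pt_ext, of _ c 0]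
      by (auto simp: Mplus_def mult.commute)
  qed (simp add: Mplus_def H_0)
qed

lemma mM_eq: "mM = Mplus"
proof -
  let ?G = "{c \<odot>\<^bsub>M\<^esub> x | c x. c \<in> val_ideal v \<and> x \<in> carrier M}"
  have G: "?G \<subseteq> Mplus" using scale_gt[of _ _ 0] by (auto simp: Mplus_def val_ideal_def H_scale)
  then have "mM \<subseteq> Mplus"
    unfolding ideal_times_module_def submodule_span_def using Mplus_submodule by blast
  moreover have "Mplus \<subseteq> ?G" using Mplus_factor by (fastforce simp: val_ideal_def)
  then have "Mplus \<subseteq> mM"
    unfolding ideal_times_module_def submodule_span_def by blast
  ultimately show ?thesis by blast
qed

lemma unit_scale_ge:
  assumes "x \<in> V" shows "val_ge (pt_val x) (e (inverse (a (h x))) * f) s \<longleftrightarrow> val_ge (pt_val x) f (s + h x)"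
    and "val_gt (pt_val x) (e (inverse (a (h x))) * f) s \<longleftrightarrow> val_gt (pt_val x) f (s + h x)"
  using a[OF h[OF assms]] assms
  by (cases "f = 0"; auto simp: val_ge_def val_gt_def field_embedding_eq_0[OF emb] valuation_mult[OF pt] ext valuation_inverse[OF v])+

lemma T_eq_iff:
  assumes "f \<in> H" "g \<in> H" shows "T f = T g \<longleftrightarrow> f - g \<in> Mplus"
proof -
  have "T f = T g \<longleftrightarrow> (\<forall>x\<in>V. reduction (pt_val x) (e (inverse (a (h x))) * f) = reduction (pt_val x) (e (inverse (a (h x))) * g))"
    unfolding red_map_def by (auto simp: fun_eq_iff restrict_def)
  also have "\<dots> \<longleftrightarrow> (\<forall>x\<in>V. val_gt (pt_val x) (f - g) (h x))"
    using unit_scale_ge(2)[of _ _ 0] by (auto simp: reduction_eq_iff[OF pt] simp flip: right_diff_distrib)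
  finally show ?thesis using assms by (simp add: Mplus_def H_diff)
qed

lemma S_simps [simp]:
  "carrier S = (\<Pi>\<^sub>E x\<in>V. reduced_span v e a H x)" "\<zero>\<^bsub>S\<^esub> = (\<lambda>x\<in>V. \<zero>\<^bsub>residue_space e (pt_val x)\<^esub>)"
  "u \<oplus>\<^bsub>S\<^esub> u' = (\<lambda>x\<in>V. u x \<oplus>\<^bsub>residue_space e (pt_val x)\<^esub> u' x)"
  "c \<odot>\<^bsub>S\<^esub> u = (\<lambda>x\<in>V. c \<odot>\<^bsub>residue_space e (pt_val x)\<^esub> u x)"
  by (simp_all add: reduced_sum_def)

lemma reduced_span_submodule:
  assumes x: "x \<in> V"
  shows "submodule (reduced_span v e a H x) (residue_field v) (residue_space e (pt_val x))"
    "\<And>f. f \<in> H \<Longrightarrow> f \<noteq> 0 \<Longrightarrow> reduction (pt_val x) (e (inverse (a (pt_val x f))) * f) \<in> reduced_span v e a H x"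
proof -
  have sub: "{reduction (pt_val x) (e (inverse (a (pt_val x f))) * f) | f. f \<in> H \<and> f \<noteq> 0} \<subseteq> carrier (residue_space e (pt_val x))"
    using a[OF vals[OF x]]
    by (auto simp: residue_field_carrier val_ge_def valuation_mult[OF pt[OF x]] ext[OF x] valuation_inverse[OF v] field_embedding_eq_0[OF emb])
  note span = submodule_span_submodule[OF valued_extension.residue_space_module[OF pt_ext[OF x]] sub]
  show "submodule (reduced_span v e a H x) (residue_field v) (residue_space e (pt_val x))"
    unfolding reduced_span_def by (rule span(1))
  show "reduction (pt_val x) (e (inverse (a (pt_val x f))) * f) \<in> reduced_span v e a H x" if "f \<in> H" "f \<noteq> 0" for f
    unfolding reduced_span_def by (rule subsetD[OF span(2)]) (use that in blast)
qed

lemma S_module: "Module.module (residue_field v) S"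
proof (rule product_module[where V = V and B = "\<lambda>x. residue_space e (pt_val x)" and C = "reduced_span v e a H"])
  show "cring (residue_field v)" using residue_field_field[OF v] by (simp add: field_def domain_def)
qed (auto intro: reduced_span_submodule(1) valued_extension.residue_space_module pt_ext)

lemma T_carrier: assumes "f \<in> carrier M" shows "T f \<in> carrier S"
proof -
  have "reduction (pt_val x) (e (inverse (a (h x))) * f) \<in> reduced_span v e a H x" if x: "x \<in> V" for x
  proof (cases "val_gt (pt_val x) f (h x)")
    case True
    then have "reduction (pt_val x) (e (inverse (a (h x))) * f) = reduction (pt_val x) 0"
      using unit_scale_ge(2)[OF x, of f 0] by (simp add: reduction_eq_iff[OF pt[OF x]])
    also have "\<dots> = \<zero>\<^bsub>residue_space e (pt_val x)\<^esub>" by (simp add: residue_field_ops(4)[OF pt[OF x]])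
    also have "\<dots> \<in> reduced_span v e a H x"
      using subgroup.one_closed[OF submodule.axioms(1)[OF reduced_span_submodule(1)[OF x]]] by simp
    finally show ?thesis .
  next
    case False
    then have "f \<noteq> 0" "pt_val x f = h x" using assms x by (auto simp: val_gt_def val_ge_def)
    then show ?thesis using reduced_span_submodule(2)[OF x, of f] assms by simp
  qed
  then show ?thesis by (auto simp: red_map_def)
qed

lemma T_add: "f \<in> carrier M \<Longrightarrow> g \<in> carrier M \<Longrightarrow> T (f + g) = T f \<oplus>\<^bsub>S\<^esub> T g"
  using unit_scale_ge(1)[of _ _ 0] by (auto simp: red_map_def fun_eq_iff residue_field_ops(1)[OF pt] distrib_left)

lemma T_scale: "val_ge v c 0 \<Longrightarrow> f \<in> carrier M \<Longrightarrow> T (e c * f) = reduction v c \<odot>\<^bsub>S\<^esub> T f"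
  using unit_scale_ge(1)[of _ _ 0]
  by (auto simp: red_map_def fun_eq_iff valued_extension.residue_smult[OF pt_ext] mult.left_commute)

lemma T_0: "T 0 = \<zero>\<^bsub>S\<^esub>"
  by (auto simp: red_map_def fun_eq_iff residue_field_ops(4)[OF pt])

lemma coordinate:
  assumes i: "i < n" shows "\<phi> i (\<Sum>j<n. e (c j) * b j) = c i"
proof -
  have add: "\<phi> i (f + g) = \<phi> i f + \<phi> i g" if "f \<in> H" "g \<in> H" for f g
    using lin[OF i] that by (simp add: linear_on_def)
  have sc: "\<phi> i (e c * f) = c * \<phi> i f" if "f \<in> H" for c f
    using lin[OF i] that by (simp add: linear_on_def)
  have "(\<Sum>j\<in>J. e (c j) * b j) \<in> H \<and> \<phi> i (\<Sum>j\<in>J. e (c j) * b j) = (\<Sum>j\<in>J. if j = i then c i else 0)"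
    if "finite J" "J \<subseteq> {..<n}" for J
    using that
  proof induction
    case empty
    show ?case using sc[OF H_0, of 0] H_0 by simp
  next
    case (insert j J)
    then have bj: "b j \<in> H" "j < n" using b by auto
    show ?case using insert bj dual[OF i bj(2)] by (auto simp: H_add H_scale add sc)
  qed
  from this[of "{..<n}"] show ?thesis using i by simp
qed

lemma b_carrier: "i < n \<Longrightarrow> b i \<in> carrier M" using b by simp

lemma combination_carrier: "(\<And>i. i < n \<Longrightarrow> val_ge v (c i) 0) \<Longrightarrow> (\<Sum>i<n. e (c i) * b i) \<in> carrier M"
  by (rule M_sum, rule M_scale) (auto simp del: M_simps intro: b_carrier)

lemma free_M: "free_of_rank (val_ring v) M n"
  unfolding free_of_rank_def
proof (intro conjI exI ballI)
  show "Module.module (val_ring v) M" by (rule M_module)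
  show "b \<in> {..<n} \<rightarrow> carrier M" using b_carrier by (auto simp del: M_simps)
  fix g assume g: "g \<in> carrier M"
  have am: "abelian_monoid M" using M_module by (simp add: Module.module_def abelian_group_def)
  have fs: "(\<Oplus>\<^bsub>M\<^esub>i\<in>{..<n}. c i \<odot>\<^bsub>M\<^esub> b i) = (\<Sum>i<n. e (c i) * b i)"
    if "c \<in> {..<n} \<rightarrow>\<^sub>E carrier (val_ring v)" for c
  proof -
    have "finsum M (\<lambda>i. (\<lambda>x. x) (c i \<odot>\<^bsub>M\<^esub> b i)) {..<n} = (\<lambda>x. x) (\<Sum>i<n. c i \<odot>\<^bsub>M\<^esub> b i)"
    proof (rule finsum_additive_map[OF am, where D = "carrier M" and T = "\<lambda>x. x"])
      show "c i \<odot>\<^bsub>M\<^esub> b i \<in> carrier M" if "i \<in> {..<n}" for i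
        using M_scale[OF _ b_carrier, of "c i" i] that PiE_mem[OF \<open>c \<in> _\<close> that] by simp
    qed (auto simp del: M_simps(1) intro: M_0 M_add)
    then show ?thesis by simp
  qed
  have coords: "(\<lambda>i\<in>{..<n}. \<phi> i g) \<in> {..<n} \<rightarrow>\<^sub>E carrier (val_ring v)" using bound g by auto
  show "\<exists>!c. c \<in> {..<n} \<rightarrow>\<^sub>E carrier (val_ring v) \<and> g = (\<Oplus>\<^bsub>M\<^esub>i\<in>{..<n}. c i \<odot>\<^bsub>M\<^esub> b i)"
  proof (rule ex1I)
    show "(\<lambda>i\<in>{..<n}. \<phi> i g) \<in> {..<n} \<rightarrow>\<^sub>E carrier (val_ring v) \<and>
       g = (\<Oplus>\<^bsub>M\<^esub>i\<in>{..<n}. (\<lambda>i\<in>{..<n}. \<phi> i g) i \<odot>\<^bsub>M\<^esub> b i)"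
      unfolding fs[OF coords] using coords expand[of g] g by simp
  next
    fix c assume "c \<in> {..<n} \<rightarrow>\<^sub>E carrier (val_ring v) \<and> g = (\<Oplus>\<^bsub>M\<^esub>i\<in>{..<n}. c i \<odot>\<^bsub>M\<^esub> b i)"
    then have c: "c \<in> {..<n} \<rightarrow>\<^sub>E carrier (val_ring v)" and g: "g = (\<Sum>i<n. e (c i) * b i)" using fs by auto
    show "c = (\<lambda>i\<in>{..<n}. \<phi> i g)"
      by (rule PiE_ext[OF c coords]) (simp add: coordinate g)
  qed
qed

lemma W_eq: "W = T ` carrier M" by (simp add: W_set_def)

lemma carrier_residue: "C \<in> carrier (residue_field v) \<Longrightarrow> \<exists>c. val_ge v c 0 \<and> C = reduction v c"
  by (auto simp: residue_field_carrier)

lemma W_submodule: "submodule W (residue_field v) S"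
proof -
  interpret S: Module.module "residue_field v" S by (rule S_module)
  show ?thesis
  proof (rule S.submoduleI)
    show sub: "W \<subseteq> carrier S" unfolding W_eq using T_carrier by blast
    show "\<zero>\<^bsub>S\<^esub> \<in> W" unfolding W_eq T_0[symmetric] using M_0 by blast
    show "\<ominus>\<^bsub>S\<^esub> u \<in> W" if "u \<in> W" for u
    proof -
      obtain f where f: "f \<in> carrier M" "u = T f" using \<open>u \<in> W\<close> by (auto simp: W_eq)
      have "T (- f) \<oplus>\<^bsub>S\<^esub> T f = \<zero>\<^bsub>S\<^esub>"
        unfolding T_add[OF M_uminus[OF f(1)] f(1), symmetric] T_0[symmetric] by simp
      then have "\<ominus>\<^bsub>S\<^esub> u = T (- f)"
        unfolding f(2) by (rule S.M.minus_equality[OF _ T_carrier[OF f(1)] T_carrier[OF M_uminus[OF f(1)]]])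
      then show ?thesis unfolding W_eq using M_uminus[OF f(1)] by blast
    qed
    show "u \<oplus>\<^bsub>S\<^esub> u' \<in> W" if "u \<in> W" "u' \<in> W" for u u'
    proof -
      obtain f g where "f \<in> carrier M" "u = T f" "g \<in> carrier M" "u' = T g"
        using \<open>u \<in> W\<close> \<open>u' \<in> W\<close> unfolding W_eq by blast
      then show ?thesis unfolding W_eq using T_add M_add by (metis image_eqI)
    qed
    show "C \<odot>\<^bsub>S\<^esub> u \<in> W" if C: "C \<in> carrier (residue_field v)" and u: "u \<in> W" for C u
    proof -
      obtain f where f: "f \<in> carrier M" "u = T f" using u unfolding W_eq by blast
      obtain c where c: "val_ge v c 0" "C = reduction v c" using carrier_residue[OF C] by blast
      show ?thesis unfolding W_eq f(2) c(2) T_scale[OF c(1) f(1), symmetric]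
        by (rule imageI) (rule M_scale[OF c(1) f(1)])
    qed
  qed
qed

abbreviation "SW \<equiv> S \<lparr>carrier := W\<rparr>"

lemma SW_module: "Module.module (residue_field v) SW"
  by (rule submodule.submodule_is_module[OF W_submodule S_module])

text \<open>The reductions of the \<open>b i\<close> form a basis. For uniqueness, two combinations with the same
  reduction differ by an element \<open>k * y\<close> of the lattice with \<open>v k > 0\<close>, whose coordinates have positive value.\<close>
lemma free_W: "free_of_rank (residue_field v) SW n"
  unfolding free_of_rank_def
proof (intro conjI exI ballI)
  show "Module.module (residue_field v) SW" by (rule SW_module)
  show "(\<lambda>i. T (b i)) \<in> {..<n} \<rightarrow> carrier SW" using b_carrier by (auto simp del: M_simps simp: W_eq)
  fix u assume "u \<in> carrier SW"
  then obtain g where g: "g \<in> carrier M" "u = T g" unfolding W_eq by auto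
  have gH: "g \<in> H" using g by simp
  have sc: "reduction v c \<odot>\<^bsub>SW\<^esub> T x \<in> carrier SW" if "val_ge v c 0" "x \<in> carrier M" for c x
    by (rule Module.module.smult_closed[OF SW_module]) (use that in \<open>auto simp: residue_field_carrier W_eq simp del: M_simps\<close>)
  have am: "abelian_monoid SW" using SW_module by (simp add: Module.module_def abelian_group_def)
  have fs: "(\<Oplus>\<^bsub>SW\<^esub>i\<in>{..<n}. reduction v (c i) \<odot>\<^bsub>SW\<^esub> T (b i)) = T (\<Sum>i<n. e (c i) * b i)"
    if c: "\<And>i. i < n \<Longrightarrow> val_ge v (c i) 0" for c
  proof -
    have mem: "e (c i) * b i \<in> carrier M" if "i \<in> {..<n}" for i
      using M_scale[OF c b_carrier] that by (simp del: M_simps)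
    have WT: "T x \<in> carrier SW" if "x \<in> carrier M" for x
      unfolding partial_object.select_convs partial_object.update_convs using that by (simp add: W_eq del: M_simps)
    have "(\<Oplus>\<^bsub>SW\<^esub>i\<in>{..<n}. reduction v (c i) \<odot>\<^bsub>SW\<^esub> T (b i)) = (\<Oplus>\<^bsub>SW\<^esub>i\<in>{..<n}. T (e (c i) * b i))"
    proof (rule abelian_monoid.finsum_cong'[OF am refl])
      show "(\<lambda>i. T (e (c i) * b i)) \<in> {..<n} \<rightarrow> carrier SW" using mem WT by blast
      show "reduction v (c i) \<odot>\<^bsub>SW\<^esub> T (b i) = T (e (c i) * b i)" if "i \<in> {..<n}" for i
        using T_scale[OF c b_carrier, of i] that by simp
    qed
    also have "\<dots> = T (\<Sum>i<n. e (c i) * b i)"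
      by (rule finsum_additive_map[OF am, where D = "carrier M"])
        (use mem WT T_add T_0 M_0 M_add in \<open>auto simp del: M_simps S_simps\<close>)
    finally show ?thesis .
  qed
  let ?c = "\<lambda>i\<in>{..<n}. reduction v (\<phi> i g)"
  show "\<exists>!c. c \<in> {..<n} \<rightarrow>\<^sub>E carrier (residue_field v) \<and> u = (\<Oplus>\<^bsub>SW\<^esub>i\<in>{..<n}. c i \<odot>\<^bsub>SW\<^esub> T (b i))"
  proof (rule ex1I)
    have bd: "val_ge v (\<phi> i g) 0" if "i < n" for i using bound[OF that] g by simp
    have "(\<Oplus>\<^bsub>SW\<^esub>i\<in>{..<n}. ?c i \<odot>\<^bsub>SW\<^esub> T (b i)) = (\<Oplus>\<^bsub>SW\<^esub>i\<in>{..<n}. reduction v (\<phi> i g) \<odot>\<^bsub>SW\<^esub> T (b i))"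
    proof (rule abelian_monoid.finsum_cong'[OF am refl])
      show "(\<lambda>i. reduction v (\<phi> i g) \<odot>\<^bsub>SW\<^esub> T (b i)) \<in> {..<n} \<rightarrow> carrier SW"
        using bd b_carrier sc by blast
    qed simp
    also have "\<dots> = T (\<Sum>i<n. e (\<phi> i g) * b i)" by (rule fs[OF bd])
    also have "\<dots> = u" by (simp only: g(2) expand[OF gH, symmetric])
    finally show "?c \<in> {..<n} \<rightarrow>\<^sub>E carrier (residue_field v) \<and> u = (\<Oplus>\<^bsub>SW\<^esub>i\<in>{..<n}. ?c i \<odot>\<^bsub>SW\<^esub> T (b i))"
      using bd by (auto simp: residue_field_carrier)
  next
    fix c assume c: "c \<in> {..<n} \<rightarrow>\<^sub>E carrier (residue_field v) \<and> u = (\<Oplus>\<^bsub>SW\<^esub>i\<in>{..<n}. c i \<odot>\<^bsub>SW\<^esub> T (b i))"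
    have "\<exists>d. val_ge v d 0 \<and> c i = reduction v d" if "i \<in> {..<n}" for i
      using c that by (intro carrier_residue) auto
    then obtain d where d: "\<And>i. i < n \<Longrightarrow> val_ge v (d i) 0 \<and> c i = reduction v (d i)" by (metis lessThan_iff)
    define f where "f = (\<Sum>i<n. e (d i) * b i)"
    have f: "f \<in> carrier M" unfolding f_def by (rule combination_carrier) (use d in blast)
    have "T g = (\<Oplus>\<^bsub>SW\<^esub>i\<in>{..<n}. c i \<odot>\<^bsub>SW\<^esub> T (b i))" using c g(2) by simp
    also have "\<dots> = (\<Oplus>\<^bsub>SW\<^esub>i\<in>{..<n}. reduction v (d i) \<odot>\<^bsub>SW\<^esub> T (b i))"
    proof (rule abelian_monoid.finsum_cong'[OF am refl])
      show "(\<lambda>i. reduction v (d i) \<odot>\<^bsub>SW\<^esub> T (b i)) \<in> {..<n} \<rightarrow> carrier SW"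
        using d b_carrier sc by blast
    qed (use d in simp)
    also have "\<dots> = T f" unfolding f_def by (rule fs) (use d in blast)
    finally have "g - f \<in> Mplus" using T_eq_iff[OF gH, of f] f by simp
    then obtain k y where k: "val_gt v k 0" "y \<in> carrier M" "g - f = e k * y" using Mplus_factor by blast
    show "c = ?c"
    proof (rule PiE_ext[where k = "{..<n}" and s = "\<lambda>_. carrier (residue_field v)"])
      show "c \<in> {..<n} \<rightarrow>\<^sub>E carrier (residue_field v)" using c by blast
      show "?c \<in> {..<n} \<rightarrow>\<^sub>E carrier (residue_field v)"
        using bound g by (auto simp: residue_field_carrier)
      fix i assume "i \<in> {..<n}"
      then have i: "i < n" by simp
      have add: "\<phi> i (e k * y + f) = k * \<phi> i y + \<phi> i f"
        using lin[OF i] k(2) f H_scale by (simp add: linear_on_def)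
      have "g = e k * y + f" using k(3) by (simp add: algebra_simps)
      then have "\<phi> i g - d i = k * \<phi> i y" using add coordinate[OF i, of d] by (simp add: f_def)
      moreover have "val_gt v (k * \<phi> i y) 0" using val_gt_mult_left[OF v k(1) bound[OF i, of y]] k(2) by simp
      ultimately have "reduction v (\<phi> i g) = reduction v (d i)" by (simp add: reduction_eq_iff[OF v])
      then show "c i = ?c i" using d i by simp
    qed
  qed
qed

abbreviation "Q \<equiv> reduced_module (val_ring v) (val_ideal v) M"
abbreviation "cls f \<equiv> mM +>\<^bsub>M\<^esub> f"

lemma cls_conv: "cls f = {y. y - f \<in> Mplus}"
proof -
  have "y \<in> (\<lambda>g. g + f) ` Mplus \<longleftrightarrow> y - f \<in> Mplus" for y
    by (auto simp: image_iff intro: bexI[of _ "y - f"])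
  then show ?thesis unfolding mM_eq by (auto simp: a_r_coset_def')
qed

lemma Mplus_carrier: "f \<in> Mplus \<Longrightarrow> f \<in> carrier M"
  by (auto simp: Mplus_def val_gt_imp_ge)

lemma cls_mem_iff: assumes f: "f \<in> carrier M" shows "y \<in> cls f \<longleftrightarrow> y \<in> carrier M \<and> T y = T f"
proof
  assume "y \<in> cls f"
  then have yf: "y - f \<in> Mplus" by (simp add: cls_conv)
  then have "y = (y - f) + f" "y - f \<in> carrier M" using Mplus_carrier by (auto simp del: M_simps)
  then have "y \<in> carrier M" using M_add f by metis
  then show "y \<in> carrier M \<and> T y = T f" using T_eq_iff[of y f] f yf by simp
next
  assume "y \<in> carrier M \<and> T y = T f"
  then show "y \<in> cls f" using T_eq_iff[of y f] f by (simp add: cls_conv)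
qed

lemma cls_eq: assumes "f \<in> carrier M" "g \<in> carrier M" shows "cls f = cls g \<longleftrightarrow> T f = T g"
  using cls_mem_iff[OF assms(1)] cls_mem_iff[OF assms(2)] assms by (auto simp del: M_simps)

lemma Q_simps:
  "carrier Q = cls ` carrier M" "\<zero>\<^bsub>Q\<^esub> = cls 0" "Y \<oplus>\<^bsub>Q\<^esub> Z = Y <+>\<^bsub>M\<^esub> Z"
  "C \<odot>\<^bsub>Q\<^esub> Y = (\<Union>c\<in>C. \<Union>y\<in>Y. cls (e c * y))"
proof -
  have "mM = cls 0" unfolding cls_conv by (simp add: mM_eq)
  then show "\<zero>\<^bsub>Q\<^esub> = cls 0" by (simp add: reduced_module_def Let_def)
qed (auto simp: reduced_module_def Let_def A_RCOSETS_def' simp del: M_simps(1))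

lemma Q_add: assumes f: "f \<in> carrier M" and g: "g \<in> carrier M" shows "cls f \<oplus>\<^bsub>Q\<^esub> cls g = cls (f + g)"
proof -
  have "y \<in> cls f <+>\<^bsub>M\<^esub> cls g \<longleftrightarrow> y \<in> cls (f + g)" for y
  proof
    assume "y \<in> cls f <+>\<^bsub>M\<^esub> cls g"
    then obtain p q where pq: "p \<in> cls f" "q \<in> cls g" "y = p + q" by (auto simp: set_add_def')
    then have "p \<in> carrier M" "T p = T f" "q \<in> carrier M" "T q = T g"
      unfolding cls_mem_iff[OF f] cls_mem_iff[OF g] by auto
    then show "y \<in> cls (f + g)"
      unfolding cls_mem_iff[OF M_add[OF f g]] pq(3) by (simp add: T_add f g M_add del: M_simps S_simps)
  next
    assume "y \<in> cls (f + g)"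
    then have "y - f \<in> cls g" by (simp add: cls_conv algebra_simps)
    moreover have "f \<in> cls f" unfolding cls_mem_iff[OF f] using f by blast
    moreover have "y = f + (y - f)" by simp
    ultimately have "\<exists>p\<in>cls f. \<exists>q\<in>cls g. y = p + q" by blast
    then show "y \<in> cls f <+>\<^bsub>M\<^esub> cls g" by (simp add: set_add_def' del: M_simps(1))
  qed
  then show ?thesis unfolding Q_simps by blast
qed

lemma Q_smult:
  assumes c: "val_ge v c 0" and f: "f \<in> carrier M"
  shows "reduction v c \<odot>\<^bsub>Q\<^esub> cls f = cls (e c * f)"
proof -
  have "cls (e d * y) = cls (e c * f)" if d: "d \<in> reduction v c" and y: "y \<in> cls f" for d y
  proof -
    have dc: "val_gt v (d - c) 0" using d by (simp add: reduction_conv)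
    have "val_ge v ((d - c) + c) 0" by (intro val_ge_add[OF v] val_gt_imp_ge[OF dc] c)
    then have vd: "val_ge v d 0" by simp
    have y': "y \<in> carrier M" "T y = T f" using y unfolding cls_mem_iff[OF f] by auto
    have "reduction v d = reduction v c" using dc by (simp add: reduction_eq_iff[OF v])
    then have "T (e d * y) = T (e c * f)"
      unfolding T_scale[OF vd y'(1)] T_scale[OF c f] y'(2) by simp
    then show ?thesis using cls_eq[OF M_scale[OF vd y'(1)] M_scale[OF c f]] by blast
  qed
  moreover have "c \<in> reduction v c" by (simp add: reduction_conv)
  moreover have "f \<in> cls f" unfolding cls_mem_iff[OF f] using f by blast
  ultimately show ?thesis unfolding Q_simps by blast
qed

text \<open>The reduction map is constant on each coset, so the image of the coset is a singleton.\<close>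
definition factor_map :: "'f set \<Rightarrow> 'f an_point \<Rightarrow> 'f set" where
  "factor_map Y = the_elem (T ` Y)"

lemma factor_map_cls: assumes f: "f \<in> carrier M" shows "factor_map (cls f) = T f"
proof -
  have "T ` cls f = {T f}" using cls_mem_iff[OF f] f by (auto simp del: M_simps)
  then show ?thesis by (simp add: factor_map_def)
qed

lemma factor_map_iso: "factor_map \<in> module_iso (residue_field v) Q SW"
proof -
  have bij: "bij_betw factor_map (carrier Q) (carrier SW)"
    unfolding bij_betw_def
  proof
    show "inj_on factor_map (carrier Q)"
    proof (rule inj_onI)
      fix x y assume xy: "x \<in> carrier Q" "y \<in> carrier Q" "factor_map x = factor_map y"
      obtain f g where fg: "f \<in> carrier M" "x = cls f" "g \<in> carrier M" "y = cls g"
        using xy unfolding Q_simps(1) by blast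
      show "x = y" using xy(3) unfolding fg(2,4) factor_map_cls[OF fg(1)] factor_map_cls[OF fg(3)] cls_eq[OF fg(1,3)] .
    qed
    show "factor_map ` carrier Q = carrier SW"
      by (auto simp: Q_simps(1) image_image factor_map_cls W_eq simp del: M_simps cong: image_cong)
  qed
  have add: "x \<oplus>\<^bsub>Q\<^esub> y \<in> carrier Q \<and> factor_map (x \<oplus>\<^bsub>Q\<^esub> y) = factor_map x \<oplus>\<^bsub>SW\<^esub> factor_map y"
    if x: "x \<in> carrier Q" and y: "y \<in> carrier Q" for x y
  proof -
    obtain f g where fg: "f \<in> carrier M" "x = cls f" "g \<in> carrier M" "y = cls g"
      using x y unfolding Q_simps(1) by blast
    show ?thesis unfolding fg(2,4) Q_add[OF fg(1,3)] factor_map_cls[OF fg(1)] factor_map_cls[OF fg(3)] factor_map_cls[OF M_add[OF fg(1,3)]]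
      using M_add[OF fg(1,3)] T_add[OF fg(1,3)] by (auto simp: Q_simps(1) simp del: M_simps)
  qed
  have sm: "C \<odot>\<^bsub>Q\<^esub> x \<in> carrier Q \<and> factor_map (C \<odot>\<^bsub>Q\<^esub> x) = C \<odot>\<^bsub>SW\<^esub> factor_map x"
    if C: "C \<in> carrier (residue_field v)" and x: "x \<in> carrier Q" for C x
  proof -
    obtain f where f: "f \<in> carrier M" "x = cls f" using x unfolding Q_simps(1) by blast
    obtain c where c: "val_ge v c 0" "C = reduction v c" using carrier_residue[OF C] by blast
    show ?thesis unfolding f(2) c(2) Q_smult[OF c(1) f(1)] factor_map_cls[OF f(1)] factor_map_cls[OF M_scale[OF c(1) f(1)]]
      using M_scale[OF c(1) f(1)] T_scale[OF c(1) f(1)] by (auto simp: Q_simps(1) simp del: M_simps)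
  qed
  have z: "\<zero>\<^bsub>Q\<^esub> \<in> carrier Q" "factor_map \<zero>\<^bsub>Q\<^esub> = \<zero>\<^bsub>SW\<^esub>"
    unfolding Q_simps(1,2) factor_map_cls[OF M_0] using M_0 T_0 by (auto simp del: M_simps)
  have "Module.module (residue_field v) Q"
    by (rule module_transport[OF SW_module bij add sm z])
  then show ?thesis unfolding module_iso_def using bij add sm SW_module by blast
qed

theorem reduction_theorem:
  "free_of_rank (val_ring v) M n \<and> T \<in> carrier M \<rightarrow> carrier S \<and>
    (\<exists>\<phi> \<in> module_iso (residue_field v) Q SW. \<forall>f \<in> carrier M. T f = \<phi> (cls f)) \<and>
    submodule W (residue_field v) S \<and> vector_space_of_dim (residue_field v) SW n"
proof (intro conjI)
  show "T \<in> carrier M \<rightarrow> carrier S" using T_carrier by blast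
  show "\<exists>\<phi> \<in> module_iso (residue_field v) Q SW. \<forall>f \<in> carrier M. T f = \<phi> (cls f)"
    using factor_map_iso factor_map_cls by (intro bexI[of _ factor_map]) auto
  show "vector_space_of_dim (residue_field v) SW n"
    unfolding vector_space_of_dim_def using residue_field_field[OF v] free_W by blast
qed (rule free_M W_submodule)+

end

section \<open>Orthonormal bases for points of type 2\<close>

text \<open>The minimum defining \<open>N f\<close> is attained at some \<open>x \<in> V\<close>, and a functional dominated by \<open>v\<^sub>x\<close> and exact at \<open>f\<close>
  becomes, after scaling by a constant of value \<open>- h(x)\<close>, one dominated by \<open>N\<close>.\<close>
theorem lattice_reduction_exists:
  fixes v :: "'k::alg_closed_field \<Rightarrow> real" and e :: "'k \<Rightarrow> 'f::field"
  assumes curve: "analytic_curve v e" and V: "finite V" "V \<noteq> {}" and type2: "\<And>x. x \<in> V \<Longrightarrow> type2 v e x"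
    and H: "module.subspace (\<lambda>c f. e c * f) H" and dim: "vector_space.dim (\<lambda>c f. e c * f) H = n" "n > 0"
    and a: "\<And>s. s \<in> value_group v \<Longrightarrow> a s \<noteq> 0 \<and> v (a s) = s"
    and h: "\<And>x. x \<in> V \<Longrightarrow> h x \<in> value_group v"
  obtains b \<phi> where "lattice_reduction v e V H a h n b \<phi>"
proof -
  have v: "valuation v" and ff: "function_field e" using curve by (auto simp: analytic_curve_def)
  have emb: "field_embedding e" using ff by (simp add: function_field_def)
  interpret K: vector_space "\<lambda>c f. e c * f" by (rule field_embedding_vector_space[OF emb])
  obtain x0 where x0: "finite_over e x0" by (rule function_field_finite_over[OF ff])
  have gauss: "\<exists>t. gauss_extension v e (pt_val x) t \<and> finite_over e t" if x: "x \<in> V" for x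
  proof -
    obtain w u where w: "x = Val w" "x \<in> an_points v e"
      and u: "u \<in> carrier (residue_field w)" "ring.transcendental (residue_field w) (constant_residues v e w) u"
      using type2[OF x] by (auto simp: type2_def)
    have vw: "valuation w" "\<And>c. w (e c) = v c" using w by (auto simp: an_points_def)
    obtain t where t: "gauss_extension v e w t"
      by (rule residually_transcendental_gauss[OF emb v vw u])
    have "finite_over e t"
      by (rule finite_over_exchange[OF emb x0 gauss_extension.transcendental[OF t]])
    with t w(1) show ?thesis by auto
  qed
  have pt: "valuation (pt_val x)" "\<And>c. pt_val x (e c) = v c" if "x \<in> V" for x
    using gauss[OF that] by (auto simp: gauss_extension_def)
  have vals: "pt_val x f \<in> value_group v" if "x \<in> V" "f \<noteq> 0" for x f
    using gauss[OF that(1)] gauss_extension.value_in_value_group that(2) by blast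
  define N where "N f = Min ((\<lambda>x. pt_val x f - h x) ` V)" for f
  have N_le: "N f \<le> pt_val x f - h x" if "x \<in> V" for f x
    unfolding N_def using V that by (intro Min_le) auto
  have N_ex: "\<exists>x\<in>V. N f = pt_val x f - h x" for f
  proof -
    have "N f \<in> (\<lambda>x. pt_val x f - h x) ` V" unfolding N_def using V by (intro Min_in) auto
    then show ?thesis by blast
  qed
  obtain B where B: "B \<subseteq> H" "K.independent B" "H \<subseteq> K.span B" "card B = n"
    using K.basis_exists[of H] dim(1) by metis
  have fB: "finite B" using B(4) dim(2) card_gt_0_iff by blast
  have spB: "K.span B = H" using B(1,3) H by (simp add: K.span_minimal subset_antisym)
  have "normed_subspace v e H N"
  proof (unfold_locales)
    show "N (e c * f) = v c + N f" if "c \<noteq> 0" "f \<in> H" "f \<noteq> 0" for c f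
    proof -
      have pv: "pt_val x (e c * f) = v c + pt_val x f" if "x \<in> V" for x
        using \<open>c \<noteq> 0\<close> \<open>f \<noteq> 0\<close> pt[OF that] by (simp add: valuation_mult field_embedding_eq_0[OF emb])
      obtain x where x: "x \<in> V" "N f = pt_val x f - h x" using N_ex by blast
      obtain y where y: "y \<in> V" "N (e c * f) = pt_val y (e c * f) - h y" using N_ex by blast
      show ?thesis using N_le[OF x(1), of "e c * f"] N_le[OF y(1), of f] x y pv by fastforce
    qed
    show "N f \<in> value_group v" if "f \<in> H" "f \<noteq> 0" for f
    proof -
      obtain x where x: "x \<in> V" "N f = pt_val x f - h x" using N_ex by blast
      show ?thesis unfolding x(2) by (intro value_group_diff v vals h x(1) that)
    qed
    show "\<exists>\<phi>. linear_on e H \<phi> \<and> (\<forall>g\<in>H. g \<noteq> 0 \<longrightarrow> val_ge v (\<phi> g) (N g)) \<and> \<phi> f \<noteq> 0 \<and> v (\<phi> f) = N f"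
      if f: "f \<in> H" "f \<noteq> 0" for f
    proof -
      obtain x where x: "x \<in> V" "N f = pt_val x f - h x" using N_ex by blast
      obtain t where t: "gauss_extension v e (pt_val x) t" "finite_over e t" using gauss[OF x(1)] by blast
      have fS: "f \<in> K.span B" using f(1) spB by simp
      obtain \<psi> where
        \<psi>1: "\<And>g g'. g \<in> K.span B \<Longrightarrow> g' \<in> K.span B \<Longrightarrow> \<psi> (g + g') = \<psi> g + \<psi> g'" and
        \<psi>2: "\<And>c g. g \<in> K.span B \<Longrightarrow> \<psi> (e c * g) = c * \<psi> g" and
        \<psi>3: "\<And>g. g \<in> K.span B \<Longrightarrow> g \<noteq> 0 \<Longrightarrow> val_ge v (\<psi> g) (pt_val x g)" and
        \<psi>4: "\<psi> f \<noteq> 0" "v (\<psi> f) = pt_val x f"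
        using gauss_extension.dominated_functional[OF t fB fS f(2)] by metis
      define k where "k = inverse (a (h x))"
      have k: "k \<noteq> 0" "v k = - h x" using a[OF h[OF x(1)]] by (auto simp: k_def valuation_inverse[OF v])
      show ?thesis
      proof (intro exI[of _ "\<lambda>g. k * \<psi> g"] conjI ballI impI)
        show "linear_on e H (\<lambda>g. k * \<psi> g)"
          unfolding linear_on_def using \<psi>1 \<psi>2 spB by (simp add: algebra_simps)
        show "val_ge v (k * \<psi> g) (N g)" if g: "g \<in> H" "g \<noteq> 0" for g
          using \<psi>3[of g] g spB k N_le[OF x(1), of g] by (cases "\<psi> g = 0") (auto simp: val_ge_def valuation_mult[OF v])
        show "k * \<psi> f \<noteq> 0" "v (k * \<psi> f) = N f" using k \<psi>4 x(2) by (auto simp: valuation_mult[OF v])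
      qed
    qed
  qed (rule emb v H)+
  then interpret N: normed_subspace v e H N .
  obtain b \<phi> where o: "N.orthonormal n b \<phi>" and expand: "\<And>g. g \<in> H \<Longrightarrow> g = (\<Sum>i<n. e (\<phi> i g) * b i)"
    using N.orthonormal_basis[OF dim] by metis
  have "lattice_reduction v e V H a h n b \<phi>"
  proof (unfold_locales)
    show "b i \<in> H \<and> (\<forall>x\<in>V. val_ge (pt_val x) (b i) (h x))" if "i < n" for i
    proof -
      have "b i \<in> H" "N (b i) = 0" using o that by (auto simp: N.orthonormal_def)
      then show ?thesis using N_le[of _ "b i"] by (auto simp: val_ge_def)
    qed
    show "val_ge v (\<phi> i g) 0" if i: "i < n" and g: "g \<in> H" "\<forall>x\<in>V. val_ge (pt_val x) g (h x)" for i g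
    proof (cases "g = 0")
      case True
      have l: "linear_on e H (\<phi> i)" using o i by (simp add: N.orthonormal_def)
      show ?thesis using True N.linear_on_0[OF l] by simp
    next
      case False
      have "0 \<le> N g" using N_ex[of g] g(2) False by (auto simp: val_ge_def)
      moreover have "val_ge v (\<phi> i g) (N g)" using o i g(1) False by (simp add: N.orthonormal_def)
      ultimately show ?thesis by (rule val_ge_trans[rotated])
    qed
    show "g = (\<Sum>i<n. e (\<phi> i g) * b i)" if "g \<in> H" for g by (rule expand[OF that])
  qed (use emb v V pt vals H a h o in \<open>auto simp: N.orthonormal_def\<close>)
  then show ?thesis by (rule that)
qed

section \<open>Valuation rings of a function field\<close>

lemma algebraic_over_closed_field:
  fixes e :: "'k::alg_closed_field \<Rightarrow> 'f::field"
  assumes e: "field_embedding e" and "\<not> transcendental_over e f"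
  obtains c where "f = e c"
proof -
  obtain p where p: "p \<noteq> 0" "peval e p f = 0" using assms(2) by (auto simp: transcendental_over_def)
  have "\<exists>c. f = e c" using p
  proof (induction "Polynomial.degree p" arbitrary: p)
    case 0
    then obtain c where "p = [:c:]" "c \<noteq> 0" by (metis degree_eq_zeroE pCons_0_0)
    then show ?case using 0 by (simp add: peval_pCons[OF e] field_embedding_eq_0[OF e])
  next
    case (Suc n)
    then obtain c where "poly p c = 0" using alg_closed_imp_poly_has_root[of p] by auto
    then obtain q where pq: "p = [:- c, 1:] * q" by (auto simp: poly_eq_0_iff_dvd)
    then have q: "q \<noteq> 0" using Suc.prems by auto
    have "Polynomial.degree p = Suc (Polynomial.degree q)"
      unfolding pq by (subst degree_mult_eq) (use q in auto)
    moreover have "peval e p f = (f - e c) * peval e q f"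
      unfolding pq peval_mult[OF e] by (simp add: peval_pCons[OF e] field_embedding_uminus[OF e] field_embedding_1[OF e])
    ultimately show ?case using Suc.hyps(1)[of q] Suc.hyps(2) Suc.prems(2) q by auto
  qed
  then show ?thesis using that by blast
qed

text \<open>A valuation ring \<open>R\<close> of the function field containing the constants, with maximal ideal \<open>m\<close>. The element
  \<open>x\<close> of \<open>m\<close> shows that it is not the whole field and serves as a unit of measurement.\<close>
locale function_field_valuation_ring =
  fixes e :: "'k::alg_closed_field \<Rightarrow> 'f::field" and R :: "'f set" and m :: "'f set" and x :: 'f
  assumes emb: "field_embedding e"
    and R_add: "\<And>f g. f \<in> R \<Longrightarrow> g \<in> R \<Longrightarrow> f + g \<in> R" and R_mult: "\<And>f g. f \<in> R \<Longrightarrow> g \<in> R \<Longrightarrow> f * g \<in> R"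
    and const: "\<And>c. e c \<in> R" and m_sub: "m \<subseteq> R" and m_add: "\<And>f g. f \<in> m \<Longrightarrow> g \<in> m \<Longrightarrow> f + g \<in> m"
    and m_mult: "\<And>f g. f \<in> R \<Longrightarrow> g \<in> m \<Longrightarrow> f * g \<in> m" and m_const: "\<And>c. e c \<in> m \<longleftrightarrow> c = 0"
    and unit_inverse: "\<And>f. f \<in> R \<Longrightarrow> f \<notin> m \<Longrightarrow> inverse f \<in> R" and inverse_m: "\<And>f. f \<notin> R \<Longrightarrow> inverse f \<in> m"
    and x: "x \<in> m" "x \<noteq> 0" and fin: "finite_over e x"
begin

lemma one: "1 \<in> R" "1 \<notin> m" using const[of 1] m_const[of 1] by (simp_all add: field_embedding_1[OF emb])
lemma zero: "0 \<in> m" using m_const[of 0] by (simp add: field_embedding_0[OF emb])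

definition unit :: "'f \<Rightarrow> bool" where "unit u \<longleftrightarrow> u \<in> R \<and> u \<notin> m"

lemma unit_nz: "unit u \<Longrightarrow> u \<noteq> 0" using zero by (auto simp: unit_def)

lemma unit_inv: assumes "unit u" shows "unit (inverse u)"
proof -
  have "inverse u \<in> R" using assms unit_inverse by (simp add: unit_def)
  moreover have "inverse u \<notin> m"
  proof
    assume "inverse u \<in> m"
    then have "u * inverse u \<in> m" using assms m_mult by (simp add: unit_def)
    then show False using one(2) unit_nz[OF assms] by simp
  qed
  ultimately show ?thesis by (simp add: unit_def)
qed

lemma unit_mult: assumes u: "unit u" and u': "unit u'" shows "unit (u * u')"
proof -
  have "u * u' \<notin> m"
  proof
    assume "u * u' \<in> m"
    then have "inverse u * (u * u') \<in> m" using unit_inv[OF u] m_mult by (simp add: unit_def)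
    then show False using u' unit_nz[OF u] by (simp add: unit_def field_simps)
  qed
  then show ?thesis using u u' R_mult by (simp add: unit_def)
qed

lemma unit_1: "unit 1" using one by (simp add: unit_def)

lemma unit_power: "unit u \<Longrightarrow> unit (u ^ k)"
  by (induction k) (simp_all add: unit_mult unit_1)

lemma trichotomy: "f \<noteq> 0 \<Longrightarrow> f \<in> m \<or> unit f \<or> inverse f \<in> m"
  using inverse_m by (auto simp: unit_def)

lemma m_inverse: assumes "f \<in> m" "f \<noteq> 0" shows "inverse f \<notin> R"
proof
  assume "inverse f \<in> R"
  then have "inverse f * f \<in> m" using m_mult assms by blast
  then show False using one(2) assms by simp
qed

lemma R_power: "f \<in> R \<Longrightarrow> f ^ k \<in> R"
  by (induction k) (auto intro: one R_mult)

lemma m_power: assumes "f \<in> m" "k > 0" shows "f ^ k \<in> m"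
proof -
  obtain j where "k = Suc j" using assms(2) by (cases k) auto
  then show ?thesis using m_mult[OF R_power[OF subsetD[OF m_sub assms(1)]] assms(1), of j] by (simp add: mult.commute)
qed

lemma m_sum: "(\<And>i. i \<in> I \<Longrightarrow> g i \<in> m) \<Longrightarrow> sum g I \<in> m"
  by (induction I rule: infinite_finite_induct) (auto intro: zero m_add)

lemma peval_R: "peval e p x \<in> R"
  by (induction p) (auto simp: peval_pCons[OF emb] intro!: R_add const R_mult subsetD[OF m_sub x(1)] subsetD[OF m_sub zero])

text \<open>On \<open>K[x]\<close> the valuation is the order of vanishing at \<open>x = 0\<close>.\<close>
lemma peval_split: "p \<noteq> 0 \<Longrightarrow> \<exists>k u. unit u \<and> peval e p x = x ^ k * u"
proof (induction p)
  case (pCons c p)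
  show ?case
  proof (cases "c = 0")
    case True
    then obtain k u where "unit u" "peval e p x = x ^ k * u" using pCons by auto
    then show ?thesis using True
      by (intro exI[of _ "Suc k"] exI[of _ u]) (simp add: peval_pCons[OF emb] field_embedding_0[OF emb])
  next
    case False
    have xp: "peval e p x * x \<in> m" by (rule m_mult[OF peval_R x(1)])
    have "e c + x * peval e p x \<notin> m"
    proof
      assume "e c + x * peval e p x \<in> m"
      moreover have "e (- 1) * (peval e p x * x) \<in> m" by (rule m_mult[OF const xp])
      ultimately have "(e c + x * peval e p x) + e (- 1) * (peval e p x * x) \<in> m" by (rule m_add)
      then have "e c \<in> m" by (simp add: field_embedding_uminus[OF emb] field_embedding_1[OF emb] mult.commute)
      then show False using m_const False by simp
    qed
    moreover have "e c + x * peval e p x \<in> R"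
      by (intro R_add R_mult const peval_R subsetD[OF m_sub x(1)])
    ultimately show ?thesis
      by (intro exI[of _ 0] exI[of _ "peval e (pCons c p) x"]) (simp add: peval_pCons[OF emb] unit_def)
  qed
qed simp

text \<open>Divisibility is a total relation in a valuation ring, so one of finitely many elements divides all others.\<close>
lemma maximal_term:
  assumes "finite J" "J \<noteq> {}" "\<And>i. i \<in> J \<Longrightarrow> t i \<noteq> (0::'f)"
  shows "\<exists>j\<in>J. \<forall>i\<in>J. t i / t j \<in> R"
  using assms
proof (induction J rule: finite_ne_induct)
  case (singleton i)
  then show ?case using one by simp
next
  case (insert i J)
  then obtain j where j: "j \<in> J" "\<And>l. l \<in> J \<Longrightarrow> t l / t j \<in> R" by auto
  show ?case
  proof (cases "t i / t j \<in> R")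
    case True
    then show ?thesis using j by (intro bexI[of _ j]) auto
  next
    case False
    then have ji: "t j / t i \<in> R" using inverse_m[of "t i / t j"] m_sub by auto
    have "t l / t i \<in> R" if "l \<in> J" for l
      using R_mult[OF j(2)[OF that] ji] insert.prems j(1) by simp
    then show ?thesis using insert.prems one by (intro bexI[of _ i]) auto
  qed
qed

text \<open>In a relation of \<open>f\<close> over \<open>K[x]\<close> two terms agree up to a unit, so some power \<open>f ^ (i - j)\<close> is a
  power of \<open>x\<close> up to a unit. The degree of the relation is bounded, so the factorial of the bound serves as
  exponent for all \<open>f\<close>.\<close>
lemma commensurable:
  obtains D where "D > 0" "\<And>f. f \<noteq> 0 \<Longrightarrow> \<exists>k::int. unit (f ^ D * x powi k)"
proof -
  obtain N where N: "\<And>z. \<exists>P. P \<noteq> 0 \<and> Polynomial.degree P \<le> N \<and> poly (map_poly (\<lambda>p. peval e p x) P) z = 0"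
    using finite_over_bounded_relation[OF emb fin] by metis
  have "\<exists>k::int. unit (f ^ fact N * x powi k)" if f: "f \<noteq> 0" for f
  proof -
    obtain P where P: "P \<noteq> 0" "Polynomial.degree P \<le> N" "poly (map_poly (\<lambda>p. peval e p x) P) f = 0"
      using N by blast
    define J where "J = {i. i \<le> N \<and> Polynomial.coeff P i \<noteq> 0}"
    define t where "t i = peval e (Polynomial.coeff P i) x * f ^ i" for i
    have "\<exists>k u. i \<in> J \<longrightarrow> unit u \<and> peval e (Polynomial.coeff P i) x = x ^ k * u" for i
      using peval_split by (auto simp: J_def)
    then obtain k u where ku: "\<And>i. i \<in> J \<Longrightarrow> unit (u i) \<and> peval e (Polynomial.coeff P i) x = x ^ k i * u i" by metis
    have t0: "t i \<noteq> 0" if "i \<in> J" for i using ku[OF that] unit_nz x(2) f by (auto simp: t_def)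
    have J: "finite J" "J \<noteq> {}"
      using P(1,2) leading_coeff_neq_0[of P] by (auto simp: J_def)
    have "(\<Sum>i\<le>Polynomial.degree P. t i) = 0"
      using P(3) unfolding poly_map_poly_altdef[OF is_ring_hom_peval[OF emb]] t_def .
    moreover have "(\<Sum>i\<in>J. t i) = (\<Sum>i\<le>Polynomial.degree P. t i)"
      using P(2) by (intro sum.mono_neutral_left) (auto simp: J_def t_def intro: le_degree)
    ultimately have sum0: "(\<Sum>i\<in>J. t i) = 0" by simp
    obtain j where j: "j \<in> J" "\<And>i. i \<in> J \<Longrightarrow> t i / t j \<in> R" using maximal_term[OF J, of t] t0 by metis
    have "\<exists>i\<in>J. i \<noteq> j \<and> unit (t i / t j)"
    proof (rule ccontr)
      assume "\<not> ?thesis"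
      then have in_m: "t i / t j \<in> m" if "i \<in> J - {j}" for i using that j(2) by (auto simp: unit_def)
      have "(\<Sum>i\<in>J - {j}. t i / t j) \<in> m"
        by (rule m_sum[OF in_m])
      moreover have "(\<Sum>i\<in>J - {j}. t i / t j) = - 1"
        using sum0 t0[OF j(1)] sum.remove[OF J(1) j(1), of t]
        by (simp add: field_simps eq_neg_iff_add_eq_0 flip: sum_divide_distrib)
      ultimately have "e (- 1) * (- 1) \<in> m" using m_mult[OF const] by metis
      then show False using one(2) by (simp add: field_embedding_uminus[OF emb] field_embedding_1[OF emb])
    qed
    then obtain i where i: "i \<in> J" "i \<noteq> j" "unit (t i / t j)" by blast
    have main: "\<exists>k::int. unit (f ^ fact N * x powi k)"
      if ij: "i \<in> J" "j \<in> J" "j < i" "unit (t i / t j)" for i j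
    proof -
      have u: "unit (u i)" "unit (u j)" using ku ij by auto
      have "t i / t j = f ^ (i - j) * x powi (int (k i) - int (k j)) * (u i * inverse (u j))"
        using ku ij x(2) f unit_nz u by (simp add: t_def power_int_diff power_diff field_simps)
      then have "f ^ (i - j) * x powi (int (k i) - int (k j)) = t i / t j * (u j * inverse (u i))"
        using unit_nz u by (simp add: field_simps)
      then have unit1: "unit (f ^ (i - j) * x powi (int (k i) - int (k j)))"
        using unit_mult[OF ij(4) unit_mult[OF u(2) unit_inv[OF u(1)]]] by simp
      \<comment> \<open>The exponent depends on \<open>f\<close>, but always divides \<open>N!\<close>.\<close>
      have "i - j dvd fact N" using ij by (intro dvd_fact) (auto simp: J_def)
      then obtain q where q: "fact N = (i - j) * q" by blast
      have "f ^ fact N * x powi ((int (k i) - int (k j)) * int q) = (f ^ (i - j) * x powi (int (k i) - int (k j))) ^ q"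
        unfolding q power_mult power_mult_distrib by (simp add: power_int_mult)
      then show ?thesis using unit_power[OF unit1, of q] by metis
    qed
    show ?thesis
    proof (cases "j < i")
      case True
      then show ?thesis using main[OF i(1) j(1)] i(3) by blast
    next
      case False
      then show ?thesis using main[OF j(1) i(1)] i(2) unit_inv[OF i(3)] by simp
    qed
  qed
  then show ?thesis using that[of "fact N"] by simp
qed

lemma unit_x_powi: assumes "unit (x powi k)" shows "k = 0"
proof (rule ccontr)
  have pos: "x powi k \<in> m" if "k > 0" for k :: int
    using m_power[OF x(1), of "nat k"] that by (simp add: power_int_def)
  assume "k \<noteq> 0"
  then consider "k > 0" | "- k > 0" by linarith
  then show False
  proof cases
    case 1
    then show False using pos[of k] assms by (simp add: unit_def)
  next
    case 2
    then show False using pos[OF 2] unit_inv[OF assms] by (simp add: unit_def power_int_minus)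
  qed
qed

text \<open>By \<open>commensurable\<close> the valuation has values in the integers, if \<open>x\<close> has value \<open>D\<close>; dividing by the
  generator of the value group gives the order of vanishing at a closed point.\<close>
theorem discrete_valuation:
  obtains P where "P \<in> places e" "\<And>f. f \<noteq> 0 \<Longrightarrow> 0 < P f \<longleftrightarrow> f \<in> m" "\<And>f. f \<noteq> 0 \<Longrightarrow> 0 \<le> P f \<longleftrightarrow> f \<in> R"
proof -
  obtain D where D: "D > 0" and ex: "\<And>f. f \<noteq> 0 \<Longrightarrow> \<exists>k::int. unit (f ^ D * x powi k)"
    using commensurable by metis
  define \<mu> where "\<mu> f = (if f = 0 then 0 else - (SOME k::int. unit (f ^ D * x powi k)))" for f
  have \<mu>: "unit (f ^ D * x powi (- \<mu> f))" if "f \<noteq> 0" for f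
    using someI_ex[OF ex[OF that]] that by (simp add: \<mu>_def)
  have \<mu>I: "\<mu> f = k" if "f \<noteq> 0" "unit (f ^ D * x powi (- k))" for f k
  proof -
    have "unit ((f ^ D * x powi (- \<mu> f)) * inverse (f ^ D * x powi (- k)))"
      by (intro unit_mult unit_inv \<mu> that)
    moreover have "(f ^ D * x powi (- \<mu> f)) * inverse (f ^ D * x powi (- k)) = x powi (k - \<mu> f)"
      using that(1) x(2) by (simp add: power_int_minus power_int_diff field_simps)
    ultimately show ?thesis using unit_x_powi[of "k - \<mu> f"] by simp
  qed
  have mult: "\<mu> (f * g) = \<mu> f + \<mu> g" if "f \<noteq> 0" "g \<noteq> 0" for f g
  proof (rule \<mu>I)
    have "(f * g) ^ D * x powi (- (\<mu> f + \<mu> g)) = (f ^ D * x powi (- \<mu> f)) * (g ^ D * x powi (- \<mu> g))"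
    proof -
      have "x powi (- (\<mu> f + \<mu> g)) = x powi (- \<mu> f) * x powi (- \<mu> g)"
        using power_int_add[of x "- \<mu> f" "- \<mu> g"] x(2) by simp
      then show ?thesis by (simp add: power_mult_distrib mult_ac)
    qed
    then show "unit ((f * g) ^ D * x powi (- (\<mu> f + \<mu> g)))" using unit_mult[OF \<mu>[OF that(1)] \<mu>[OF that(2)]] by simp
  qed (use that in simp)
  have \<mu>x: "\<mu> x = int D"
    by (rule \<mu>I) (use x one in \<open>auto simp: power_int_minus unit_def\<close>)
  have unit0: "\<mu> f = 0" if "unit f" for f
    using \<mu>I[of f 0] unit_power[OF that] unit_nz[OF that] by simp
  have \<mu>1: "\<mu> 1 = 0" using unit0[of 1] one by (simp add: unit_def)
  have inv: "\<mu> (inverse f) = - \<mu> f" if "f \<noteq> 0" for f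
    using mult[of f "inverse f"] that \<mu>1 by simp
  have m_pos: "0 < \<mu> f" if f: "f \<in> m" "f \<noteq> 0" for f
  proof (rule ccontr)
    assume "\<not> ?thesis"
    then have "x powi (- \<mu> f) \<in> R"
      using R_power[OF subsetD[OF m_sub x(1)], of "nat (- \<mu> f)"] by (simp add: power_int_def)
    then have "x powi (- \<mu> f) * f ^ D \<in> m" using m_power[OF f(1) D] by (rule m_mult)
    then show False using \<mu>[OF f(2)] by (simp add: unit_def mult.commute)
  qed
  have pos_iff: "0 < \<mu> f \<longleftrightarrow> f \<in> m" if f: "f \<noteq> 0" for f
  proof
    assume p: "0 < \<mu> f"
    have "inverse f \<notin> m" using m_pos[of "inverse f"] inv[OF f] p f by auto
    moreover have "\<not> unit f" using unit0 p by fastforce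
    ultimately show "f \<in> m" using trichotomy[OF f] by blast
  qed (use m_pos f in blast)
  have ge_iff: "0 \<le> \<mu> f \<longleftrightarrow> f \<in> R" if f: "f \<noteq> 0" for f
  proof -
    have "0 \<le> \<mu> f \<longleftrightarrow> inverse f \<notin> m" using pos_iff[of "inverse f"] inv[OF f] f by auto
    also have "\<dots> \<longleftrightarrow> f \<in> R" using m_inverse[of "inverse f"] inverse_m[of f] f by auto
    finally show ?thesis .
  qed
  have powi: "\<mu> (g powi q) = q * \<mu> g" if g: "g \<noteq> 0" for g q
  proof -
    have nat: "\<mu> (g ^ n) = int n * \<mu> g" for n
      by (induction n) (use g mult \<mu>1 in \<open>auto simp: algebra_simps\<close>)
    show ?thesis using nat[of "nat q"] nat[of "nat (- q)"] inv[of "g ^ nat (- q)"] g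
      by (auto simp: power_int_def power_inverse)
  qed
  \<comment> \<open>The positive generator of the group of values of \<open>\<mu>\<close>.\<close>
  define d where "d = (LEAST n. n > 0 \<and> (\<exists>g. g \<noteq> 0 \<and> \<mu> g = int n))"
  have "\<exists>n. n > 0 \<and> (\<exists>g. g \<noteq> 0 \<and> \<mu> g = int n)" using \<mu>x x D by blast
  from LeastI_ex[OF this] obtain g0 where d: "d > 0" and g0: "g0 \<noteq> 0" "\<mu> g0 = int d" unfolding d_def by blast
  have dvd: "int d dvd \<mu> f" if f: "f \<noteq> 0" for f
  proof -
    define q where "q = \<mu> f div int d"
    have "\<mu> (f * g0 powi (- q)) = \<mu> f mod int d"
      using mult[OF f, of "g0 powi (- q)"] powi[OF g0(1), of "- q"] g0
      by (simp add: q_def minus_div_mult_eq_mod)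
    moreover have "f * g0 powi (- q) \<noteq> 0" using f g0 by simp
    ultimately have "\<not> (0 < nat (\<mu> f mod int d) \<and> nat (\<mu> f mod int d) < d)"
      using not_less_Least[of "nat (\<mu> f mod int d)" "\<lambda>n. n > 0 \<and> (\<exists>g. g \<noteq> 0 \<and> \<mu> g = int n)"]
      unfolding d_def[symmetric] by (metis nat_0_le pos_mod_sign d of_nat_0_less_iff)
    moreover have "0 \<le> \<mu> f mod int d" "\<mu> f mod int d < int d" using d by simp_all
    ultimately have "\<mu> f mod int d = 0" by linarith
    then show ?thesis by (simp add: dvd_eq_mod_eq_0)
  qed
  define P where "P f = \<mu> f div int d" for f
  have P: "\<mu> f = int d * P f" if "f \<noteq> 0" for f using dvd[OF that] by (simp add: P_def)
  have Ppos: "0 < P f \<longleftrightarrow> f \<in> m" and Pge: "0 \<le> P f \<longleftrightarrow> f \<in> R" if "f \<noteq> 0" for f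
    using pos_iff[OF that] ge_iff[OF that] d unfolding P[OF that] by (auto simp: zero_less_mult_iff zero_le_mult_iff)
  have Pm: "P (f * g) = P f + P g" if "f \<noteq> 0" "g \<noteq> 0" for f g
    using mult[OF that] P[of "f * g"] P[of f] P[of g] that d by (simp flip: distrib_left)
  have Padd: "P f \<le> P (f + g)" if fg: "f \<noteq> 0" "g \<noteq> 0" "f + g \<noteq> 0" "P f \<le> P g" for f g
  proof -
    have Pi: "P (h / f) = P h - P f" if "h \<noteq> 0" for h
      using Pm[of "h / f" f] that fg by simp
    have "g / f \<in> R" using Pge[of "g / f"] Pi[of g] fg by simp
    then have "(f + g) / f \<in> R" using R_add[OF one(1), of "g / f"] fg by (simp add: add_divide_distrib)
    then show ?thesis using Pge[of "(f + g) / f"] Pi[of "f + g"] fg by simp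
  qed
  have "valuation P" unfolding valuation_def
  proof (intro conjI allI impI)
    fix f g :: 'f assume fg: "f \<noteq> 0" "g \<noteq> 0" "f + g \<noteq> 0"
    then show "min (P f) (P g) \<le> P (f + g)"
      using Padd[of f g] Padd[of g f] by (auto simp: min_def add.commute)
  qed (use Pm in \<open>auto simp: P_def \<mu>_def\<close>)
  moreover have "P (e c) = 0" for c
  proof (cases "c = 0")
    case False
    then have "unit (e c)" using const m_const by (simp add: unit_def)
    then show ?thesis by (simp add: P_def unit0)
  qed (simp add: P_def \<mu>_def field_embedding_0[OF emb])
  moreover have "P ` {f. f \<noteq> 0} = UNIV"
  proof -
    have "P (g0 powi q) = q" for q using powi[OF g0(1), of q] g0 d by (simp add: P_def)
    moreover have "g0 powi q \<noteq> 0" for q using g0 by simp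
    ultimately show ?thesis by (metis (mono_tags, lifting) UNIV_eq_I imageI mem_Collect_eq)
  qed
  ultimately have "P \<in> places e" by (simp add: places_def)
  then show ?thesis using that[of P] Ppos Pge by blast
qed

end

section \<open>Compactness of the analytification\<close>

text \<open>The residue field at a closed point is \<open>K\<close>. If \<open>f\<close> had no value in \<open>K\<close>, then \<open>P\<close> would be trivial on
  \<open>K(f)\<close>. A function \<open>u\<close> with \<open>P u = 1\<close> is algebraic over \<open>K(f)\<close>, but the terms of its relation
  would have distinct orders.\<close>
lemma place_value_exists:
  fixes e :: "'k::alg_closed_field \<Rightarrow> 'f::field"
  assumes ff: "function_field e" and P: "P \<in> places e" and f: "val_ge P f 0"
  shows "\<exists>c. val_gt P (f - e c) 0"
proof (rule ccontr)
  assume contra: "\<not> ?thesis"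
  have emb: "field_embedding e" using ff by (simp add: function_field_def)
  have vP: "valuation P" and Pc: "\<And>c. P (e c) = 0" using P by (auto simp: places_def)
  have "1 \<in> P ` {f. f \<noteq> 0}" using P by (auto simp: places_def)
  then obtain u where u: "u \<noteq> 0" "P u = 1" by auto
  have lin: "f - e c \<noteq> 0" "P (f - e c) = 0" for c
  proof -
    have "val_ge P (f - e c) 0" by (intro val_ge_diff[OF vP f]) (simp add: val_ge_def Pc)
    moreover have "\<not> val_gt P (f - e c) 0" using contra by blast
    ultimately show "f - e c \<noteq> 0" "P (f - e c) = 0" by (auto simp: val_ge_def val_gt_def not_less)
  qed
  have pev: "peval e p f \<noteq> 0 \<and> P (peval e p f) = 0" if "p \<noteq> 0" for p
    using that
  proof (induction "Polynomial.degree p" arbitrary: p)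
    case 0
    then obtain c where "p = [:c:]" "c \<noteq> 0" by (metis degree_eq_zeroE pCons_0_0)
    then show ?case by (simp add: peval_pCons[OF emb] field_embedding_eq_0[OF emb] Pc)
  next
    case (Suc n)
    then obtain c where "poly p c = 0" using alg_closed_imp_poly_has_root[of p] by auto
    then obtain q where pq: "p = [:- c, 1:] * q" by (auto simp: poly_eq_0_iff_dvd)
    then have q: "q \<noteq> 0" using Suc.prems by auto
    have "Polynomial.degree p = Suc (Polynomial.degree q)"
      unfolding pq by (subst degree_mult_eq) (use q in auto)
    then have "peval e q f \<noteq> 0 \<and> P (peval e q f) = 0" using Suc.hyps q by auto
    moreover have "peval e p f = (f - e c) * peval e q f"
      unfolding pq peval_mult[OF emb] by (simp add: peval_pCons[OF emb] field_embedding_uminus[OF emb] field_embedding_1[OF emb])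
    ultimately show ?case using lin[of c] by (simp add: valuation_mult[OF vP])
  qed
  obtain x0 where x0: "finite_over e x0" by (rule function_field_finite_over[OF ff])
  have "transcendental_over e f" using pev by (simp add: transcendental_over_def)
  then have "finite_over e f" by (rule finite_over_exchange[OF emb x0])
  then obtain Q where Q: "Q \<noteq> 0" "poly (map_poly (\<lambda>p. peval e p f) Q) u = 0"
    using finite_over_relation[OF emb] by blast
  define t where "t i = peval e (Polynomial.coeff Q i) f * u ^ i" for i
  have Pu: "P (u ^ i) = int i" for i
    by (induction i) (use u in \<open>auto simp: valuation_one[OF vP] valuation_mult[OF vP]\<close>)
  have Pt: "P (t i) = int i" if "t i \<noteq> 0" for i
  proof -
    have "Polynomial.coeff Q i \<noteq> 0" using that by (auto simp: t_def)
    then show ?thesis using pev u Pu by (simp add: t_def valuation_mult[OF vP])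
  qed
  have 1: "sum t {..Polynomial.degree Q} = 0"
    using Q(2) unfolding poly_map_poly_altdef[OF is_ring_hom_peval[OF emb]] t_def .
  have 2: "Polynomial.degree Q \<in> {..Polynomial.degree Q}" by simp
  have 3: "t (Polynomial.degree Q) \<noteq> 0" using Q(1) pev u by (simp add: t_def)
  show False
  proof (rule valuation_sum_eq_0[OF vP finite_atMost 1 2 3])
    fix i j assume "i \<noteq> j" "t i \<noteq> 0" "t j \<noteq> 0" "P (t i) = P (t j)"
    then show False using Pt[of i] Pt[of j] by simp
  qed
qed

lemma val_abs_nonneg [simp]: "0 \<le> val_abs w f" by (simp add: val_abs_def)

lemma val_abs_mult: "valuation w \<Longrightarrow> val_abs w (f * g) = val_abs w f * val_abs w g"
  by (auto simp: val_abs_def valuation_mult simp flip: exp_add)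

lemma val_abs_add: assumes "valuation w" shows "val_abs w (f + g) \<le> max (val_abs w f) (val_abs w g)"
proof (cases "f = 0 \<or> g = 0 \<or> f + g = 0")
  case False
  then have "min (w f) (w g) \<le> w (f + g)" using assms by (auto simp: valuation_def)
  then show ?thesis using False by (auto simp: val_abs_def min_def max_def split: if_splits)
qed (auto simp: val_abs_def le_max_iff_disj)

lemma val_abs_inverse: "valuation w \<Longrightarrow> f \<noteq> 0 \<Longrightarrow> val_abs w (inverse f) = inverse (val_abs w f)"
  by (simp add: val_abs_def valuation_inverse exp_minus)

lemma val_abs_pos: "f \<noteq> 0 \<Longrightarrow> 0 < val_abs w f" by (simp add: val_abs_def)

text \<open>Extended absolute values unify the two kinds of points: at a closed point the functions with a pole have
  absolute value \<open>\<infinity>\<close> and the functions with a zero have absolute value \<open>0\<close>. The conditions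
  pass to pointwise limits (\<open>absolute_value_limit\<close>). The maximum is written \<open>Orderings.top\<close> because the short
  name also denotes the greatest element of an order structure.\<close>
definition absolute_value :: "('k::field \<Rightarrow> real) \<Rightarrow> ('k \<Rightarrow> 'f::field) \<Rightarrow> ('f \<Rightarrow> ennreal) \<Rightarrow> bool" where
  "absolute_value v e A \<longleftrightarrow> (\<forall>c. A (e c) = ennreal (val_abs v c)) \<and>
     (\<forall>f g. A f < Orderings.top \<longrightarrow> A g < Orderings.top \<longrightarrow> A (f + g) \<le> max (A f) (A g) \<and> A (f * g) = A f * A g) \<and>
     (\<forall>f. f \<noteq> 0 \<longrightarrow> A (inverse f) = inverse (A f))"

definition point_abs :: "('k::field \<Rightarrow> real) \<Rightarrow> ('k \<Rightarrow> 'f::field) \<Rightarrow> 'f an_point \<Rightarrow> 'f \<Rightarrow> ennreal" where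
  "point_abs v e x f = (if regular_at x f then ennreal (pt_abs v e x f) else Orderings.top)"

lemma pt_abs_Closed:
  assumes emb: "field_embedding e" and P: "P \<in> places e" and c: "val_gt P (f - e c) 0"
  shows "pt_abs v e (Closed P) f = val_abs v c"
proof -
  have vP: "valuation P" and Pc: "\<And>c. P (e c) = 0" using P by (auto simp: places_def)
  have "(THE d. val_gt P (f - e d) 0) = c"
  proof (rule the_equality[of "\<lambda>d. val_gt P (f - e d) 0", OF c])
    fix d assume "val_gt P (f - e d) 0"
    from val_gt_diff[OF vP this c] have "val_gt P (e (c - d)) 0" by (simp add: field_embedding_diff[OF emb])
    then show "d = c" by (simp add: val_gt_def Pc field_embedding_eq_0[OF emb])
  qed
  then show ?thesis by simp
qed

lemma absolute_value_point:
  fixes e :: "'k::alg_closed_field \<Rightarrow> 'f::field"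
  assumes ff: "function_field e" and v: "valuation v" and x: "x \<in> an_points v e"
  shows "absolute_value v e (point_abs v e x)"
proof -
  have emb: "field_embedding e" using ff by (simp add: function_field_def)
  show ?thesis
  proof (cases x)
    case (Val w)
    then have w: "valuation w" "\<And>c. w (e c) = v c" using x by (auto simp: an_points_def)
    have c: "val_abs w (e c) = val_abs v c" for c by (simp add: val_abs_def w field_embedding_eq_0[OF emb])
    have add: "ennreal (val_abs w (f + g)) \<le> max (ennreal (val_abs w f)) (ennreal (val_abs w g))" for f g
      using val_abs_add[OF w(1), of f g] by (auto simp: max_def ennreal_leI split: if_splits)
    show ?thesis unfolding absolute_value_def point_abs_def Val
      using add by (auto simp: c val_abs_mult[OF w(1)] ennreal_mult val_abs_inverse[OF w(1)]
        inverse_ennreal val_abs_pos)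
  next
    case (Closed P)
    then have P: "P \<in> places e" using x by (auto simp: an_points_def)
    have vP: "valuation P" and Pc: "\<And>c. P (e c) = 0" using P by (auto simp: places_def)
    have ge_c: "val_ge P (e c) 0" for c by (simp add: val_ge_def Pc)
    let ?A = "point_abs v e x"
    have A: "?A f = ennreal (val_abs v c)" if "val_gt P (f - e c) 0" for f c
    proof -
      have "val_ge P ((f - e c) + e c) 0" by (intro val_ge_add[OF vP] val_gt_imp_ge[OF that] ge_c)
      then show ?thesis using pt_abs_Closed[OF emb P that, of v] by (simp add: point_abs_def Closed)
    qed
    have val: "\<exists>c. val_gt P (f - e c) 0" if "?A f < Orderings.top" for f
      using that place_value_exists[OF ff P, of f] by (auto simp: point_abs_def Closed split: if_splits)
    show ?thesis unfolding absolute_value_def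
    proof (intro conjI allI impI)
      show "?A (e c) = ennreal (val_abs v c)" for c by (rule A) simp
    next
      fix f g assume "?A f < Orderings.top" "?A g < Orderings.top"
      then obtain c d where cd: "val_gt P (f - e c) 0" "val_gt P (g - e d) 0" using val by meson
      have "val_gt P ((f - e c) + (g - e d)) 0" by (rule val_gt_add[OF vP cd])
      then have "val_gt P (f + g - e (c + d)) 0" by (simp add: field_embedding_add[OF emb] algebra_simps)
      then show "?A (f + g) \<le> max (?A f) (?A g)"
        using val_abs_add[OF v, of c d] unfolding A[OF cd(1)] A[OF cd(2)]
        by (subst A) (auto simp: max_def ennreal_leI split: if_splits)
      have "val_ge P ((f - e c) + e c) 0" by (intro val_ge_add[OF vP] val_gt_imp_ge[OF cd(1)] ge_c)
      then have fge: "val_ge P f 0" by simp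
      have "val_gt P ((g - e d) * f + (f - e c) * e d) (0 + 0)"
        using val_gt_mult_left[OF vP cd(2) fge] val_gt_mult_left[OF vP cd(1) ge_c] by (intro val_gt_add[OF vP]) auto
      then have "val_gt P (f * g - e (c * d)) 0" by (simp add: field_embedding_mult[OF emb] algebra_simps)
      then show "?A (f * g) = ?A f * ?A g"
        unfolding A[OF cd(1)] A[OF cd(2)] by (subst A) (auto simp: val_abs_mult[OF v] ennreal_mult)
    next
      fix f :: 'f assume f: "f \<noteq> 0"
      have pos: "?A g = 0" if "P g > 0" for g
        using A[of g 0] that by (simp add: field_embedding_0[OF emb] val_gt_def val_abs_def)
      have neg: "?A g = Orderings.top" if "P g < 0" "g \<noteq> 0" for g
        using that by (simp add: point_abs_def Closed val_ge_def)
      consider "P f > 0" | "P f < 0" | "P f = 0" by linarith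
      then show "?A (inverse f) = inverse (?A f)"
      proof cases
        case 1
        then show ?thesis using pos[of f] neg[of "inverse f"] f by (simp add: valuation_inverse[OF vP])
      next
        case 2
        then show ?thesis using neg[of f] pos[of "inverse f"] f by (simp add: valuation_inverse[OF vP])
      next
        case 3
        then have "val_ge P f 0" by (simp add: val_ge_def)
        then obtain c where c: "val_gt P (f - e c) 0" using place_value_exists[OF ff P] by blast
        have c0: "c \<noteq> 0" using c 3 f by (auto simp: field_embedding_0[OF emb] val_gt_def)
        have ec: "e c \<noteq> 0" using c0 by (simp add: field_embedding_eq_0[OF emb])
        have "inverse f - e (inverse c) = (f - e c) * (- inverse (f * e c))"
          unfolding field_embedding_inverse[OF emb] using f ec by (simp add: field_simps)
        moreover have "val_ge P (- inverse (f * e c)) 0"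
          using f ec 3 by (simp add: vP val_ge_def valuation_uminus[OF vP] valuation_inverse[OF vP] valuation_mult[OF vP] Pc)
        ultimately have "val_gt P (inverse f - e (inverse c)) 0"
          using val_gt_mult_left[OF vP c, of "- inverse (f * e c)" 0] by simp
        then show ?thesis unfolding A[OF c] using c0
          by (subst A) (auto simp: val_abs_inverse[OF v] inverse_ennreal val_abs_pos)
      qed
    qed
  qed
qed

lemma absolute_value_limit:
  fixes B :: "'f::field \<Rightarrow> ennreal"
  assumes A: "\<And>n. absolute_value v e (A n)" and F: "F \<noteq> bot" and lim: "\<And>f. ((\<lambda>n. A n f) \<longlongrightarrow> B f) F"
  shows "absolute_value v e B"
  unfolding absolute_value_def
proof (intro conjI allI impI)
  fix c
  have "((\<lambda>n. A n (e c)) \<longlongrightarrow> ennreal (val_abs v c)) F"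
    using A by (simp add: absolute_value_def)
  then show "B (e c) = ennreal (val_abs v c)" using tendsto_unique[OF F lim] by blast
next
  fix f g assume fin: "B f < Orderings.top" "B g < Orderings.top"
  have ev: "\<forall>\<^sub>F n in F. A n f < Orderings.top \<and> A n g < Orderings.top"
    using order_tendstoD(2)[OF lim fin(1)] order_tendstoD(2)[OF lim fin(2)] by (rule eventually_conj)
  show "B (f + g) \<le> max (B f) (B g)"
  proof (rule tendsto_le[OF F tendsto_max[OF lim lim] lim])
    show "\<forall>\<^sub>F n in F. A n (f + g) \<le> max (A n f) (A n g)"
      using ev by eventually_elim (use A in \<open>simp add: absolute_value_def\<close>)
  qed
  have real: "((\<lambda>n. enn2real (A n f)) \<longlongrightarrow> enn2real (B f)) F" if "B f < Orderings.top" for f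
    using lim[of f] that by (intro tendsto_enn2real) (auto simp: ennreal_enn2real_if)
  have "((\<lambda>n. ennreal (enn2real (A n f) * enn2real (A n g))) \<longlongrightarrow> ennreal (enn2real (B f) * enn2real (B g))) F"
    by (intro tendsto_ennrealI tendsto_mult real fin)
  moreover have "\<forall>\<^sub>F n in F. ennreal (enn2real (A n f) * enn2real (A n g)) = A n (f * g)"
    using ev by eventually_elim (use A in \<open>auto simp: absolute_value_def ennreal_mult ennreal_enn2real_if\<close>)
  ultimately have "((\<lambda>n. A n (f * g)) \<longlongrightarrow> ennreal (enn2real (B f) * enn2real (B g))) F"
    by (rule Lim_transform_eventually)
  then have "B (f * g) = ennreal (enn2real (B f) * enn2real (B g))" using tendsto_unique[OF F lim] by blast
  then show "B (f * g) = B f * B g" by (simp add: ennreal_mult ennreal_enn2real[OF fin(1)] ennreal_enn2real[OF fin(2)])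
next
  fix f :: 'f assume f: "f \<noteq> 0"
  have "continuous_on UNIV (\<lambda>x::ennreal. inverse x)" by (intro continuous_intros)
  then have "((\<lambda>n. inverse (A n f)) \<longlongrightarrow> inverse (B f)) F"
    by (rule continuous_on_tendsto_compose[OF _ lim]) auto
  moreover have "inverse (A n f) = A n (inverse f)" for n using A[of n] f by (simp add: absolute_value_def)
  ultimately have "((\<lambda>n. A n (inverse f)) \<longlongrightarrow> inverse (B f)) F" by simp
  then show "B (inverse f) = inverse (B f)" using tendsto_unique[OF F lim] by blast
qed

text \<open>If \<open>B\<close> is finite and positive on nonzero functions, it comes from a valuation. Otherwise the
  functions with finite \<open>B\<close> form a valuation ring with a nontrivial maximal ideal, which is the local ring of a
  closed point; on it \<open>B\<close> is the absolute value of the value in \<open>K\<close>.\<close>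
lemma absolute_value_is_point:
  fixes e :: "'k::alg_closed_field \<Rightarrow> 'f::field"
  assumes ff: "function_field e" and v: "valuation v" and B: "absolute_value v e B"
  shows "\<exists>x\<in>an_points v e. \<forall>f. regular_at x f \<longrightarrow> B f = ennreal (pt_abs v e x f)"
proof -
  have emb: "field_embedding e" using ff by (simp add: function_field_def)
  have Bconst: "B (e c) = ennreal (val_abs v c)" for c using B by (simp add: absolute_value_def)
  have add: "B (f + g) \<le> max (B f) (B g)" and mult: "B (f * g) = B f * B g" if "B f < Orderings.top" "B g < Orderings.top" for f g
    using B that by (auto simp: absolute_value_def)
  have inv: "B (inverse f) = inverse (B f)" if "f \<noteq> 0" for f using B that by (simp add: absolute_value_def)
  have B0: "B 0 = 0" using Bconst[of 0] by (simp add: field_embedding_0[OF emb] val_abs_def)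
  show ?thesis
  proof (cases "\<forall>f. f \<noteq> 0 \<longrightarrow> B f \<noteq> 0 \<and> B f \<noteq> Orderings.top")
    case True
    define w where "w f = (if f = 0 then 0 else - ln (enn2real (B f)))" for f
    have fin: "B f < Orderings.top" for f using True B0 by (cases "f = 0") (auto simp: less_top)
    have pos: "0 < enn2real (B f)" if "f \<noteq> 0" for f
      using True that fin[of f] by (simp add: enn2real_positive_iff zero_less_iff_neq_zero)
    have abs: "val_abs w f = enn2real (B f)" for f
      using pos[of f] B0 by (simp add: val_abs_def w_def)
    have "valuation w" unfolding valuation_def
    proof (intro conjI allI impI)
      fix f g :: 'f assume "f \<noteq> 0" "g \<noteq> 0"
      then show "w (f * g) = w f + w g" using pos[of f] pos[of g]
        by (simp add: w_def mult[OF fin fin] enn2real_mult ln_mult)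
    next
      fix f g :: 'f assume fg: "f \<noteq> 0" "g \<noteq> 0" "f + g \<noteq> 0"
      have "enn2real (B (f + g)) \<le> enn2real (max (B f) (B g))"
        by (rule enn2real_mono[OF add[OF fin fin]]) (simp add: fin)
      then have "enn2real (B (f + g)) \<le> enn2real (B f) \<or> enn2real (B (f + g)) \<le> enn2real (B g)"
        by (auto simp: max_def split: if_splits)
      then show "min (w f) (w g) \<le> w (f + g)"
        using fg pos[of f] pos[of g] pos[of "f + g"] by (auto simp: w_def min_le_iff_disj)
    qed (simp add: w_def)
    moreover have "w (e c) = v c" for c
    proof (cases "c = 0")
      case False
      then show ?thesis using val_abs_pos[of c v]
        by (simp add: w_def Bconst field_embedding_eq_0[OF emb]) (simp add: val_abs_def)
    qed (use v in \<open>simp add: w_def field_embedding_0[OF emb] valuation_def\<close>)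
    ultimately have "Val w \<in> an_points v e" by (auto simp: an_points_def)
    moreover have "B f = ennreal (pt_abs v e (Val w) f)" for f
      using fin[of f] by (simp add: abs ennreal_enn2real_if less_top)
    ultimately show ?thesis by blast
  next
    case False
    then obtain f0 where f0: "f0 \<noteq> 0" "B f0 = 0 \<or> B f0 = Orderings.top" by blast
    obtain y where y: "y \<noteq> 0" "B y = 0"
      using f0 inv[OF f0(1)] that[of f0] that[of "inverse f0"] by auto
    have tr: "transcendental_over e y"
    proof (rule ccontr)
      assume "\<not> ?thesis"
      then obtain c where c: "y = e c" by (rule algebraic_over_closed_field[OF emb])
      then have "c \<noteq> 0" using y(1) by (auto simp: field_embedding_0[OF emb])
      then show False using y(2) val_abs_pos[of c v] by (simp add: c Bconst)
    qed
    obtain x0 where x0: "finite_over e x0" by (rule function_field_finite_over[OF ff])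
    have fin: "finite_over e y" by (rule finite_over_exchange[OF emb x0 tr])
    interpret function_field_valuation_ring e "{f. B f < Orderings.top}" "{f. B f = 0}" y
    proof (unfold_locales, goal_cases)
      case (2 f g) then show ?case using add[of f g] by (auto simp: le_less_trans)
    next
      case (3 f g) then show ?case using mult[of f g] by (auto simp: ennreal_mult_less_top)
    next
      case (6 f g) then show ?case using add[of f g] by auto
    next
      case (7 f g) then show ?case using mult[of f g] by auto
    next
      case (8 c) then show ?case using val_abs_pos[of c v] by (cases "c = 0") (auto simp: Bconst val_abs_def)
    next
      case (9 f)
      then have "f \<noteq> 0" using B0 by auto
      have "inverse (B f) < Orderings.top"
        using 9 by (cases "B f" rule: ennreal_cases) (auto simp: inverse_ennreal)
      then show ?case using inv[OF \<open>f \<noteq> 0\<close>] by simp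
    next
      case (10 f)
      then show ?case using inv[of f] B0 by (cases "f = 0") (auto simp: less_top[symmetric])
    qed (use emb Bconst y fin in auto)
    obtain P where P: "P \<in> places e" "\<And>f. f \<noteq> 0 \<Longrightarrow> 0 < P f \<longleftrightarrow> B f = 0"
      "\<And>f. f \<noteq> 0 \<Longrightarrow> 0 \<le> P f \<longleftrightarrow> B f < Orderings.top" using discrete_valuation by auto
    have "B f = ennreal (pt_abs v e (Closed P) f)" if reg: "val_ge P f 0" for f
    proof -
      obtain c where c: "val_gt P (f - e c) 0" using place_value_exists[OF ff P(1) reg] by blast
      then have z: "B (f - e c) = 0" using P(2)[of "f - e c"] B0 by (cases "f - e c = 0") (auto simp: val_gt_def)
      have ft: "B f < Orderings.top" using reg P(3)[of f] B0 by (cases "f = 0") (auto simp: val_ge_def)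
      have Bconst_top: "B (e d) < Orderings.top" for d by (simp add: Bconst)
      note ct = Bconst_top[of c]
      have "B (e c - f) = 0"
        using mult[OF Bconst_top[of "- 1"], of "f - e c"] z by (simp add: Bconst field_embedding_uminus[OF emb] field_embedding_1[OF emb])
      then have "B (e c) \<le> B f" using add[of "e c - f" f] ft by simp
      moreover have "B f \<le> B (e c)" using add[of "f - e c" "e c"] z ct by simp
      ultimately show ?thesis unfolding pt_abs_Closed[OF emb P(1) c] by (simp add: Bconst)
    qed
    moreover have "Closed P \<in> an_points v e" using P(1) by (simp add: an_points_def)
    ultimately show ?thesis by (intro bexI[of _ "Closed P"]) auto
  qed
qed

text \<open>By the theorem of Tychonoff the functions to the compact space \<open>[0, \<infinity>]\<close> form a compact space. The cluster
  point is expressed by a filter finer than \<open>sequentially\<close>, since the function space need not be first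
  countable and subsequences need not converge.\<close>
lemma pointwise_cluster:
  fixes A :: "nat \<Rightarrow> 'f \<Rightarrow> ennreal"
  obtains B F where "F \<noteq> bot" "F \<le> sequentially" "\<And>f. ((\<lambda>n. A n f) \<longlongrightarrow> B f) F"
proof -
  have "compact_space (euclidean :: ennreal topology)"
    using compact_UNIV[where 'a = ennreal] by (simp add: compact_space_def)
  then have "compact_space (product_topology (\<lambda>_::'f. euclidean :: ennreal topology) UNIV)"
    by (simp add: compact_space_product_topology)
  then have "compact (UNIV :: ('f \<Rightarrow> ennreal) set)"
    unfolding euclidean_product_topology by (simp add: compact_space_def)
  moreover have "filtermap A sequentially \<noteq> bot" by (simp add: filtermap_bot_iff)
  ultimately obtain B where B: "inf (nhds B) (filtermap A sequentially) \<noteq> bot"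
    unfolding compact_filter by auto
  define F where "F = inf sequentially (filtercomap A (nhds B))"
  have "F \<noteq> bot"
  proof
    assume "F = bot"
    then have "eventually (\<lambda>_. False) F" by simp
    then obtain P Q where PQ: "eventually P sequentially" "eventually Q (filtercomap A (nhds B))" "\<And>n. \<not> (P n \<and> Q n)"
      unfolding F_def eventually_inf by blast
    obtain U where U: "eventually U (nhds B)" "\<And>n. U (A n) \<Longrightarrow> Q n"
      using PQ(2) unfolding eventually_filtercomap by blast
    have "eventually (\<lambda>b. \<not> U b) (filtermap A sequentially)"
      unfolding eventually_filtermap using PQ(1) by eventually_elim (use PQ(3) U(2) in blast)
    then have "eventually (\<lambda>_. False) (inf (nhds B) (filtermap A sequentially))"
      unfolding eventually_inf using U(1) by blast
    then show False using B by (simp add: trivial_limit_def)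
  qed
  moreover have "F \<le> sequentially" by (simp add: F_def)
  moreover have "((\<lambda>n. A n f) \<longlongrightarrow> B f) F" for f
  proof -
    have "filterlim A (nhds B) F"
      unfolding F_def by (rule filterlim_mono[OF filterlim_filtercomap]) auto
    then show ?thesis
      by (rule continuous_on_tendsto_compose[OF continuous_on_product_coordinates[of f]]) auto
  qed
  ultimately show ?thesis by (rule that)
qed

text \<open>If \<open>u\<close> vanishes at \<open>P\<close>, a place with \<open>u = 1\<close> differs from \<open>P\<close>. It exists because
  \<open>K[u] \<rightarrow> K\<close>, \<open>u \<mapsto> 1\<close>, extends to a valuation ring.\<close>
lemma another_place:
  fixes e :: "'k::alg_closed_field \<Rightarrow> 'f::field"
  assumes ff: "function_field e" and P: "P \<in> places e"
  shows "\<exists>Q\<in>places e. Q \<noteq> P"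
proof -
  have emb: "field_embedding e" using ff by (simp add: function_field_def)
  have vP: "valuation P" and Pc: "\<And>c. P (e c) = 0" using P by (auto simp: places_def)
  have "1 \<in> P ` {f. f \<noteq> 0}" using P by (auto simp: places_def)
  then obtain u where u: "u \<noteq> 0" "P u = 1" by auto
  have tr: "transcendental_over e u"
  proof (rule ccontr)
    assume "\<not> ?thesis"
    then obtain c where c: "u = e c" by (rule algebraic_over_closed_field[OF emb])
    then show False using u Pc by simp
  qed
  define x where "x = u - 1"
  define G0 where "G0 = {(peval e p u, poly p 1) | p. True}"
  have "place_graph e G0" unfolding place_graph_def
  proof (intro conjI allI impI)
    fix c show "(e c, c) \<in> G0" unfolding G0_def by (intro CollectI exI[of _ "[:c:]"]) (simp add: peval_pCons[OF emb])
  next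
    fix f c g d assume "(f, c) \<in> G0" "(g, d) \<in> G0"
    then obtain p q where *: "f = peval e p u" "c = poly p 1" "g = peval e q u" "d = poly q 1" by (auto simp: G0_def)
    show "(f + g, c + d) \<in> G0" unfolding G0_def *
      by (intro CollectI exI[of _ "p + q"]) (simp add: peval_add[OF emb])
    show "(f * g, c * d) \<in> G0" unfolding G0_def *
      by (intro CollectI exI[of _ "p * q"]) (simp add: peval_mult[OF emb])
  next
    fix c assume "(0, c) \<in> G0"
    then obtain p where "peval e p u = 0" "c = poly p 1" by (auto simp: G0_def)
    then show "c = 0" using tr by (cases "p = 0") (auto simp: transcendental_over_def)
  qed
  then obtain G where G: "G0 \<subseteq> G" "maximal_place e G" by (rule place_graph_maximal_extension[OF emb])
  interpret G: maximal_place e G by (rule G(2))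
  have "(peval e [:- 1, 1:] u, poly [:- 1, 1:] 1) \<in> G0" unfolding G0_def by blast
  then have xm: "(x, 0) \<in> G"
    using G(1) by (auto simp: peval_pCons[OF emb] field_embedding_uminus[OF emb] field_embedding_1[OF emb] x_def)
  have x0: "x \<noteq> 0" using Pc[of 1] u by (auto simp: x_def field_embedding_1[OF emb])
  have trx: "transcendental_over e x"
  proof (rule ccontr)
    assume "\<not> ?thesis"
    then obtain c where c: "x = e c" by (rule algebraic_over_closed_field[OF emb])
    then have "u = e (c + 1)" by (simp add: x_def field_embedding_add[OF emb] field_embedding_1[OF emb] algebra_simps)
    then show False using u Pc by simp
  qed
  obtain y0 where y0: "finite_over e y0" by (rule function_field_finite_over[OF ff])
  have fin: "finite_over e x" by (rule finite_over_exchange[OF emb y0 trx])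
  interpret function_field_valuation_ring e "{f. \<exists>c. (f, c) \<in> G}" "{f. (f, 0) \<in> G}" x
  proof (unfold_locales, goal_cases)
    case (6 f g) then show ?case using G.add[of f 0 g 0] by simp
  next
    case (7 f g) then show ?case using G.mult[of f _ g 0] by auto
  next
    case (8 c) then show ?case using G.const[of c] G.unique[of "e c" c 0] by auto
  next
    case (9 f) then show ?case using G.inverse_in by auto
  next
    case (10 f)
    then have "f \<noteq> 0" using G.zero by auto
    then obtain c where c: "(inverse f, c) \<in> G" using G.valuation_ring 10 by blast
    then show ?case using G.inverse_in[OF c] 10 by (cases "c = 0") auto
  qed (use emb G.add G.mult G.const xm x0 fin in blast)+
  obtain Q where Q: "Q \<in> places e" "\<And>f. f \<noteq> 0 \<Longrightarrow> 0 < Q f \<longleftrightarrow> (f, 0) \<in> G"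
    using discrete_valuation by (metis mem_Collect_eq)
  have "Q x > 0" using Q(2)[OF x0] xm by simp
  moreover have "P x = 0"
  proof -
    have "P (- 1 + u) = P (- 1)"
      by (rule valuation_add_dominant(2)[OF vP]) (use u valuation_one[OF vP] in \<open>auto simp: valuation_uminus[OF vP] val_gt_def\<close>)
    then show ?thesis by (simp add: x_def valuation_uminus[OF vP] valuation_one[OF vP])
  qed
  ultimately show ?thesis using Q(1) by (intro bexI[of _ Q]) auto
qed

text \<open>Pointwise convergence of absolute values is convergence in the analytification, provided that the \<open>y n\<close> avoid
  each finite set of closed points from some index on, which holds as they are distinct.\<close>
lemma convergent_in_analytification:
  assumes B: "\<And>f. regular_at x f \<Longrightarrow> B f = ennreal (pt_abs v e x f)"
    and lim: "\<And>f. ((\<lambda>n. point_abs v e (y n) f) \<longlongrightarrow> B f) F"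
    and y: "\<And>n. y n \<in> an_points v e" and distinct: "inj y" and F: "F \<le> sequentially"
    and W: "openin (an_topology v e) W" "x \<in> W"
  shows "\<forall>\<^sub>F n in F. y n \<in> W"
proof -
  have "generate_topology_on {{x \<in> an_points v e - Closed ` S. \<alpha> < pt_abs v e x f \<and> pt_abs v e x f < \<beta>} | S f \<alpha> \<beta>.
        finite S \<and> S \<noteq> {} \<and> S \<subseteq> places e \<and> (\<forall>P\<in>places e - S. val_ge P f 0)} W"
    using W(1) by (simp add: an_topology_def openin_topology_generated_by_iff)
  then show ?thesis using W(2)
  proof (induction rule: generate_topology_on.induct)
    case (Int a b)
    then show ?case by (simp add: eventually_conj)
  next
    case (UN K)
    then obtain k where k: "k \<in> K" "x \<in> k" by blast
    then have "\<forall>\<^sub>F n in F. y n \<in> k" using UN by blast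
    then show ?case by eventually_elim (use k in blast)
  next
    case (Basis U)
    then obtain S f \<alpha> \<beta> where U: "U = {x \<in> an_points v e - Closed ` S. \<alpha> < pt_abs v e x f \<and> pt_abs v e x f < \<beta>}"
      and S: "finite S" "S \<subseteq> places e" "\<forall>P\<in>places e - S. val_ge P f 0" by blast
    have reg: "regular_at z f" if "z \<in> an_points v e - Closed ` S" for z
      using that S(3) by (cases z) (auto simp: an_points_def)
    have "x \<in> an_points v e - Closed ` S" using Basis.prems U by blast
    then have Bf: "B f = ennreal (pt_abs v e x f)" using reg B by blast
    have nn: "0 \<le> pt_abs v e z f" for z by (cases z) auto
    have "((\<lambda>n. enn2real (point_abs v e (y n) f)) \<longlongrightarrow> pt_abs v e x f) F"
      using lim[of f] by (intro tendsto_enn2real nn) (simp add: Bf)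
    then have "\<forall>\<^sub>F n in F. \<alpha> < enn2real (point_abs v e (y n) f)" "\<forall>\<^sub>F n in F. enn2real (point_abs v e (y n) f) < \<beta>"
      using Basis.prems U by (auto intro: order_tendstoD)
    moreover have "\<forall>\<^sub>F n in F. y n \<notin> Closed ` S"
    proof -
      have "finite (y -` (Closed ` S))" using S(1) distinct by (intro finite_vimageI) auto
      then have "\<forall>\<^sub>F n in sequentially. y n \<notin> Closed ` S"
        by (simp add: cofinite_eq_sequentially[symmetric] eventually_cofinite vimage_def)
      then show ?thesis using F by (rule filter_leD[rotated])
    qed
    ultimately show ?case
    proof eventually_elim
      case (elim n)
      then have "y n \<in> an_points v e - Closed ` S" using y by blast
      then show ?case using elim reg[of "y n"] nn by (simp add: U point_abs_def)
    qed
  qed simp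
qed

text \<open>If \<open>V\<close> is empty, the components of the analytification are open and infinite in number. A cluster point
  of a sequence of points from distinct components lies in one of them, which would then contain
  infinitely many terms of the sequence.\<close>
theorem semistable_vertex_set_nonempty:
  fixes v :: "'k::alg_closed_field \<Rightarrow> real" and e :: "'k \<Rightarrow> 'f::field"
  assumes curve: "analytic_curve v e" and V: "semistable_vertex_set v e V"
  shows "V \<noteq> {}"
proof
  assume empty: "V = {}"
  have v: "valuation v" and ff: "function_field e" using curve by (auto simp: analytic_curve_def)
  have emb: "field_embedding e" using ff by (simp add: function_field_def)
  let ?T = "subtopology (an_topology v e) (an_points v e)"
  define \<C> where "\<C> = connected_components_of ?T"
  have comp: "vertex_complement_components v e V = \<C>"
    by (simp add: vertex_complement_components_def empty \<C>_def)
  have op: "openin (an_topology v e) C" if "C \<in> \<C>" for C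
    using V that unfolding semistable_vertex_set_def comp open_disk_def open_annulus_def annulus_chart_def analytic_iso_def
    by blast
  have "infinite {C \<in> \<C>. open_disk v e C}" using V by (simp add: semistable_vertex_set_def comp)
  then have "infinite \<C>" by (rule contrapos_nn) (auto intro: finite_subset[rotated])
  then obtain C :: "nat \<Rightarrow> 'f an_point set" where C: "inj C" "range C \<subseteq> \<C>"
    using infinite_countable_subset by blast
  have "\<exists>y. y \<in> C n" for n using nonempty_connected_components_of[of "C n" ?T] C(2) by (auto simp: \<C>_def)
  then obtain y where y: "\<And>n. y n \<in> C n" by metis
  have Csub: "C n \<subseteq> an_points v e" for n
    using connected_components_of_subset[of "C n" ?T] C(2) by (auto simp: \<C>_def)
  have disj: "C1 = C2" if "C1 \<in> \<C>" "C2 \<in> \<C>" "z \<in> C1" "z \<in> C2" for C1 C2 z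
    using connected_components_of_disjoint[of C1 ?T C2] that by (auto simp: \<C>_def disjnt_iff)
  have same: "n = m" if "y n \<in> D" "y m \<in> D" "D \<in> \<C>" for n m D
  proof -
    have "C n = D" "C m = D" using disj[of "C n" D "y n"] disj[of "C m" D "y m"] that y C(2) by auto
    then show ?thesis using C(1) by (auto dest: injD)
  qed
  have "inj y"
  proof (rule injI)
    fix n m assume "y n = y m"
    then show "n = m" using same[of n "C n" m] y[of n] C(2) by auto
  qed
  have yp: "y n \<in> an_points v e" for n using y Csub by blast
  obtain B F where F: "F \<noteq> bot" "F \<le> sequentially" "\<And>f. ((\<lambda>n. point_abs v e (y n) f) \<longlongrightarrow> B f) F"
    using pointwise_cluster[of "\<lambda>n. point_abs v e (y n)"] by metis
  have "absolute_value v e B"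
    by (rule absolute_value_limit[OF absolute_value_point[OF ff v yp] F(1,3)])
  then obtain x where x: "x \<in> an_points v e" "\<And>f. regular_at x f \<Longrightarrow> B f = ennreal (pt_abs v e x f)"
    using absolute_value_is_point[OF ff v] by blast
  \<comment> \<open>The basic open sets omit a nonempty set of closed points, so a second closed point is needed
    to see that \<open>x\<close> belongs to the underlying set of the topology.\<close>
  have "\<exists>Q\<in>places e. x \<noteq> Closed Q"
  proof -
    have "\<exists>P. P \<in> places e"
    proof -
      have "y 0 \<in> topspace (an_topology v e)"
        using op[of "C 0"] y[of 0] C(2) openin_subset by blast
      then show ?thesis by (auto simp: an_topology_def topology_generated_by_topspace)
    qed
    then obtain P where P: "P \<in> places e" by blast
    then obtain Q where "Q \<in> places e" "Q \<noteq> P" using another_place[OF ff] by blast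
    then show ?thesis using P by (cases "x = Closed P") auto
  qed
  then obtain Q where Q: "Q \<in> places e" "x \<noteq> Closed Q" by blast
  have "x \<in> topspace (an_topology v e)"
  proof -
    let ?U = "{z \<in> an_points v e - Closed ` {Q}. -1 < pt_abs v e z 0 \<and> pt_abs v e z 0 < 1}"
    have "pt_abs v e x 0 = 0"
    proof (cases x)
      case (Closed P)
      then have "P \<in> places e" using x(1) by (auto simp: an_points_def)
      then show ?thesis using pt_abs_Closed[OF emb, of P 0 0 v] Closed
        by (simp add: field_embedding_0[OF emb] val_abs_def)
    qed (simp add: val_abs_def)
    then have "x \<in> ?U" using x(1) Q(2) by auto
    moreover have "openin (an_topology v e) ?U"
      unfolding an_topology_def by (rule topology_generated_by_Basis) (intro CollectI exI[of _ "{Q}"] exI[of _ 0] exI[of _ "-1"] exI[of _ 1], use Q(1) in auto)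
    ultimately show ?thesis using openin_subset by blast
  qed
  then have "x \<in> \<Union>\<C>" using x(1) by (simp add: \<C>_def Union_connected_components_of)
  then obtain D where D: "D \<in> \<C>" "x \<in> D" by blast
  have ev: "\<forall>\<^sub>F n in F. y n \<in> D"
    by (rule convergent_in_analytification[OF x(2) F(3) yp \<open>inj y\<close> F(2) op[OF D(1)] D(2)])
  then obtain n where n: "y n \<in> D" using F(1) eventually_happens by blast
  have "\<forall>\<^sub>F m in F. n < m" using F(2) eventually_gt_at_top by (rule filter_leD)
  with ev have "\<forall>\<^sub>F m in F. y m \<in> D \<and> n < m" by (rule eventually_conj)
  then obtain m where "y m \<in> D" "n < m" using F(1) eventually_happens by blast
  then show False using same[OF n _ D(1), of m] by simp
qed

section \<open>Reduction of the lattice\<close>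

theorem lemma7p9:
  fixes v :: "'k::alg_closed_field \<Rightarrow> real" and e :: "'k \<Rightarrow> 'f::field"
    and V :: "'f an_point set" and D :: "('f \<Rightarrow> int) \<Rightarrow> int" and H :: "'f set" and r :: nat
    and a :: "real \<Rightarrow> 'k" and h :: "'f an_point \<Rightarrow> real"
  assumes "analytic_curve v e"
    and "semistable_vertex_set v e V"
    and "is_divisor e D"
    and "H \<subseteq> riemann_roch_space e D"
    and "module.subspace (\<lambda>c f. e c * f) H"
    and "vector_space.dim (\<lambda>c f. e c * f) H = r + 1"
    and "\<And>s. s \<in> value_group v \<Longrightarrow> a s \<noteq> 0 \<and> v (a s) = s"
    and "\<And>s s'. s \<in> value_group v \<Longrightarrow> s' \<in> value_group v \<Longrightarrow> a (s + s') = a s * a s'"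
    and "graph_rational_function v e V h"
    and "rational_divisor v e V (graph_div v e V h)"
    and "h ` V \<subseteq> value_group v"
    and "admissible v e V (\<lambda>x. retract_divisor v e V D x + graph_div v e V h x)"
  shows "free_of_rank (val_ring v) (M_mod e V H h) (r + 1) \<and>
    red_map e V a h \<in> carrier (M_mod e V H h) \<rightarrow> carrier (reduced_sum v e V a H) \<and>
    (\<exists>\<phi> \<in> module_iso (residue_field v)
        (reduced_module (val_ring v) (val_ideal v) (M_mod e V H h))
        (reduced_sum v e V a H \<lparr>carrier := W_set e V a H h\<rparr>).
      \<forall>f \<in> carrier (M_mod e V H h).
        red_map e V a h f = \<phi> (ideal_times_module (val_ring v) (val_ideal v) (M_mod e V H h)
          +>\<^bsub>M_mod e V H h\<^esub> f)) \<and>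
    submodule (W_set e V a H h) (residue_field v) (reduced_sum v e V a H) \<and>
    vector_space_of_dim (residue_field v)
      (reduced_sum v e V a H \<lparr>carrier := W_set e V a H h\<rparr>) (r + 1)"
proof -
  have V: "finite V" "\<And>x. x \<in> V \<Longrightarrow> type2 v e x"
    using assms(2) by (auto simp: semistable_vertex_set_def)
  obtain b \<phi> where "lattice_reduction v e V H a h (r + 1) b \<phi>"
  proof (rule lattice_reduction_exists[OF assms(1) V(1) _ V(2) assms(5,6)])
    show "V \<noteq> {}" by (rule semistable_vertex_set_nonempty[OF assms(1,2)])
    show "h x \<in> value_group v" if "x \<in> V" for x using assms(11) that by blast
  qed (use assms(7) in auto)
  then show ?thesis by (rule lattice_reduction.reduction_theorem)
qed

end
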